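(* For $j=1,\dots,r$ let $d_j\ge1$, $n_j=d_j+1$, and let $M_j$ be a free abelian group of rank $d_j$ generated by $v_{j1},\dots,v_{jn_j}$ with the single relation $v_{j1}+\dots+v_{jn_j}=0$; let $M=M_1\oplus\dots\oplus M_r$, $d=d_1+\dots+d_r$, $\Delta=\mathrm{conv}\{v_{ji}\}\subset M_{\mathbb R}$ (reflexive) and $$f(t)=1-\sum_{j=1}^r\sum_{i=1}^{n_j}a_{ji}t^{v_{ji}}.$$ For a monomial $x^k=\prod_{j,i}x_{ji}^{k_{ji}}$ of degree $d$ in variables $x_{ji}$ ($1\le i\le n_j$, $1\le j\le r$), with $k_j=\sum_ik_{ji}$, let $R_{x^k}=(-1)^d\mathrm{Res}_f\big(t_0^d\prod_{j,i}(a_{ji}t^{v_{ji}})^{k_{ji}}\big)$. Put $u_j=n_j^{n_j}a_{j1}\cdots a_{jn_j}$. Then $R_{x^k}$ is the rational function of $u_1,\dots,u_r$ $$R_{x^k}(u)=n_1^{d_1-k_1-1}\cdots n_r^{d_r-k_r-1}\ \mathrm{tr}_{L/K}\left(\frac1{z_1^{d_1-k_1}\cdots z_r^{d_r-k_r}(1-z_1-\dots-z_r)}\right),$$ where $K=\mathbb C(u_1,\dots,u_r)$, $L=K(z_1,\dots,z_r)$ with $z_j^{n_j}=u_j$, and $\mathrm{tr}_{L/K}(g)=\sum g(z_1,\dots,z_r)$ summed over all $n_1\cdots n_r$ solutions of $z_j^{n_j}=u_j$ ($1\le j\le r$).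
   Context: For a reflexive $d$-dimensional lattice polytope $\Delta\subset M_{\mathbb R}$, $S_\Delta=\bigoplus_kS^k_\Delta\subset\mathbb C[t_0,t^{\pm1}]$ with $S^k_\Delta$ spanned by $t_0^kt^m$, $m\in k\Delta\cap M$. For a Laurent polynomial $f$ supported in $\Delta$ put $f_i=t_i\partial f/\partial t_i$, $F_0=t_0f$, $F_i=t_0f_i$; for $\Delta$-regular $f$ (i.e. $F_0,\dots,F_d$ regular in $S_\Delta$) let $H'_f=t_0^d\det M_f$, $M_f$ the $(d+1)\times(d+1)$ matrix with first row and first column $(f,f_1,\dots,f_d)$ and $(i,j)$-entry $t_i\partial f_j/\partial t_i$ for $1\le i,j\le d$. The toric residue $\mathrm{Res}_f:S^d_\Delta\to\mathbb C$ is the linear map vanishing on $\sum_iF_iS^{d-1}_\Delta$ with $\mathrm{Res}_f(H'_f)=\mathrm{Vol}(\Delta)$ ($d!$ times Euclidean volume); it is a rational function of the coefficients $a_{ji}$. *)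

theory Defs
  imports "HOL-Analysis.Analysis" "HOL-Library.Poly_Mapping" "HOL-Combinatorics.Permutations"
begin

text \<open>Laurent polynomials in t_0, t_1, ..., t_d with complex coefficients.
  An exponent vector is a finitely supported map nat to int; coordinate 0 is
  the exponent of t_0, coordinates 1..d are those of t_1..t_d (the lattice M = Z^d).\<close>
type_synonym lpoly = "(nat \<Rightarrow>\<^sub>0 int) \<Rightarrow>\<^sub>0 complex"

definition in_dil :: "(nat \<Rightarrow>\<^sub>0 int) set \<Rightarrow> nat \<Rightarrow> (nat \<Rightarrow>\<^sub>0 int) \<Rightarrow> bool" where
  "in_dil V k m \<longleftrightarrow> (\<exists>c::(nat \<Rightarrow>\<^sub>0 int) \<Rightarrow> real. (\<forall>v\<in>V. c v \<ge> 0) \<and> (\<Sum>v\<in>V. c v) = real k \<and>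
      (\<forall>p\<ge>1. real_of_int (Poly_Mapping.lookup m p) = (\<Sum>v\<in>V. c v * real_of_int (Poly_Mapping.lookup v p))))"

definition S_deg :: "(nat \<Rightarrow>\<^sub>0 int) set \<Rightarrow> nat \<Rightarrow> lpoly set" where
  "S_deg V k = {p. \<forall>m\<in>Poly_Mapping.keys p. Poly_Mapping.lookup m 0 = int k \<and> in_dil V k m}"

definition S_ring :: "(nat \<Rightarrow>\<^sub>0 int) set \<Rightarrow> lpoly set" where
  "S_ring V = {p. \<forall>m\<in>Poly_Mapping.keys p. Poly_Mapping.lookup m 0 \<ge> 0 \<and> in_dil V (nat (Poly_Mapping.lookup m 0)) m}"

definition theta :: "nat \<Rightarrow> lpoly \<Rightarrow> lpoly" where
  "theta i p = (\<Sum>m\<in>Poly_Mapping.keys p. Poly_Mapping.single m (of_int (Poly_Mapping.lookup m i) * Poly_Mapping.lookup p m))"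

definition fder :: "lpoly \<Rightarrow> nat \<Rightarrow> lpoly" where
  "fder f i = (if i = 0 then f else theta i f)"

definition t0pow :: "nat \<Rightarrow> lpoly" where
  "t0pow k = Poly_Mapping.single (Poly_Mapping.single 0 (int k)) 1"

definition Fgen :: "lpoly \<Rightarrow> nat \<Rightarrow> lpoly" where
  "Fgen f i = t0pow 1 * fder f i"

definition Fideal :: "(nat \<Rightarrow>\<^sub>0 int) set \<Rightarrow> lpoly \<Rightarrow> nat \<Rightarrow> lpoly set" where
  "Fideal V f i = {(\<Sum>l<i. Fgen f l * h l) | h. \<forall>l<i. h l \<in> S_ring V}"

definition delta_regular :: "(nat \<Rightarrow>\<^sub>0 int) set \<Rightarrow> nat \<Rightarrow> lpoly \<Rightarrow> bool" where
  "delta_regular V d f \<longleftrightarrow>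
     (\<forall>i\<le>d. \<forall>g\<in>S_ring V. Fgen f i * g \<in> Fideal V f i \<longrightarrow> g \<in> Fideal V f i)
     \<and> \<not> S_ring V \<subseteq> Fideal V f (Suc d)"

text \<open>H'_f = t_0^d det M_f, M_f(i,j) = t_i d/dt_i (f_j) (with row/column 0 = (f, f_1,...,f_d)).\<close>
definition hessH :: "nat \<Rightarrow> lpoly \<Rightarrow> lpoly" where
  "hessH d f = t0pow d *
     (\<Sum>\<sigma> | \<sigma> permutes {0..d}. of_int (sign \<sigma>) * (\<Prod>i\<in>{0..d}. fder (fder f (\<sigma> i)) i))"

definition realDelta :: "nat \<Rightarrow> (nat \<Rightarrow>\<^sub>0 int) set \<Rightarrow> (nat \<Rightarrow> real) set" where
  "realDelta d V = {x \<in> PiE {1..d} (\<lambda>_. UNIV). \<exists>c::(nat \<Rightarrow>\<^sub>0 int) \<Rightarrow> real.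
      (\<forall>v\<in>V. c v \<ge> 0) \<and> (\<Sum>v\<in>V. c v) = 1 \<and>
      (\<forall>p\<in>{1..d}. x p = (\<Sum>v\<in>V. c v * real_of_int (Poly_Mapping.lookup v p)))}"

definition normVol :: "nat \<Rightarrow> (nat \<Rightarrow>\<^sub>0 int) set \<Rightarrow> real" where
  "normVol d V = fact d * measure (PiM {1..d} (\<lambda>_. lborel)) (realDelta d V)"

definition is_toric_res :: "(nat \<Rightarrow>\<^sub>0 int) set \<Rightarrow> nat \<Rightarrow> lpoly \<Rightarrow> (lpoly \<Rightarrow> complex) \<Rightarrow> bool" where
  "is_toric_res V d f R \<longleftrightarrow>
     (\<forall>p\<in>S_deg V d. \<forall>q\<in>S_deg V d. R (p + q) = R p + R q)
   \<and> (\<forall>c. \<forall>p\<in>S_deg V d. R (Poly_Mapping.single 0 c * p) = c * R p)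
   \<and> (\<forall>g. (\<forall>i\<le>d. g i \<in> S_deg V (d - 1)) \<longrightarrow> R (\<Sum>i\<le>d. Fgen f i * g i) = 0)
   \<and> R (hessH d f) = complex_of_real (normVol d V)
   \<and> (\<forall>p. p \<notin> S_deg V d \<longrightarrow> R p = 0)"

definition toric_res :: "(nat \<Rightarrow>\<^sub>0 int) set \<Rightarrow> nat \<Rightarrow> lpoly \<Rightarrow> lpoly \<Rightarrow> complex" where
  "toric_res V d f = (THE R. is_toric_res V d f R)"

text \<open>The concrete setting: blocks j < r with d_j = dd j; coordinate of the i-th
  basis vector (i < d_j) of block j is off j + i + 1.\<close>
definition off :: "(nat \<Rightarrow> nat) \<Rightarrow> nat \<Rightarrow> nat" where
  "off dd j = (\<Sum>l<j. dd l)"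

text \<open>v_{j,i} for i < n_j = d_j + 1 (0-based): basis vectors, and the last one is
  minus their sum, so that v_{j,0} + ... + v_{j,d_j} = 0.\<close>
definition vtx :: "(nat \<Rightarrow> nat) \<Rightarrow> nat \<Rightarrow> nat \<Rightarrow> (nat \<Rightarrow>\<^sub>0 int)" where
  "vtx dd j i = (if i < dd j then Poly_Mapping.single (off dd j + i + 1) 1
                 else - (\<Sum>i'<dd j. Poly_Mapping.single (off dd j + i' + 1) 1))"

definition Vset :: "nat \<Rightarrow> (nat \<Rightarrow> nat) \<Rightarrow> (nat \<Rightarrow>\<^sub>0 int) set" where
  "Vset r dd = {vtx dd j i | j i. j < r \<and> i < Suc (dd j)}"

definition fpoly :: "nat \<Rightarrow> (nat \<Rightarrow> nat) \<Rightarrow> (nat \<Rightarrow> nat \<Rightarrow> complex) \<Rightarrow> lpoly" where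
  "fpoly r dd a = 1 - (\<Sum>j<r. \<Sum>i<Suc (dd j). Poly_Mapping.single (vtx dd j i) (a j i))"

end

theory Submission
  imports Defs "HOL-Probability.Distributions" "Jordan_Normal_Form.Determinant"
begin

text \<open>
  Put \<open>x_{ji} = t_0 t^{v_{ji}}\<close>, \<open>Y_{ji} = a_{ji} x_{ji}\<close> and \<open>n_j = d_j + 1\<close>. The ring \<open>S\<close> is generated by \<open>t_0\<close>
  and the \<open>x_{ji}\<close>, with relations \<open>\<Prod>_i x_{ji} = t_0^{n_j}\<close>. Modulo \<open>J = (F_1, \<dots>, F_d)\<close> all the \<open>Y_{ji}\<close> of a
  block agree with one element \<open>y_j\<close>, and \<open>y_j^{n_j} = (\<Prod>_i a_{ji}) t_0^{n_j}\<close>. So (when no \<open>a_{ji}\<close> vanishes)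
  \<open>S / J\<close> is the homogeneous coordinate ring of the \<open>\<Prod> n_j\<close> points \<open>y_j = z_j / n_j\<close>, \<open>z_j^{n_j} = u_j\<close>, and
  \<open>F_0\<close> takes the value \<open>1 - \<Sum> z_j\<close> there.

  Regularity makes \<open>F_0\<close> a nonzerodivisor modulo \<open>J\<close>, which forces \<open>a_{ji} \<noteq> 0\<close> (otherwise \<open>F_0\<close> is nilpotent
  modulo \<open>J\<close>) and \<open>\<Sum> z_j \<noteq> 1\<close> (otherwise \<open>F_0\<close> kills the interpolation polynomial of a point).
  The weighted sum over the points of \<open>p(z) / (\<Prod> z_j^{d_j} (1 - \<Sum> z_j))\<close> then kills \<open>F_1, \<dots>, F_d\<close> trivially and
  \<open>F_0 S^{d-1}\<close> by orthogonality of characters; Fourier inversion on the points shows that its kernel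
  in degree \<open>d\<close> is exactly the ideal, so it is the residue up to a factor. The factor comes from the
  value of the Hessian, a block determinant, and from \<open>Vol(\<Delta>) = \<Prod> n_j\<close>.
\<close>

section \<open>Ideals generated by regular sequences\<close>

text \<open>\<open>delta_regular\<close> places \<open>F_0\<close> first in the sequence, whereas
  the argument needs \<open>F_0\<close> modulo \<open>F_1, ..., F_d\<close>; the exchange rests on
  every relation of a regular sequence being a Koszul relation.

  The degree \<open>d\<close> enters through one exponent. Modulo \<open>J\<close> every element of
  degree \<open>k\<close> is a combination of the monomials \<open>y^e\<close> with
  \<open>e_j <= d_j\<close> and total degree at most \<open>k\<close>, and these are independent
  functions on the points. The only such \<open>e\<close> of total degree \<open>d\<close> is
  \<open>(d_1, ..., d_r)\<close>, and summing over the points against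
  \<open>1 / \<Prod> z_j^{d_j}\<close> extracts its coefficient up to a nonzero factor. Hence that
  sum kills everything of degree \<open>d - 1\<close>, and conversely a function on the points comes
  from degree \<open>d - 1\<close> exactly when this coefficient vanishes. Applied to
  \<open>q / (1 - \<Sum> z_j)\<close>, this decides whether \<open>q\<close> of degree
  \<open>d\<close> is \<open>F_0\<close> times an element of degree \<open>d - 1\<close> modulo
  \<open>J\<close>.

  \<open>toric_res\<close> is a definite description, so existence and uniqueness of the residue
  must be settled before its value can be used; membership of the Hessian in degree \<open>d\<close>
  is part of this.\<close>

locale comm_subring =
  fixes S :: "'a::comm_ring_1 set"
  assumes one_closed [simp, intro]: "1 \<in> S"
    and diff_closed [simp, intro]: "x \<in> S \<Longrightarrow> y \<in> S \<Longrightarrow> x - y \<in> S"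
    and mult_closed [simp, intro]: "x \<in> S \<Longrightarrow> y \<in> S \<Longrightarrow> x * y \<in> S"
begin

lemma zero_closed [simp, intro]: "0 \<in> S"
  using diff_closed[OF one_closed one_closed] by simp

lemma uminus_closed [simp, intro]: "x \<in> S \<Longrightarrow> - x \<in> S"
  using diff_closed[OF zero_closed, of x] by simp

lemma add_closed [simp, intro]: "x \<in> S \<Longrightarrow> y \<in> S \<Longrightarrow> x + y \<in> S"
  using diff_closed[of x "- y"] by simp

lemma power_closed [simp, intro]: "x \<in> S \<Longrightarrow> x ^ n \<in> S"
  by (induction n) auto

lemma sum_closed [intro]: "(\<And>i. i \<in> A \<Longrightarrow> g i \<in> S) \<Longrightarrow> sum g A \<in> S"
  by (induction A rule: infinite_finite_induct) auto

lemma prod_closed [intro]: "(\<And>i. i \<in> A \<Longrightarrow> g i \<in> S) \<Longrightarrow> prod g A \<in> S"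
  by (induction A rule: infinite_finite_induct) auto

lemma of_nat_closed [simp, intro]: "of_nat n \<in> S"
  by (induction n) auto

text \<open>In the application the type contains all Laurent polynomials, where \<open>t_0\<close>
  is a unit; taking the coefficients in \<open>S\<close> is what makes this an ideal of
  \<open>S_ring V\<close>.\<close>

definition gen :: "('i \<Rightarrow> 'a) \<Rightarrow> 'i set \<Rightarrow> 'a set" where
  "gen F A = {(\<Sum>l\<in>A. F l * h l) | h. \<forall>l\<in>A. h l \<in> S}"

lemma genI: "(\<And>l. l \<in> A \<Longrightarrow> h l \<in> S) \<Longrightarrow> p = (\<Sum>l\<in>A. F l * h l) \<Longrightarrow> p \<in> gen F A"
  unfolding gen_def by blast

lemma genE:
  assumes "p \<in> gen F A"
  obtains h where "\<And>l. l \<in> A \<Longrightarrow> h l \<in> S" "p = (\<Sum>l\<in>A. F l * h l)"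
  using assms unfolding gen_def by blast

lemma gen_zero [simp]: "0 \<in> gen F A"
  by (rule genI[of _ "\<lambda>_. 0"]) auto

lemma gen_add: assumes "p \<in> gen F A" "q \<in> gen F A" shows "p + q \<in> gen F A"
proof -
  obtain h where h: "\<And>l. l \<in> A \<Longrightarrow> h l \<in> S" "p = (\<Sum>l\<in>A. F l * h l)" using assms(1) by (blast elim: genE)
  obtain h' where h': "\<And>l. l \<in> A \<Longrightarrow> h' l \<in> S" "q = (\<Sum>l\<in>A. F l * h' l)" using assms(2) by (blast elim: genE)
  show ?thesis by (rule genI[of _ "\<lambda>l. h l + h' l"]) (auto simp: h h' sum.distrib distrib_left)
qed

lemma gen_mult: assumes "p \<in> gen F A" "s \<in> S" shows "s * p \<in> gen F A"
proof -
  obtain h where h: "\<And>l. l \<in> A \<Longrightarrow> h l \<in> S" "p = (\<Sum>l\<in>A. F l * h l)" using assms(1) by (blast elim: genE)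
  show ?thesis by (rule genI[of _ "\<lambda>l. s * h l"]) (auto simp: h assms sum_distrib_left mult_ac)
qed

lemma gen_uminus: "p \<in> gen F A \<Longrightarrow> - p \<in> gen F A"
  using gen_mult[of p F A "- 1"] by simp

lemma gen_diff: "p \<in> gen F A \<Longrightarrow> q \<in> gen F A \<Longrightarrow> p - q \<in> gen F A"
  using gen_add[OF _ gen_uminus, of p F A q] by simp

lemma gen_sum: "(\<And>i. i \<in> B \<Longrightarrow> g i \<in> gen F A) \<Longrightarrow> sum g B \<in> gen F A"
  by (induction B rule: infinite_finite_induct) (auto intro: gen_add)

lemma gen_mono:
  assumes "finite B" "A \<subseteq> B" shows "gen F A \<subseteq> gen F B"
proof
  fix p assume "p \<in> gen F A"
  then obtain h where h: "\<And>l. l \<in> A \<Longrightarrow> h l \<in> S" "p = (\<Sum>l\<in>A. F l * h l)" by (blast elim: genE)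
  have "(\<Sum>l\<in>A. F l * h l) = (\<Sum>l\<in>B. F l * (if l \<in> A then h l else 0))"
    using assms by (intro sum.mono_neutral_cong_left) auto
  then show "p \<in> gen F B" by (intro genI[of _ "\<lambda>l. if l \<in> A then h l else 0"]) (auto simp: h)
qed

lemma gen_generator:
  assumes "finite A" "l \<in> A" shows "F l \<in> gen F A"
  by (rule genI[of _ "\<lambda>k. if k = l then 1 else 0"]) (use assms in \<open>auto simp: if_distrib cong: if_cong\<close>)

text \<open>In each term of the binomial expansion either the exponent of \<open>x\<close> reaches
  \<open>m\<close> or that of \<open>y\<close> reaches \<open>n\<close>. This makes nilpotency
  modulo an ideal additive.\<close>

lemma gen_power_add:
  assumes "x \<in> S" "y \<in> S" "x ^ m \<in> gen F A" "y ^ n \<in> gen F A"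
  shows "(x + y) ^ (m + n) \<in> gen F A"
proof -
  have up: "z ^ k \<in> gen F A" if "z \<in> S" "z ^ l \<in> gen F A" "l \<le> k" for z k l
    using gen_mult[OF that(2), of "z ^ (k - l)"] that by (simp add: power_add[symmetric])
  have "of_nat (m + n choose k) * x ^ k * y ^ (m + n - k) \<in> gen F A" for k
  proof (cases "m \<le> k")
    case True
    then show ?thesis using gen_mult[OF up[OF assms(1,3) True], of "of_nat (m + n choose k) * y ^ (m + n - k)"] assms
      by (simp add: mult_ac)
  next
    case False
    then have "n \<le> m + n - k" by simp
    then show ?thesis using gen_mult[OF up[OF assms(2,4), of "m + n - k"], of "of_nat (m + n choose k) * x ^ k"] assms
      by (simp add: mult_ac)
  qed
  then show ?thesis unfolding binomial_ring by (intro gen_sum)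
qed

lemma gen_power_sum:
  assumes "finite B" "\<And>i. i \<in> B \<Longrightarrow> g i \<in> S" "\<And>i. i \<in> B \<Longrightarrow> \<exists>n. g i ^ n \<in> gen F A"
  shows "\<exists>n. sum g B ^ n \<in> gen F A"
  using assms
proof (induction B rule: finite_induct)
  case empty
  show ?case by (rule exI[of _ 1]) simp
next
  case (insert i B)
  then obtain n where n: "sum g B ^ n \<in> gen F A" by auto
  obtain m where m: "g i ^ m \<in> gen F A" using insert by auto
  have "sum g B \<in> S" using insert by (intro sum_closed) auto
  then have "(g i + sum g B) ^ (m + n) \<in> gen F A" using insert m n by (intro gen_power_add) auto
  then show ?case using insert by auto
qed

text \<open>Every relation among the members of a regular sequence is a Koszul relation, so each member
  is a nonzerodivisor modulo all the others, whatever the order.\<close>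
lemma koszul_relation:
  fixes F :: "nat \<Rightarrow> 'a"
  assumes reg: "\<And>i g. i < n \<Longrightarrow> g \<in> S \<Longrightarrow> F i * g \<in> gen F {..<i} \<Longrightarrow> g \<in> gen F {..<i}"
    and F: "\<And>i. i < n \<Longrightarrow> F i \<in> S"
    and g: "\<And>i. i < n \<Longrightarrow> g i \<in> S" and rel: "(\<Sum>l<n. F l * g l) = 0" and i: "i < n"
  shows "g i \<in> gen F ({..<n} - {i})"
  using assms
proof (induction n arbitrary: g i)
  case 0
  then show ?case by simp
next
  case (Suc n)
  have "F n * g n = (\<Sum>l<n. F l * (- g l))"
    using Suc.prems(4) by (simp add: sum_negf eq_neg_iff_add_eq_0 add.commute)
  then have "F n * g n \<in> gen F {..<n}"
    using Suc.prems(3) by (intro genI[of _ "\<lambda>l. - g l"]) auto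
  then have gn: "g n \<in> gen F {..<n}" by (rule Suc.prems(1)[OF lessI Suc.prems(3)[OF lessI]])
  then obtain h where h: "\<And>l. l < n \<Longrightarrow> h l \<in> S" "g n = (\<Sum>l<n. F l * h l)"
    by (rule genE) (use lessThan_iff in blast)
  show ?case
  proof (cases "i = n")
    case True
    have "{..<Suc n} - {n} = {..<n}" by auto
    then show ?thesis using gn True by simp
  next
    case False
    \<comment> \<open>Regularity writes the last coefficient \<open>g n\<close> through the earlier
      generators; absorbing \<open>F n * g n\<close> into the other coefficients leaves a shorter
      relation for the induction.\<close>
    have "(\<Sum>l<n. F l * (g l + F n * h l)) = (\<Sum>l<n. F l * g l) + F n * (\<Sum>l<n. F l * h l)"
      by (simp add: distrib_left sum.distrib sum_distrib_left mult_ac)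
    also have "\<dots> = 0" using Suc.prems(4) h(2) by simp
    finally have rel': "(\<Sum>l<n. F l * (g l + F n * h l)) = 0" .
    have "g i + F n * h i \<in> gen F ({..<n} - {i})"
      by (rule Suc.IH[OF Suc.prems(1,2) _ rel']) (use Suc.prems(2,3,5) False h in simp_all)
    then have 1: "g i + F n * h i \<in> gen F ({..<Suc n} - {i})"
      by (rule subsetD[OF gen_mono, rotated -1]) auto
    have "h i * F n \<in> gen F ({..<Suc n} - {i})"
      using False Suc.prems(5) h by (intro gen_mult gen_generator) auto
    from gen_diff[OF 1 this] show ?thesis by (simp add: mult.commute)
  qed
qed

lemma regular_nonzerodivisor:
  fixes F :: "nat \<Rightarrow> 'a"
  assumes reg: "\<And>i g. i < n \<Longrightarrow> g \<in> S \<Longrightarrow> F i * g \<in> gen F {..<i} \<Longrightarrow> g \<in> gen F {..<i}"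
    and F: "\<And>i. i < n \<Longrightarrow> F i \<in> S"
    and g: "g \<in> S" and i: "i < n" and mem: "F i * g \<in> gen F ({..<n} - {i})"
  shows "g \<in> gen F ({..<n} - {i})"
proof -
  obtain h where h: "\<And>l. l \<in> {..<n} - {i} \<Longrightarrow> h l \<in> S" "F i * g = (\<Sum>l\<in>{..<n}-{i}. F l * h l)"
    by (rule genE[OF mem]) blast
  \<comment> \<open>The membership is read as a relation among all generators whose coefficient at
    \<open>i\<close> is \<open>- g\<close>.\<close>
  define h' where "h' = h(i := - g)"
  have "(\<Sum>l<n. F l * h' l) = F i * h' i + (\<Sum>l\<in>{..<n}-{i}. F l * h' l)"
    using i by (intro sum.remove) auto
  also have "(\<Sum>l\<in>{..<n}-{i}. F l * h' l) = F i * g"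
    unfolding h(2) by (intro sum.cong) (auto simp: h'_def)
  finally have "(\<Sum>l<n. F l * h' l) = 0" by (simp add: h'_def)
  have "h' i \<in> gen F ({..<n} - {i})"
    by (rule koszul_relation[OF reg F _ \<open>(\<Sum>l<n. F l * h' l) = 0\<close> i]) (use h(1) g in \<open>simp_all add: h'_def\<close>)
  then show ?thesis using gen_uminus[of "- g" F] by (simp add: h'_def)
qed

lemma gen_cong_mult:
  assumes "x \<in> S" "y' \<in> S" "x - x' \<in> gen F A" "y - y' \<in> gen F A"
  shows "x * y - x' * y' \<in> gen F A"
  using gen_add[OF gen_mult[OF assms(4,1)] gen_mult[OF assms(3,2)]] by (simp add: algebra_simps)

lemma gen_cong_power:
  assumes "x \<in> S" "x' \<in> S" "x - x' \<in> gen F A"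
  shows "x ^ n - x' ^ n \<in> gen F A"
  by (induction n) (use assms in \<open>auto intro: gen_cong_mult\<close>)

lemma gen_cong_prod:
  assumes "\<And>i. i \<in> B \<Longrightarrow> g i \<in> S" "\<And>i. i \<in> B \<Longrightarrow> g' i \<in> S" "\<And>i. i \<in> B \<Longrightarrow> g i - g' i \<in> gen F A"
  shows "prod g B - prod g' B \<in> gen F A"
  using assms
  by (induction B rule: infinite_finite_induct) (auto intro!: gen_cong_mult prod_closed)

lemma gen_cong_trans: "x - y \<in> gen F A \<Longrightarrow> y - z \<in> gen F A \<Longrightarrow> x - z \<in> gen F A"
  using gen_add[of "x - y" F A "y - z"] by simp

lemma gen_cong_sym: "x - y \<in> gen F A \<Longrightarrow> y - x \<in> gen F A"
  using gen_uminus[of "x - y" F A] by simp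

end

section \<open>The graded ring of a polytope\<close>

lemma poly_mapping_sum_single:
  "p = (\<Sum>m\<in>Poly_Mapping.keys p. Poly_Mapping.single m (Poly_Mapping.lookup p m))"
  by (rule poly_mapping_eqI)
    (auto simp: lookup_sum lookup_single when_def in_keys_iff if_distrib cong: if_cong)

lemma poly_mapping_induct [case_names single add]:
  assumes "\<And>m c. P (Poly_Mapping.single m c)" "\<And>p q. P p \<Longrightarrow> P q \<Longrightarrow> P (p + q)"
  shows "P (p :: 'a \<Rightarrow>\<^sub>0 'b::comm_monoid_add)"
proof -
  have "P (\<Sum>m\<in>B. Poly_Mapping.single m (Poly_Mapping.lookup p m))" for B
    using assms(1)[of undefined 0] by (induction B rule: infinite_finite_induct) (auto intro: assms)
  then show ?thesis by (subst poly_mapping_sum_single)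
qed

text \<open>For multiplicative \<open>\<phi>\<close> this is the ring homomorphism evaluating a
  Laurent polynomial at a point of the torus.\<close>

definition mon_eval :: "('a \<Rightarrow> complex) \<Rightarrow> ('a \<Rightarrow>\<^sub>0 complex) \<Rightarrow> complex" where
  "mon_eval \<phi> p = (\<Sum>m\<in>Poly_Mapping.keys p. Poly_Mapping.lookup p m * \<phi> m)"

lemma mon_eval_superset:
  "finite B \<Longrightarrow> Poly_Mapping.keys p \<subseteq> B \<Longrightarrow> mon_eval \<phi> p = (\<Sum>m\<in>B. Poly_Mapping.lookup p m * \<phi> m)"
  unfolding mon_eval_def by (rule sum.mono_neutral_left) (auto simp: in_keys_iff)

lemma mon_eval_zero [simp]: "mon_eval \<phi> 0 = 0" by (simp add: mon_eval_def)

lemma mon_eval_single [simp]: "mon_eval \<phi> (Poly_Mapping.single m c) = c * \<phi> m"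
  by (simp add: mon_eval_def)

lemma mon_eval_add [simp]: "mon_eval \<phi> (p + q) = mon_eval \<phi> p + mon_eval \<phi> q"
proof -
  let ?B = "Poly_Mapping.keys p \<union> Poly_Mapping.keys q"
  have "Poly_Mapping.keys (p + q) \<subseteq> ?B" by (rule Poly_Mapping.keys_add)
  then show ?thesis
    by (simp add: mon_eval_superset[of ?B] lookup_add distrib_right sum.distrib)
qed

lemma mon_eval_sum [simp]: "mon_eval \<phi> (sum g B) = (\<Sum>i\<in>B. mon_eval \<phi> (g i))"
  by (induction B rule: infinite_finite_induct) auto

lemma mon_eval_uminus [simp]: "mon_eval \<phi> (- p) = - mon_eval \<phi> p"
  using mon_eval_add[of \<phi> p "- p"] by (simp add: eq_neg_iff_add_eq_0 add.commute)

lemma mon_eval_diff [simp]: "mon_eval \<phi> (p - q) = mon_eval \<phi> p - mon_eval \<phi> q"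
  using mon_eval_add[of \<phi> p "- q"] by simp

lemma mon_eval_mult:
  assumes "\<And>m m'. \<phi> (m + m') = \<phi> m * \<phi> m'"
  shows "mon_eval \<phi> (p * q) = mon_eval \<phi> p * mon_eval \<phi> (q :: 'a::monoid_add \<Rightarrow>\<^sub>0 complex)"
proof (induction p rule: poly_mapping_induct)
  case (single m c)
  show ?case
    by (induction q rule: poly_mapping_induct) (auto simp: mult_single assms distrib_left)
qed (auto simp: distrib_right)

lemma lookup_theta: "Poly_Mapping.lookup (theta i p) m = of_int (Poly_Mapping.lookup m i) * Poly_Mapping.lookup p m"
  by (auto simp: theta_def lookup_sum lookup_single when_def in_keys_iff if_distrib cong: if_cong)

lemma theta_single [simp]:
  "theta i (Poly_Mapping.single m c) = Poly_Mapping.single m (of_int (Poly_Mapping.lookup m i) * c)"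
  by (rule poly_mapping_eqI) (auto simp: lookup_theta lookup_single when_def)

lemma theta_sum [simp]: "theta i (sum g B) = (\<Sum>b\<in>B. theta i (g b))"
  by (rule poly_mapping_eqI) (simp add: lookup_theta lookup_sum sum_distrib_left)

lemma in_dil_add:
  assumes "in_dil V k m" "in_dil V k' m'"
  shows "in_dil V (k + k') (m + m')"
proof -
  obtain c where c: "\<forall>v\<in>V. c v \<ge> 0" "(\<Sum>v\<in>V. c v) = real k"
      "\<forall>p\<ge>1. real_of_int (Poly_Mapping.lookup m p) = (\<Sum>v\<in>V. c v * real_of_int (Poly_Mapping.lookup v p))"
    using assms(1) unfolding in_dil_def by blast
  obtain c' where c': "\<forall>v\<in>V. c' v \<ge> 0" "(\<Sum>v\<in>V. c' v) = real k'"
      "\<forall>p\<ge>1. real_of_int (Poly_Mapping.lookup m' p) = (\<Sum>v\<in>V. c' v * real_of_int (Poly_Mapping.lookup v p))"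
    using assms(2) unfolding in_dil_def by blast
  show ?thesis unfolding in_dil_def
    by (rule exI[of _ "\<lambda>v. c v + c' v"]) (use c c' in \<open>auto simp: lookup_add sum.distrib distrib_right\<close>)
qed

lemma in_dil_zero: "in_dil V 0 0"
  unfolding in_dil_def by (rule exI[of _ "\<lambda>_. 0"]) auto

lemma S_ring_comm_subring: "comm_subring (S_ring V)"
proof
  show "1 \<in> S_ring V" by (simp add: S_ring_def in_dil_zero)
  show "x - y \<in> S_ring V" if "x \<in> S_ring V" "y \<in> S_ring V" for x y
    using that Poly_Mapping.keys_add[of x "- y"] by (auto simp: S_ring_def)
  show "x * y \<in> S_ring V" if xy: "x \<in> S_ring V" "y \<in> S_ring V" for x y
  proof -
    {
      fix m assume "m \<in> Poly_Mapping.keys (x * y)"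
      then obtain a b where ab: "m = a + b" "a \<in> Poly_Mapping.keys x" "b \<in> Poly_Mapping.keys y"
        using keys_mult[of x y] by blast
      then have "Poly_Mapping.lookup a 0 \<ge> 0" "in_dil V (nat (Poly_Mapping.lookup a 0)) a"
          "Poly_Mapping.lookup b 0 \<ge> 0" "in_dil V (nat (Poly_Mapping.lookup b 0)) b"
        using xy by (auto simp: S_ring_def)
      then have "Poly_Mapping.lookup m 0 \<ge> 0 \<and> in_dil V (nat (Poly_Mapping.lookup m 0)) m"
        using in_dil_add[of V "nat (Poly_Mapping.lookup a 0)" a "nat (Poly_Mapping.lookup b 0)" b]
        by (simp add: ab lookup_add nat_add_distrib)
    }
    then show ?thesis by (auto simp: S_ring_def)
  qed
qed

lemma S_deg_subset_S_ring: "S_deg V k \<subseteq> S_ring V"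
  by (auto simp: S_deg_def S_ring_def)

lemma S_deg_zero [simp]: "0 \<in> S_deg V k" by (simp add: S_deg_def)

lemma S_deg_add: "p \<in> S_deg V k \<Longrightarrow> q \<in> S_deg V k \<Longrightarrow> p + q \<in> S_deg V k"
  using Poly_Mapping.keys_add[of p q] by (auto simp: S_deg_def)

lemma S_deg_uminus: "p \<in> S_deg V k \<Longrightarrow> - p \<in> S_deg V k"
  by (auto simp: S_deg_def)

lemma S_deg_diff: "p \<in> S_deg V k \<Longrightarrow> q \<in> S_deg V k \<Longrightarrow> p - q \<in> S_deg V k"
  using S_deg_add[OF _ S_deg_uminus, of p V k q] by simp

lemma S_deg_sum: "(\<And>i. i \<in> B \<Longrightarrow> g i \<in> S_deg V k) \<Longrightarrow> sum g B \<in> S_deg V k"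
  by (induction B rule: infinite_finite_induct) (auto intro: S_deg_add)

lemma S_deg_mult:
  assumes "p \<in> S_deg V k" "q \<in> S_deg V l" shows "p * q \<in> S_deg V (k + l)"
proof -
  {
    fix m assume "m \<in> Poly_Mapping.keys (p * q)"
    then obtain a b where ab: "m = a + b" "a \<in> Poly_Mapping.keys p" "b \<in> Poly_Mapping.keys q"
      using keys_mult[of p q] by blast
    then have "Poly_Mapping.lookup m 0 = int (k + l) \<and> in_dil V (k + l) m"
      using assms by (auto simp: S_deg_def lookup_add intro: in_dil_add)
  }
  then show ?thesis by (auto simp: S_deg_def)
qed

lemma S_deg_const: "Poly_Mapping.single 0 c \<in> S_deg V 0"
  by (auto simp: S_deg_def in_dil_zero)

lemma S_deg_smult: "p \<in> S_deg V k \<Longrightarrow> Poly_Mapping.single 0 c * p \<in> S_deg V k"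
  using S_deg_mult[OF S_deg_const, of p V k c] by simp

lemma S_deg_one: "1 \<in> S_deg V 0"
  using S_deg_const[of 1 V] by simp

lemma S_deg_power: "p \<in> S_deg V k \<Longrightarrow> p ^ n \<in> S_deg V (k * n)"
  by (induction n) (simp_all add: S_deg_one S_deg_mult)

lemma S_deg_prod: "finite B \<Longrightarrow> (\<And>i. i \<in> B \<Longrightarrow> g i \<in> S_deg V (k i)) \<Longrightarrow> prod g B \<in> S_deg V (sum k B)"
  by (induction B rule: finite_induct) (auto simp: S_deg_one intro: S_deg_mult)

definition deg_part :: "nat \<Rightarrow> lpoly \<Rightarrow> lpoly" where
  "deg_part k p = (\<Sum>m\<in>Poly_Mapping.keys p. if Poly_Mapping.lookup m 0 = int k then Poly_Mapping.single m (Poly_Mapping.lookup p m) else 0)"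

lemma lookup_deg_part:
  "Poly_Mapping.lookup (deg_part k p) m = (if Poly_Mapping.lookup m 0 = int k then Poly_Mapping.lookup p m else 0)"
proof -
  have "Poly_Mapping.lookup (deg_part k p) m =
    (\<Sum>m'\<in>Poly_Mapping.keys p. if m' = m then (if Poly_Mapping.lookup m 0 = int k then Poly_Mapping.lookup p m else 0) else 0)"
    unfolding deg_part_def lookup_sum by (intro sum.cong) (auto simp: lookup_single)
  then show ?thesis by (auto simp: in_keys_iff)
qed

lemma deg_part_in_S_deg: "p \<in> S_ring V \<Longrightarrow> deg_part k p \<in> S_deg V k"
  by (force simp: S_deg_def S_ring_def in_keys_iff lookup_deg_part split: if_splits)

lemma deg_part_id: "p \<in> S_deg V k \<Longrightarrow> deg_part k p = p"
  by (rule poly_mapping_eqI) (auto simp: lookup_deg_part S_deg_def in_keys_iff)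

lemma deg_part_add: "deg_part k (p + q) = deg_part k p + deg_part k q"
  by (rule poly_mapping_eqI) (auto simp: lookup_deg_part lookup_add)

lemma deg_part_sum: "deg_part k (sum g B) = (\<Sum>i\<in>B. deg_part k (g i))"
  by (rule poly_mapping_eqI) (simp add: lookup_deg_part lookup_sum)

lemma deg_part_single:
  "deg_part k (Poly_Mapping.single m c) = (if Poly_Mapping.lookup m 0 = int k then Poly_Mapping.single m c else 0)"
  by (rule poly_mapping_eqI) (auto simp: lookup_deg_part lookup_single when_def)

text \<open>Allows a homogeneous element of the ideal of the \<open>F_i\<close> to be rewritten with
  homogeneous coefficients of degree one less, as the definition of the residue demands.\<close>

lemma deg_part_mult:
  assumes "\<And>m. m \<in> Poly_Mapping.keys p \<Longrightarrow> Poly_Mapping.lookup m 0 = 1"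
  shows "deg_part (Suc k) (p * q) = p * deg_part k q"
proof -
  have single: "deg_part (Suc k) (Poly_Mapping.single m c * q) = Poly_Mapping.single m c * deg_part k q"
    if "Poly_Mapping.lookup m 0 = 1" for m c
    using that
    by (induction q rule: poly_mapping_induct)
      (auto simp: mult_single deg_part_single deg_part_add distrib_left lookup_add)
  have "deg_part (Suc k) ((\<Sum>m\<in>Poly_Mapping.keys p. Poly_Mapping.single m (Poly_Mapping.lookup p m)) * q)
     = (\<Sum>m\<in>Poly_Mapping.keys p. Poly_Mapping.single m (Poly_Mapping.lookup p m)) * deg_part k q"
    unfolding sum_distrib_right deg_part_sum by (intro sum.cong refl single assms)
  then show ?thesis by (simp only: poly_mapping_sum_single[of p, symmetric])
qed

lemma single_power:
  "(Poly_Mapping.single m c :: 'a::comm_monoid_add \<Rightarrow>\<^sub>0 'b::comm_semiring_1) ^ n = Poly_Mapping.single (\<Sum>_<n. m) (c ^ n)"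
  by (induction n) (simp_all add: mult_single add.commute)

lemma prod_single:
  "(\<Prod>i\<in>B. Poly_Mapping.single (m i) (c i) :: 'a::comm_monoid_add \<Rightarrow>\<^sub>0 'b::comm_semiring_1)
     = Poly_Mapping.single (\<Sum>i\<in>B. m i) (\<Prod>i\<in>B. c i)"
  by (induction B rule: infinite_finite_induct) (simp_all add: mult_single)

section \<open>Coordinates of the blocks\<close>

lemma off_Suc: "off dd (Suc j) = off dd j + dd j" by (simp add: off_def)

lemma off_mono: "j \<le> k \<Longrightarrow> off dd j \<le> off dd k"
  unfolding off_def by (intro sum_mono2) auto

definition block :: "(nat \<Rightarrow> nat) \<Rightarrow> nat \<Rightarrow> nat set" where
  "block dd j = {off dd j + 1..off dd j + dd j}"

lemma block_subset: "j < r \<Longrightarrow> block dd j \<subseteq> {1..off dd r}"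
  using off_mono[of "Suc j" r dd] by (auto simp: block_def off_Suc)

lemma coord_exhaust:
  assumes "p \<in> {1..off dd r}"
  obtains j i where "j < r" "i < dd j" "p = off dd j + i + 1"
proof -
  have "\<exists>j<r. \<exists>i<dd j. p = off dd j + i + 1"
    using assms
  proof (induction r)
    case (Suc r)
    show ?case
    proof (cases "p \<le> off dd r")
      case True
      then show ?thesis using Suc by (auto intro: less_SucI)
    next
      case False
      then show ?thesis using Suc.prems
        by (intro exI[of _ r] conjI exI[of _ "p - off dd r - 1"]) (auto simp: off_Suc)
    qed
  qed (simp add: off_def)
  then show ?thesis using that by blast
qed

lemma coord_less:
  assumes "j < j'" "i < dd j" shows "off dd j + i < off dd j' + i'"
  using off_mono[of "Suc j" j' dd] assms by (simp add: off_Suc)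

lemma coord_unique:
  assumes "i < dd j" "i' < dd j'"
  shows "off dd j + i = off dd j' + i' \<longleftrightarrow> j = j' \<and> i = i'"
proof (cases j j' rule: linorder_cases)
  case less
  then show ?thesis using coord_less[of j j' i dd i'] assms by auto
next
  case greater
  then show ?thesis using coord_less[of j' j i' dd i] assms by auto
qed auto

lemma block_eq_image: "block dd j = (\<lambda>l. off dd j + l + 1) ` {..<dd j}"
proof (intro equalityI subsetI)
  fix x assume "x \<in> block dd j"
  then have "x = off dd j + (x - off dd j - 1) + 1" "x - off dd j - 1 < dd j" by (auto simp: block_def)
  then show "x \<in> (\<lambda>l. off dd j + l + 1) ` {..<dd j}" by blast
qed (auto simp: block_def)

section \<open>An integral computing the volume\<close>

text \<open>Both the closed and the open ray occur, because \<open>exp_block_gauge_split\<close>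
  breaks ties for the minimum by the index.\<close>

lemma nn_integral_exp_shifted:
  fixes c :: real
  assumes "A = {c..} \<or> A = {c<..}"
  shows "(\<integral>\<^sup>+ y. ennreal (exp (- (y - c))) * indicator A y \<partial>lborel) = 1"
proof -
  have "(\<integral>\<^sup>+ y. ennreal (exp (- (y - c))) * indicator A y \<partial>lborel)
      = (\<integral>\<^sup>+ y. ennreal (exp (- (y - c))) * indicator {c..} y \<partial>lborel)"
    by (rule nn_integral_cong_AE, use AE_lborel_singleton[of c] in eventually_elim)
      (use assms in \<open>auto simp: indicator_def\<close>)
  also have "\<dots> = (\<integral>\<^sup>+ y. ennreal (exp (- y)) * indicator {0..} y \<partial>lborel)"
    by (subst nn_integral_real_affine[where c = 1 and t = c])
      (auto simp: indicator_def intro!: nn_integral_cong)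
  also have "\<dots> = 1"
    using nn_intergal_power_times_exp_Ici[of 0] by simp
  finally show ?thesis .
qed

lemma nn_integral_exp_neg: "(\<integral>\<^sup>+ y. ennreal (exp y) * indicator {..<0::real} y \<partial>lborel) = 1"
proof -
  have "(\<integral>\<^sup>+ y. ennreal (exp y) * indicator {..<0::real} y \<partial>lborel)
     = (\<integral>\<^sup>+ y. ennreal (exp (- (y - 0))) * indicator {0<..} y \<partial>lborel)"
    by (subst nn_integral_real_affine[where c = "-1" and t = 0])
      (auto simp: indicator_def intro!: nn_integral_cong)
  then show ?thesis using nn_integral_exp_shifted[of "{0<..}" 0] by simp
qed

text \<open>The Minkowski gauge of the simplex with vertices the basis vectors of \<open>J\<close>
  and minus their sum. The cheapest way to write \<open>x\<close> gives the last vertex the weight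
  \<open>M = max(0, - x_i)\<close> and the others \<open>x_i + M\<close>; the total weight is this
  formula.\<close>

definition block_gauge :: "nat set \<Rightarrow> (nat \<Rightarrow> real) \<Rightarrow> real" where
  "block_gauge J x = sum x J + (real (card J) + 1) * Max (insert 0 ((\<lambda>i. - x i) ` J))"

lemma block_gauge_cong: "(\<And>i. i \<in> J \<Longrightarrow> x i = y i) \<Longrightarrow> block_gauge J x = block_gauge J y"
  unfolding block_gauge_def by (simp cong: sum.cong image_cong)

lemma block_gauge_measurable [measurable]:
  assumes [simp]: "finite J" "J \<subseteq> I"
  shows "block_gauge J \<in> borel_measurable (PiM I (\<lambda>_. lborel))"
proof -
  have [measurable]: "(\<lambda>x. x i) \<in> borel_measurable (PiM I (\<lambda>_. lborel :: real measure))" if "i \<in> J" for i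
    using measurable_component_singleton[of i I "\<lambda>_. lborel :: real measure"] subsetD[OF assms(2) that] by auto
  \<comment> \<open>Indexing the extra element 0 by \<open>None\<close> presents the set as the
    image of one finite family, the form that \<open>borel_measurable_Max\<close> handles.\<close>
  have eq: "insert 0 ((\<lambda>i. - x i) ` J) = (\<lambda>i. case i of None \<Rightarrow> 0 | Some i \<Rightarrow> - x i) ` (insert None (Some ` J))"
    for x :: "nat \<Rightarrow> real" by (auto simp: image_image)
  have "(\<lambda>x. Max ((\<lambda>i. case i of None \<Rightarrow> 0 | Some i \<Rightarrow> - x i) ` (insert None (Some ` J))))
      \<in> borel_measurable (PiM I (\<lambda>_. lborel :: real measure))"
    by (rule borel_measurable_Max) auto
  then have [measurable]: "(\<lambda>x. Max (insert 0 ((\<lambda>i. - x i) ` J))) \<in> borel_measurable (PiM I (\<lambda>_. lborel :: real measure))"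
    by (simp only: eq)
  show ?thesis unfolding block_gauge_def[abs_def] by measurable
qed

lemma block_gauge_scale:
  assumes "finite J" "s \<ge> 0"
  shows "block_gauge J (\<lambda>i. s * x i) = s * block_gauge J x"
proof -
  have "Max (insert 0 ((\<lambda>i. - (s * x i)) ` J)) = Max ((\<lambda>y. s * y) ` insert 0 ((\<lambda>i. - x i) ` J))"
    by (simp add: image_image)
  also have "\<dots> = s * Max (insert 0 ((\<lambda>i. - x i) ` J))"
    using assms by (intro mono_Max_commute[symmetric]) (auto simp: mono_def mult_left_mono)
  finally show ?thesis by (simp add: block_gauge_def sum_distrib_left algebra_simps)
qed

text \<open>A case split on the smallest coordinate. Either all coordinates are nonnegative, or
  there is a unique first index \<open>i\<close> attaining the negative minimum; strictness for
  smaller indices makes the cases disjoint. In that case the gauge is the sum of the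
  \<open>x l - x i\<close> minus \<open>x i\<close>, so its exponential factors.\<close>

lemma exp_block_gauge_split:
  fixes x :: "nat \<Rightarrow> real"
  assumes fin: "finite J"
  shows "ennreal (exp (- block_gauge J x)) =
     (\<Prod>l\<in>J. ennreal (exp (- (x l - 0))) * indicator {0..} (x l)) +
     (\<Sum>i\<in>J. (ennreal (exp (x i)) * indicator {..<0} (x i)) *
        (\<Prod>l\<in>J-{i}. ennreal (exp (- (x l - x i))) * indicator (if l < i then {x i<..} else {x i..}) (x l)))"
   (is "_ = ?A + (\<Sum>i\<in>J. ?B i)")
proof (cases "\<forall>l\<in>J. 0 \<le> x l")
  case True
  have "Max (insert 0 ((\<lambda>i. - x i) ` J)) = 0"
    using True fin by (intro Max_eqI) auto
  then have "block_gauge J x = sum x J" by (simp add: block_gauge_def)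
  moreover have "?A = (\<Prod>l\<in>J. ennreal (exp (- x l)))"
    using True by (intro prod.cong) (auto simp: indicator_def)
  moreover have "\<dots> = ennreal (exp (- sum x J))"
    using fin by (simp add: prod_ennreal exp_sum[symmetric] sum_negf)
  moreover have "(\<Sum>i\<in>J. ?B i) = 0" using True by (intro sum.neutral) (auto simp: indicator_def)
  ultimately show ?thesis by simp
next
  case False
  define m where "m = Min (x ` J)"
  have ne: "J \<noteq> {}" using False by auto
  have mle: "m \<le> x l" if "l \<in> J" for l using that fin by (simp add: m_def)
  have "m \<in> x ` J" unfolding m_def using fin ne by (intro Min_in) auto
  then have ex: "\<exists>i. i \<in> J \<and> x i = m" by auto
  define i where "i = (LEAST i. i \<in> J \<and> x i = m)"
  have i: "i \<in> J" "x i = m" using LeastI_ex[OF ex] by (auto simp: i_def)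
  have least: "\<not> (l \<in> J \<and> x l = m)" if "l < i" for l using not_less_Least that unfolding i_def by blast
  have neg: "m < 0" using False mle by force
  have "Max (insert 0 ((\<lambda>i. - x i) ` J)) = - m"
    using fin i neg mle by (intro Max_eqI) auto
  then have "block_gauge J x = sum x (J - {i}) + x i - (real (card J) + 1) * m"
    using fin i by (simp add: block_gauge_def sum.remove[of J i])
  also have "\<dots> = (\<Sum>l\<in>J-{i}. x l - x i) - x i"
    using fin i ne by (simp add: sum_subtractf card_Diff_singleton_if of_nat_diff Suc_leI card_gt_0_iff algebra_simps)
  finally have bg: "- block_gauge J x = x i + (\<Sum>l\<in>J-{i}. - (x l - x i))"
    by (simp only: sum_negf)
  have "?B i = ennreal (exp (x i)) * (\<Prod>l\<in>J-{i}. ennreal (exp (- (x l - x i))))"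
  proof (intro arg_cong2[of _ _ _ _ "(*)"] prod.cong refl)
    show "ennreal (exp (x i)) * indicator {..<0} (x i) = ennreal (exp (x i))"
      using neg i by (simp add: indicator_def)
    fix l assume l: "l \<in> J - {i}"
    have "x l \<noteq> m" if "l < i" using least[OF that] l by auto
    then show "ennreal (exp (- (x l - x i))) * indicator (if l < i then {x i<..} else {x i..}) (x l)
       = ennreal (exp (- (x l - x i)))"
      using mle[of l] l i by (auto simp: indicator_def)
  qed
  also have "\<dots> = ennreal (exp (- block_gauge J x))"
    unfolding bg using fin by (simp add: prod_ennreal exp_sum[symmetric] ennreal_mult[symmetric] exp_add[symmetric])
  finally have Bi: "?B i = ennreal (exp (- block_gauge J x))" .
  have B0: "?B i' = 0" if i': "i' \<in> J" "i' \<noteq> i" for i'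
  proof -
    have "i \<in> J - {i'}" using i i' by auto
    moreover have "indicator (if i < i' then {x i'<..} else {x i'..}) (x i) = (0::ennreal)"
      using mle[OF i'(1)] least[of i'] i i' by (auto simp: indicator_def)
    ultimately have "(\<Prod>l\<in>J-{i'}. ennreal (exp (- (x l - x i'))) * indicator (if l < i' then {x i'<..} else {x i'..}) (x l)) = 0"
      using fin by (auto intro!: prod_zero bexI[of _ i])
    then show ?thesis by simp
  qed
  have "(\<Sum>i\<in>J. ?B i) = ?B i" using fin i B0 by (subst sum.remove[of J i]) auto
  moreover have "?A = 0" using False fin by (auto intro!: prod_zero simp: indicator_def)
  ultimately show ?thesis using Bi by simp
qed

text \<open>Each of the \<open>card J + 1\<close> pieces of the split has integral 1: with
  \<open>x i\<close> fixed, the other coordinates integrate to 1 each, which leaves the exponential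
  over the negative ray.\<close>

lemma nn_integral_exp_block_gauge:
  assumes fin: "finite J"
  shows "(\<integral>\<^sup>+ x. ennreal (exp (- block_gauge J x)) \<partial>PiM J (\<lambda>_. lborel)) = of_nat (card J + 1)"
proof -
  interpret product_sigma_finite "\<lambda>_::nat. lborel :: real measure" ..
  define h where "h i l y z = ennreal (exp (- (y - z))) * indicator (if l < i then {z<..} else {z..}) y"
    for i l :: nat and y z :: real
  \<comment> \<open>The set under the indicator depends on \<open>z\<close>; written as a
    comparison, the function is visibly jointly measurable in \<open>y\<close> and
    \<open>z\<close>.\<close>
  have h_eq: "h i l y z = (if l < i then ennreal (exp (- (y - z))) * (if z < y then 1 else 0)
       else ennreal (exp (- (y - z))) * (if z \<le> y then 1 else 0))" for i l y z
    by (auto simp: h_def indicator_def)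
  have h_meas: "(\<lambda>x. h i l (f x) (g x)) \<in> borel_measurable M"
    if [measurable]: "f \<in> borel_measurable M" "g \<in> borel_measurable M"
    for i l and f g :: "'b \<Rightarrow> real" and M
    unfolding h_eq by measurable
  let ?B = "\<lambda>i x. (ennreal (exp (x i)) * indicator {..<0} (x i)) * (\<Prod>l\<in>J-{i}. h i l (x l) (x i))"
  have comp [measurable]: "(\<lambda>x. x i) \<in> borel_measurable (PiM J (\<lambda>_. lborel :: real measure))" if "i \<in> J" for i
    using measurable_component_singleton[of i J "\<lambda>_. lborel :: real measure"] that by auto
  have Bm: "?B i \<in> borel_measurable (PiM J (\<lambda>_. lborel))" if "i \<in> J" for i
    using that by (intro borel_measurable_times_ennreal borel_measurable_prod_ennreal h_meas) auto
  have "(\<integral>\<^sup>+ x. ennreal (exp (- block_gauge J x)) \<partial>PiM J (\<lambda>_. lborel))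
      = (\<integral>\<^sup>+ x. (\<Prod>l\<in>J. ennreal (exp (- (x l - 0))) * indicator {0..} (x l)) + (\<Sum>i\<in>J. ?B i x) \<partial>PiM J (\<lambda>_. lborel))"
    unfolding h_def by (intro nn_integral_cong exp_block_gauge_split fin)
  also have "\<dots> = (\<integral>\<^sup>+ x. (\<Prod>l\<in>J. ennreal (exp (- (x l - 0))) * indicator {0..} (x l)) \<partial>PiM J (\<lambda>_. lborel))
      + (\<Sum>i\<in>J. (\<integral>\<^sup>+ x. ?B i x \<partial>PiM J (\<lambda>_. lborel)))"
    using Bm by (subst nn_integral_add) (auto simp: nn_integral_sum intro!: borel_measurable_prod_ennreal borel_measurable_sum)
  also have "(\<integral>\<^sup>+ x. (\<Prod>l\<in>J. ennreal (exp (- (x l - 0))) * indicator {0..} (x l)) \<partial>PiM J (\<lambda>_. lborel)) = 1"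
    using nn_integral_exp_shifted[of "{0..}" 0]
    by (subst product_nn_integral_prod[OF fin]) auto
  also have "(\<Sum>i\<in>J. (\<integral>\<^sup>+ x. ?B i x \<partial>PiM J (\<lambda>_. lborel))) = (\<Sum>i\<in>J. 1)"
  proof (rule sum.cong[OF refl])
    fix i assume i: "i \<in> J"
    have ins: "insert i (J - {i}) = J" using i by auto
    have "(\<integral>\<^sup>+ x. ?B i x \<partial>PiM J (\<lambda>_. lborel)) =
       (\<integral>\<^sup>+ y. (\<integral>\<^sup>+ x. ?B i (x(i := y)) \<partial>(PiM (J - {i}) (\<lambda>_. lborel))) \<partial>lborel)"
      using product_nn_integral_insert_rev[of "J - {i}" i "?B i"] Bm[OF i] fin ins by simp
    also have "\<dots> = (\<integral>\<^sup>+ y. ennreal (exp y) * indicator {..<0} y *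
        (\<integral>\<^sup>+ x. (\<Prod>l\<in>J-{i}. h i l (x l) y) \<partial>(PiM (J - {i}) (\<lambda>_. lborel))) \<partial>lborel)"
    proof (rule nn_integral_cong)
      fix y :: real
      have "(\<integral>\<^sup>+ x. ?B i (x(i := y)) \<partial>(PiM (J - {i}) (\<lambda>_. lborel)))
          = (\<integral>\<^sup>+ x. ennreal (exp y) * indicator {..<0} y * (\<Prod>l\<in>J-{i}. h i l (x l) y) \<partial>(PiM (J - {i}) (\<lambda>_. lborel)))"
        by (intro nn_integral_cong arg_cong2[of _ _ _ _ "(*)"] prod.cong) auto
      also have "\<dots> = ennreal (exp y) * indicator {..<0} y * (\<integral>\<^sup>+ x. (\<Prod>l\<in>J-{i}. h i l (x l) y) \<partial>(PiM (J - {i}) (\<lambda>_. lborel)))"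
      proof (rule nn_integral_cmult, intro borel_measurable_prod_ennreal h_meas)
        fix l assume "l \<in> J - {i}"
        then show "(\<lambda>x. x l) \<in> borel_measurable (PiM (J - {i}) (\<lambda>_. lborel))"
          using measurable_component_singleton[of l "J - {i}" "\<lambda>_. lborel :: real measure"] by auto
      qed auto
      finally show "(\<integral>\<^sup>+ x. ?B i (x(i := y)) \<partial>(PiM (J - {i}) (\<lambda>_. lborel)))
          = ennreal (exp y) * indicator {..<0} y * (\<integral>\<^sup>+ x. (\<Prod>l\<in>J-{i}. h i l (x l) y) \<partial>(PiM (J - {i}) (\<lambda>_. lborel)))" .
    qed
    also have "\<dots> = (\<integral>\<^sup>+ y. ennreal (exp y) * indicator {..<0} y \<partial>lborel)"
    proof (rule nn_integral_cong)
      fix y :: real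
      have 1: "(\<integral>\<^sup>+ w. h i l w y \<partial>lborel) = 1" for l
        unfolding h_def by (intro nn_integral_exp_shifted) auto
      have "(\<integral>\<^sup>+ x. (\<Prod>l\<in>J-{i}. h i l (x l) y) \<partial>(PiM (J - {i}) (\<lambda>_. lborel)))
          = (\<Prod>l\<in>J-{i}. (\<integral>\<^sup>+ w. h i l w y \<partial>lborel))"
        using fin by (intro product_nn_integral_prod[where f = "\<lambda>l w. h i l w y"] h_meas) auto
      then show "ennreal (exp y) * indicator {..<0} y * (\<integral>\<^sup>+ x. (\<Prod>l\<in>J-{i}. h i l (x l) y) \<partial>(PiM (J - {i}) (\<lambda>_. lborel)))
          = ennreal (exp y) * indicator {..<0} y" by (simp add: 1)
    qed
    also have "\<dots> = 1" by (rule nn_integral_exp_neg)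
    finally show "(\<integral>\<^sup>+ x. ?B i x \<partial>PiM J (\<lambda>_. lborel)) = 1" .
  qed
  finally show ?thesis by simp
qed

text \<open>A dilation acts on each coordinate separately, so its Jacobian is collected by
  one-dimensional substitutions.\<close>

lemma nn_integral_PiM_scale:
  fixes h :: "('i \<Rightarrow> real) \<Rightarrow> ennreal"
  assumes "finite I" "s > 0" "h \<in> borel_measurable (PiM I (\<lambda>_. lborel))"
  shows "(\<integral>\<^sup>+ x. h x \<partial>PiM I (\<lambda>_. lborel)) = ennreal (s ^ card I) * (\<integral>\<^sup>+ x. h (\<lambda>i\<in>I. s * x i) \<partial>PiM I (\<lambda>_. lborel))"
  using assms(1,3)
proof (induction I arbitrary: h rule: finite_induct)
  case empty
  interpret product_sigma_finite "\<lambda>_::'i. lborel :: real measure" ..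
  show ?case by (simp add: nn_integral_empty restrict_def del: nn_integral_const)
next
  case (insert i I)
  interpret product_sigma_finite "\<lambda>_::'i. lborel :: real measure" ..
  note [measurable] = insert.prems
  note [simp] = insert.hyps
  have m1 [measurable]: "(\<lambda>x. \<lambda>j\<in>insert i I. s * x j) \<in> measurable (PiM (insert i I) (\<lambda>_. lborel)) (PiM (insert i I) (\<lambda>_. lborel))"
    by (rule measurable_restrict) (auto intro!: borel_measurable_times measurable_component_singleton[of _ _ "\<lambda>_. lborel :: real measure", simplified])
  have meas: "(\<lambda>y. \<integral>\<^sup>+ x. h ((\<lambda>j\<in>I. s * x j)(i := y)) \<partial>PiM I (\<lambda>_. lborel)) \<in> borel_measurable lborel"
  proof -
    interpret I: finite_product_sigma_finite "\<lambda>_::'i. lborel :: real measure" I by standard auto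
    have [measurable]: "(\<lambda>x. \<lambda>j\<in>I. s * x j) \<in> measurable (PiM I (\<lambda>_. lborel)) (PiM I (\<lambda>_. lborel))"
      by (rule measurable_restrict) (auto intro!: borel_measurable_times measurable_component_singleton[of _ _ "\<lambda>_. lborel :: real measure", simplified])
    show ?thesis by measurable
  qed
  have "(\<integral>\<^sup>+ x. h x \<partial>PiM (insert i I) (\<lambda>_. lborel)) = (\<integral>\<^sup>+ y. (\<integral>\<^sup>+ x. h (x(i := y)) \<partial>PiM I (\<lambda>_. lborel)) \<partial>lborel)"
    by (intro product_nn_integral_insert_rev) auto
  also have "\<dots> = (\<integral>\<^sup>+ y. ennreal (s ^ card I) * (\<integral>\<^sup>+ x. h ((\<lambda>j\<in>I. s * x j)(i := y)) \<partial>PiM I (\<lambda>_. lborel)) \<partial>lborel)"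
    by (intro nn_integral_cong insert.IH) measurable
  also have "\<dots> = ennreal (s ^ card I) * (\<integral>\<^sup>+ y. (\<integral>\<^sup>+ x. h ((\<lambda>j\<in>I. s * x j)(i := y)) \<partial>PiM I (\<lambda>_. lborel)) \<partial>lborel)"
    by (rule nn_integral_cmult[OF meas])
  also have "(\<integral>\<^sup>+ y. (\<integral>\<^sup>+ x. h ((\<lambda>j\<in>I. s * x j)(i := y)) \<partial>PiM I (\<lambda>_. lborel)) \<partial>lborel)
     = ennreal s * (\<integral>\<^sup>+ y. (\<integral>\<^sup>+ x. h ((\<lambda>j\<in>I. s * x j)(i := s * y)) \<partial>PiM I (\<lambda>_. lborel)) \<partial>lborel)"
    using nn_integral_real_affine[OF meas[simplified], where c = s and t = 0] assms(2) by simp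
  also have "(\<integral>\<^sup>+ y. (\<integral>\<^sup>+ x. h ((\<lambda>j\<in>I. s * x j)(i := s * y)) \<partial>PiM I (\<lambda>_. lborel)) \<partial>lborel)
     = (\<integral>\<^sup>+ y. (\<integral>\<^sup>+ x. h (\<lambda>j\<in>insert i I. s * (x(i := y)) j) \<partial>PiM I (\<lambda>_. lborel)) \<partial>lborel)"
    by (intro nn_integral_cong arg_cong[of _ _ h]) (auto simp: fun_eq_iff restrict_def)
  also have "\<dots> = (\<integral>\<^sup>+ x. h (\<lambda>j\<in>insert i I. s * x j) \<partial>PiM (insert i I) (\<lambda>_. lborel))"
    by (rule product_nn_integral_insert_rev[symmetric]) auto
  finally have "(\<integral>\<^sup>+ x. h x \<partial>PiM (insert i I) (\<lambda>_. lborel)) = ennreal (s ^ card I) *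
     (ennreal s * (\<integral>\<^sup>+ x. h (\<lambda>j\<in>insert i I. s * x j) \<partial>PiM (insert i I) (\<lambda>_. lborel)))" .
  moreover have "ennreal (s ^ card (insert i I)) = ennreal (s ^ card I) * ennreal s"
    using assms(2) by (simp add: ennreal_mult mult.commute)
  ultimately show ?case by (simp only: mult.assoc)
qed

text \<open>Slicing \<open>exp (- N x)\<close> into the sublevel sets of \<open>N\<close>, whose volumes scale like \<open>s ^ card I\<close>,
  turns the volume of a polytope into an integral that factors over the blocks.\<close>
lemma nn_integral_exp_gauge:
  fixes N :: "('i \<Rightarrow> real) \<Rightarrow> real"
  assumes fin: "finite I" and N [measurable]: "N \<in> borel_measurable (PiM I (\<lambda>_. lborel))"
    and nonneg: "\<And>x. N x \<ge> 0" and scale: "\<And>s x. s > 0 \<Longrightarrow> N (\<lambda>i\<in>I. s * x i) = s * N x"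
  shows "(\<integral>\<^sup>+ x. ennreal (exp (- N x)) \<partial>PiM I (\<lambda>_. lborel))
     = ennreal (fact (card I)) * emeasure (PiM I (\<lambda>_. lborel)) {x \<in> space (PiM I (\<lambda>_. lborel)). N x \<le> 1}"
proof -
  interpret product_sigma_finite "\<lambda>_::'i. lborel :: real measure" ..
  interpret I: finite_product_sigma_finite "\<lambda>_::'i. lborel :: real measure" I by standard (rule fin)
  interpret P: pair_sigma_finite "PiM I (\<lambda>_. lborel :: real measure)" "lborel :: real measure" ..
  let ?P = "PiM I (\<lambda>_. lborel :: real measure)"
  let ?V = "emeasure ?P {x \<in> space ?P. N x \<le> 1}"
  \<comment> \<open>For fixed \<open>x\<close>, integrating \<open>k s (N x)\<close> over
    \<open>s\<close> returns \<open>exp (- N x)\<close>; for fixed \<open>s\<close> it cuts out the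
    sublevel set of \<open>N\<close> at \<open>s\<close>.\<close>
  define k where "k s y = ennreal (exp (- s)) * (if y \<le> s then 1 else 0)" for s y :: real
  have k_meas [measurable]: "(\<lambda>p. k (snd p) (N (fst p))) \<in> borel_measurable (?P \<Otimes>\<^sub>M lborel)"
    unfolding k_def by measurable
  have "(\<integral>\<^sup>+ x. ennreal (exp (- N x)) \<partial>?P) = (\<integral>\<^sup>+ x. (\<integral>\<^sup>+ s. k s (N x) \<partial>lborel) \<partial>?P)"
  proof (rule nn_integral_cong)
    fix x
    have "(\<integral>\<^sup>+ s. k s (N x) \<partial>lborel)
        = (\<integral>\<^sup>+ s. ennreal (exp (- N x)) * (ennreal (exp (- (s - N x))) * indicator {N x..} s) \<partial>lborel)"
      by (intro nn_integral_cong)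
        (auto simp: k_def indicator_def ennreal_mult[symmetric] exp_add[symmetric])
    also have "\<dots> = ennreal (exp (- N x)) * 1"
      by (subst nn_integral_cmult) (use nn_integral_exp_shifted[of "{N x..}" "N x"] in auto)
    finally show "ennreal (exp (- N x)) = (\<integral>\<^sup>+ s. k s (N x) \<partial>lborel)" by simp
  qed
  also have "\<dots> = (\<integral>\<^sup>+ s. (\<integral>\<^sup>+ x. k s (N x) \<partial>?P) \<partial>lborel)"
    using P.Fubini[OF k_meas] by simp
  also have "\<dots> = (\<integral>\<^sup>+ s. ?V * (ennreal (s ^ card I * exp (- s)) * indicator {0..} s) \<partial>lborel)"
  \<comment> \<open>At \<open>s = 0\<close> the dilation degenerates, so this null set is removed;
    for \<open>s < 0\<close> the sublevel set is empty.\<close>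
  proof (rule nn_integral_cong_AE, use AE_lborel_singleton[of 0] in eventually_elim)
    fix s :: real assume s: "s \<noteq> 0"
    show "(\<integral>\<^sup>+ x. k s (N x) \<partial>?P) = ?V * (ennreal (s ^ card I * exp (- s)) * indicator {0..} s)"
    proof (cases "s > 0")
      case False
      then have "k s (N x) = 0" for x using s nonneg[of x] by (auto simp: k_def)
      then show ?thesis using False s by (simp add: indicator_def)
    next
      case True
      have [measurable]: "(\<lambda>x. k s (N x)) \<in> borel_measurable ?P" unfolding k_def by measurable
      have "(\<integral>\<^sup>+ x. k s (N x) \<partial>?P) = ennreal (s ^ card I) * (\<integral>\<^sup>+ x. k s (N (\<lambda>i\<in>I. s * x i)) \<partial>?P)"
        using nn_integral_PiM_scale[OF fin True, of "\<lambda>x. k s (N x)"] by simp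
      also have "(\<integral>\<^sup>+ x. k s (N (\<lambda>i\<in>I. s * x i)) \<partial>?P)
          = (\<integral>\<^sup>+ x. ennreal (exp (- s)) * indicator {x \<in> space ?P. N x \<le> 1} x \<partial>?P)"
        using True by (intro nn_integral_cong) (auto simp: k_def scale indicator_def)
      also have "\<dots> = ennreal (exp (- s)) * ?V" by (subst nn_integral_cmult_indicator) auto
      finally show ?thesis using True by (simp add: ennreal_mult mult_ac)
    qed
  qed
  \<comment> \<open>The Gamma integral of \<open>s ^ card I * exp (- s)\<close> supplies the
    factorial that \<open>normVol\<close> contains.\<close>
  also have "\<dots> = ?V * ennreal (fact (card I))"
    by (subst nn_integral_cmult) (auto simp: nn_intergal_power_times_exp_Ici)
  finally show ?thesis by (simp add: mult.commute)
qed

lemma nn_integral_exp_sum_block_gauge: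
  "(\<integral>\<^sup>+ x. ennreal (exp (- (\<Sum>j<r. block_gauge (block dd j) x))) \<partial>PiM {1..off dd r} (\<lambda>_. lborel))
     = (\<Prod>j<r. of_nat (dd j + 1))"
proof (induction r)
  case 0
  interpret product_sigma_finite "\<lambda>_::nat. lborel :: real measure" ..
  show ?case by (simp add: off_def nn_integral_empty del: nn_integral_const)
next
  case (Suc r)
  interpret product_sigma_finite "\<lambda>_::nat. lborel :: real measure" ..
  let ?I = "{1..off dd r}" and ?J = "block dd r"
  have U: "{1..off dd (Suc r)} = ?I \<union> ?J" by (auto simp: block_def off_Suc)
  have fin: "finite (block dd j)" for j by (simp add: block_def)
  have disj: "?I \<inter> ?J = {}" by (auto simp: block_def)
  have bm: "(\<lambda>x. block_gauge (block dd j) x) \<in> borel_measurable (PiM (?I \<union> ?J) (\<lambda>_. lborel))" if "j < Suc r" for j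
    using block_subset[OF that, of dd, unfolded U] fin by (intro block_gauge_measurable) auto
  have [measurable]: "(\<lambda>x. \<Sum>j<Suc r. block_gauge (block dd j) x) \<in> borel_measurable (PiM (?I \<union> ?J) (\<lambda>_. lborel))"
    using bm by (intro borel_measurable_sum) auto
  have "(\<integral>\<^sup>+ x. ennreal (exp (- (\<Sum>j<Suc r. block_gauge (block dd j) x))) \<partial>PiM (?I \<union> ?J) (\<lambda>_. lborel))
     = (\<integral>\<^sup>+ x. (\<integral>\<^sup>+ y. ennreal (exp (- (\<Sum>j<Suc r. block_gauge (block dd j) (merge ?I ?J (x, y)))))
          \<partial>PiM ?J (\<lambda>_. lborel)) \<partial>PiM ?I (\<lambda>_. lborel))"
    by (rule product_nn_integral_fold[OF disj]) (use fin in simp, use fin in simp, measurable)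
  also have "\<dots> = (\<integral>\<^sup>+ x. (\<integral>\<^sup>+ y. ennreal (exp (- (\<Sum>j<r. block_gauge (block dd j) x))) *
      ennreal (exp (- block_gauge ?J y)) \<partial>PiM ?J (\<lambda>_. lborel)) \<partial>PiM ?I (\<lambda>_. lborel))"
  proof (intro nn_integral_cong)
    fix x y :: "nat \<Rightarrow> real"
    have 1: "block_gauge (block dd j) (merge ?I ?J (x, y)) = block_gauge (block dd j) x" if "j < r" for j
      using block_subset[OF that, of dd] by (intro block_gauge_cong) (auto simp: merge_def)
    have 2: "block_gauge ?J (merge ?I ?J (x, y)) = block_gauge ?J y"
      using disj by (intro block_gauge_cong) (auto simp: merge_def)
    show "ennreal (exp (- (\<Sum>j<Suc r. block_gauge (block dd j) (merge ?I ?J (x, y))))) =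
       ennreal (exp (- (\<Sum>j<r. block_gauge (block dd j) x))) * ennreal (exp (- block_gauge ?J y))"
      by (simp add: 1[simplified] 2[simplified] ennreal_mult[symmetric] exp_add[symmetric])
  qed
  also have "\<dots> = (\<integral>\<^sup>+ x. ennreal (exp (- (\<Sum>j<r. block_gauge (block dd j) x))) * of_nat (dd r + 1) \<partial>PiM ?I (\<lambda>_. lborel))"
  proof (intro nn_integral_cong, subst nn_integral_cmult)
    have [measurable]: "block_gauge ?J \<in> borel_measurable (PiM ?J (\<lambda>_. lborel))"
      by (intro block_gauge_measurable fin) auto
    show "(\<lambda>y. ennreal (exp (- block_gauge ?J y))) \<in> borel_measurable (PiM ?J (\<lambda>_. lborel))" by measurable
  qed (simp_all add: nn_integral_exp_block_gauge fin, simp add: block_def)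
  also have "\<dots> = (\<integral>\<^sup>+ x. ennreal (exp (- (\<Sum>j<r. block_gauge (block dd j) x))) \<partial>PiM ?I (\<lambda>_. lborel)) * of_nat (dd r + 1)"
  proof (rule nn_integral_multc)
    have [measurable]: "(\<lambda>x. \<Sum>j<r. block_gauge (block dd j) x) \<in> borel_measurable (PiM ?I (\<lambda>_. lborel))"
      by (intro borel_measurable_sum block_gauge_measurable fin block_subset) simp
    show "(\<lambda>x. ennreal (exp (- (\<Sum>j<r. block_gauge (block dd j) x)))) \<in> borel_measurable (PiM ?I (\<lambda>_. lborel))" by measurable
  qed
  finally show ?case unfolding U Suc.IH by simp
qed

section \<open>Determinants\<close>

text \<open>Removes the terms with a repeated exponent from the expanded Hessian in
  \<open>hessH_in_S_deg\<close>.\<close>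

lemma leibniz_identical_rows_zero:
  fixes b :: "nat \<Rightarrow> nat \<Rightarrow> complex"
  assumes "i < n" "j < n" "i \<noteq> j" "b i = b j"
  shows "(\<Sum>\<sigma> | \<sigma> permutes {0..<n}. of_int (sign \<sigma>) * (\<Prod>i\<in>{0..<n}. b i (\<sigma> i))) = 0"
proof -
  let ?A = "Matrix.mat n n (\<lambda>(i, j). b i j)"
  have "Determinant.det ?A = 0"
    by (rule det_identical_rows[of _ n i j]) (use assms in \<open>auto intro!: eq_vecI\<close>)
  moreover have "Determinant.det ?A = (\<Sum>\<sigma> | \<sigma> permutes {0..<n}. of_int (sign \<sigma>) * (\<Prod>i\<in>{0..<n}. b i (\<sigma> i)))"
    unfolding Determinant.det_def
    by (auto intro!: sum.cong prod.cong simp: permutes_in_image)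
  ultimately show ?thesis by simp
qed

text \<open>The matrix is \<open>c\<close> times \<open>B = I + W U\<close>, the identity plus a
  rank-one matrix. The products \<open>X Y\<close> and \<open>Y X\<close> of two block matrices have
  determinants \<open>det (I + W U)\<close> and \<open>1 + U W = n + 1\<close>, which therefore
  agree.\<close>

lemma det_one_plus_ones:
  "Determinant.det (Matrix.mat n n (\<lambda>(i, j). c * (if i = j then 2 else 1))) = (c :: complex) ^ n * of_nat (n + 1)"
proof -
  define B where "B = Matrix.mat n n (\<lambda>(i, j). if i = j then 2 else (1::complex))"
  define U where "U = Matrix.mat (Suc 0) n (\<lambda>_. 1 :: complex)"
  define W where "W = Matrix.mat n (Suc 0) (\<lambda>_. 1 :: complex)"
  have car: "B \<in> carrier_mat n n" "U \<in> carrier_mat (Suc 0) n" "- U \<in> carrier_mat (Suc 0) n" "W \<in> carrier_mat n (Suc 0)"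
    by (auto simp: B_def U_def W_def)
  let ?O = "1\<^sub>m (Suc 0) :: complex mat" and ?I = "1\<^sub>m n :: complex mat"
  let ?Z = "0\<^sub>m n (Suc 0) :: complex mat"
  define X where "X = four_block_mat ?O (- U) W ?I"
  define Y where "Y = four_block_mat ?O U ?Z ?I"
  have X: "X \<in> carrier_mat (Suc n) (Suc n)" and Y: "Y \<in> carrier_mat (Suc n) (Suc n)"
    unfolding X_def Y_def using four_block_carrier_mat[of ?O "Suc 0" "Suc 0" ?I n n] by auto
  have UW: "?O * ?O + U * W = Matrix.mat 1 1 (\<lambda>_. of_nat (n + 1))"
    by (rule eq_matI) (auto simp: W_def U_def scalar_prod_def)
  have "X * Y = four_block_mat (?O * ?O + - U * ?Z) (?O * U + - U * ?I) (W * ?O + ?I * ?Z) (W * U + ?I * ?I)"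
    unfolding X_def Y_def using car
    by (intro mult_four_block_mat[of _ "Suc 0" "Suc 0" _ n _ n _ _ "Suc 0" _ n]) auto
  also have "?O * ?O + - U * ?Z = ?O" by (rule eq_matI) (auto simp: U_def scalar_prod_def)
  also have "?O * U + - U * ?I = 0\<^sub>m (Suc 0) n" using car by auto
  also have "W * ?O + ?I * ?Z = W" using car by auto
  also have "W * U + ?I * ?I = B" by (rule eq_matI) (auto simp: W_def U_def B_def scalar_prod_def)
  finally have "Determinant.det (X * Y) = Determinant.det ?O * Determinant.det B"
    using det_four_block_mat_upper_right_zero[of ?O "Suc 0" "0\<^sub>m (Suc 0) n" n W B] car by simp
  then have 1: "Determinant.det X * Determinant.det Y = Determinant.det B"
    using X Y by (simp add: det_mult)
  have "Y * X = four_block_mat (?O * ?O + U * W) (?O * - U + U * ?I) (?Z * ?O + ?I * W) (?Z * - U + ?I * ?I)"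
    unfolding X_def Y_def using car
    by (intro mult_four_block_mat[of _ "Suc 0" "Suc 0" _ n _ n _ _ "Suc 0" _ n]) auto
  also have "?O * - U + U * ?I = 0\<^sub>m (Suc 0) n" by (rule eq_matI) (auto simp: U_def scalar_prod_def)
  also have "?Z * ?O + ?I * W = W" using car by auto
  also have "?Z * - U + ?I * ?I = ?I" by (rule eq_matI) (auto simp: U_def scalar_prod_def)
  finally have "Determinant.det (Y * X) = Determinant.det (?O * ?O + U * W) * Determinant.det ?I"
    using det_four_block_mat_upper_right_zero[of "?O * ?O + U * W" "Suc 0" "0\<^sub>m (Suc 0) n" n W ?I] car by auto
  also have "\<dots> = of_nat (n + 1)" unfolding UW by (simp add: det_single)
  finally have 2: "Determinant.det Y * Determinant.det X = of_nat (n + 1)"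
    using X Y by (simp add: det_mult)
  have "Matrix.mat n n (\<lambda>(i, j). c * (if i = j then 2 else 1)) = c \<cdot>\<^sub>m B"
    by (rule eq_matI) (auto simp: B_def)
  then show ?thesis using 1 2 by (simp add: mult.commute B_def)
qed

text \<open>The value of the Hessian matrix at a common zero of the logarithmic derivatives.\<close>
definition hess_entry :: "nat \<Rightarrow> (nat \<Rightarrow> nat) \<Rightarrow> complex \<Rightarrow> (nat \<Rightarrow> complex) \<Rightarrow> nat \<Rightarrow> nat \<Rightarrow> complex" where
  "hess_entry r dd w y p q =
     (if p = 0 \<and> q = 0 then w else
      (\<Sum>j<r. if p \<in> block dd j \<and> q \<in> block dd j
         then - y j * (if p = q then 2 else 1) else 0))"

text \<open>The matrix is block diagonal: the corner entry \<open>w\<close>, then for each block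
  \<open>- y j\<close> times the sum of the identity and the all-ones matrix.\<close>

lemma det_hess_entry:
  "Determinant.det (Matrix.mat (Suc (off dd r)) (Suc (off dd r)) (\<lambda>(p, q). hess_entry r dd w y p q))
    = w * (\<Prod>j<r. (- y j) ^ dd j * of_nat (dd j + 1))"
proof (induction r)
  case 0
  show ?case by (simp add: off_def det_single hess_entry_def)
next
  case (Suc r)
  let ?n = "Suc (off dd r)" and ?m = "dd r"
  let ?A = "Matrix.mat ?n ?n (\<lambda>(p, q). hess_entry r dd w y p q)"
  let ?B = "Matrix.mat ?m ?m (\<lambda>(i, j). - y r * (if i = j then 2 else 1))"
  have vanish: "(if p \<in> block dd j \<and> q \<in> block dd j
         then - y j * (if p = q then 2 else 1) else 0) = 0" if "j < r" "p > off dd r \<or> q > off dd r" for j p q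
    using block_subset[OF that(1), of dd] that(2) by auto
  have "Matrix.mat (Suc (off dd (Suc r))) (Suc (off dd (Suc r))) (\<lambda>(p, q). hess_entry (Suc r) dd w y p q)
     = four_block_mat ?A (0\<^sub>m ?n ?m) (0\<^sub>m ?m ?n) ?B" (is "?L = ?R")
  proof (rule eq_matI)
    fix p q assume "p < dim_row ?R" "q < dim_col ?R"
    then have pq: "p < ?n + ?m" "q < ?n + ?m" by auto
    show "?L $$ (p, q) = ?R $$ (p, q)"
    proof (cases "p < ?n \<and> q < ?n")
      case True
      then show ?thesis using pq by (auto simp: hess_entry_def off_Suc block_def)
    next
      case False
      then have "(\<Sum>j<r. if p \<in> block dd j \<and> q \<in> block dd j
         then - y j * (if p = q then 2 else 1) else 0) = 0"
        by (intro sum.neutral ballI vanish) auto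
      then show ?thesis using pq False by (auto simp: hess_entry_def off_Suc block_def)
    qed
  qed (auto simp: off_Suc)
  then have "Determinant.det ?L = Determinant.det ?A * Determinant.det ?B"
    by (simp add: det_four_block_mat_upper_right_zero[of _ ?n _ ?m])
  then show ?case unfolding Suc.IH det_one_plus_ones by (simp add: mult.assoc)
qed

lemma leibniz_hess_entry:
  "(\<Sum>\<sigma> | \<sigma> permutes {0..off dd r}. of_int (sign \<sigma>) * (\<Prod>i\<in>{0..off dd r}. hess_entry r dd w y i (\<sigma> i)))
    = w * (\<Prod>j<r. (- y j) ^ dd j * of_nat (dd j + 1))"
proof -
  have "{0..off dd r} = {0..<Suc (off dd r)}" by auto
  then have "(\<Sum>\<sigma> | \<sigma> permutes {0..off dd r}. of_int (sign \<sigma>) * (\<Prod>i\<in>{0..off dd r}. hess_entry r dd w y i (\<sigma> i)))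
    = Determinant.det (Matrix.mat (Suc (off dd r)) (Suc (off dd r)) (\<lambda>(p, q). hess_entry r dd w y p q))"
    unfolding Determinant.det_def
    by (auto intro!: sum.cong prod.cong simp: permutes_in_image)
  then show ?thesis by (simp add: det_hess_entry)
qed

section \<open>Characters of a product of cyclic groups\<close>

text \<open>Multiplication by a primitive root of unity permutes the roots and multiplies the sum by
  a factor different from 1.\<close>

lemma sum_nth_roots_powi_eq_0:
  fixes u :: complex and m :: int
  assumes n: "n > 0" and u: "u \<noteq> 0" and m: "\<not> int n dvd m"
  shows "(\<Sum>w | w ^ n = u. w powi m) = 0"
proof -
  define \<zeta> where "\<zeta> = cis (2 * pi / n)"
  have z0: "\<zeta> \<noteq> 0" by (simp add: \<zeta>_def)
  have zn: "\<zeta> ^ n = 1" using n by (simp add: \<zeta>_def Complex.DeMoivre)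
  have "\<zeta> powi m \<noteq> 1"
  proof
    assume "\<zeta> powi m = 1"
    then have "cos (of_int m * (2 * pi / n)) = 1"
      by (simp add: \<zeta>_def cis_power_int complex_eq_iff)
    then obtain j :: int where "of_int m * (2 * pi / n) = of_int j * 2 * pi"
      by (auto simp: cos_one_2pi_int)
    then have "real_of_int m = of_int (j * int n)" using n by (simp add: field_simps)
    then have "m = j * int n" by (simp only: of_int_eq_iff)
    then show False using m by simp
  qed
  moreover have "(\<Sum>w | w ^ n = u. w powi m) = (\<Sum>w | w ^ n = u. (\<zeta> * w) powi m)"
    by (rule sum.reindex_bij_witness[of _ "\<lambda>w. \<zeta> * w" "\<lambda>w. w / \<zeta>"])
      (use z0 zn in \<open>auto simp: power_mult_distrib power_divide\<close>)
  moreover have "\<dots> = \<zeta> powi m * (\<Sum>w | w ^ n = u. w powi m)"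
    by (simp add: power_int_mult_distrib sum_distrib_left)
  ultimately have "(\<zeta> powi m - 1) * (\<Sum>w | w ^ n = u. w powi m) = 0" by (simp add: left_diff_distrib)
  then show ?thesis using \<open>\<zeta> powi m \<noteq> 1\<close> by simp
qed

lemma sum_powers_root_of_unity:
  fixes w :: complex
  assumes "w ^ n = 1" "w \<noteq> 1"
  shows "(\<Sum>e<n. w ^ e) = 0"
  using assms by (simp add: geometric_sum)

text \<open>Like \<open>PiE\<close>, but with value 0 outside the index range, in accordance with
  the condition \<open>z j = 0\<close> for \<open>j \<ge> r\<close> in the theorem.\<close>

definition ext_fun :: "nat \<Rightarrow> (nat \<Rightarrow> 'a set) \<Rightarrow> (nat \<Rightarrow> 'a::zero) set" where
  "ext_fun r A = {z. (\<forall>j<r. z j \<in> A j) \<and> (\<forall>j\<ge>r. z j = 0)}"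

lemma bij_betw_ext_fun:
  "bij_betw (\<lambda>g j. if j < r then g j else 0) (PiE {..<r} A) (ext_fun r A)"
proof (rule bij_betw_byWitness[where f' = "\<lambda>z. restrict z {..<r}"])
  show "\<forall>g\<in>PiE {..<r} A. (\<lambda>j\<in>{..<r}. if j < r then g j else 0) = g"
    by (auto simp: fun_eq_iff PiE_def extensional_def restrict_def)
  show "\<forall>z\<in>ext_fun r A. (\<lambda>j. if j < r then restrict z {..<r} j else 0) = z"
    by (auto simp: ext_fun_def fun_eq_iff)
  show "(\<lambda>g j. if j < r then g j else 0) ` PiE {..<r} A \<subseteq> ext_fun r A"
    unfolding ext_fun_def by (intro image_subsetI) (simp add: PiE_mem)
  show "(\<lambda>z. restrict z {..<r}) ` ext_fun r A \<subseteq> PiE {..<r} A"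
    by (intro image_subsetI) (simp add: ext_fun_def)
qed

lemma ext_fun_neqE:
  assumes "z \<in> ext_fun r A" "z' \<in> ext_fun r B" "z \<noteq> z'"
  obtains j where "j < r" "z j \<noteq> z' j"
proof -
  obtain j where j: "z j \<noteq> z' j" using assms(3) by blast
  moreover have "j < r" using assms(1,2) j by (cases "j < r") (auto simp: ext_fun_def)
  ultimately show ?thesis using that by blast
qed

lemma finite_ext_fun: "(\<And>j. j < r \<Longrightarrow> finite (A j)) \<Longrightarrow> finite (ext_fun r A)"
  using bij_betw_finite[OF bij_betw_ext_fun[of r A]] finite_PiE[of "{..<r}" A] by auto

lemma sum_ext_fun_prod:
  fixes f :: "nat \<Rightarrow> 'a::zero \<Rightarrow> complex"
  assumes "\<And>j. j < r \<Longrightarrow> finite (A j)"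
  shows "(\<Sum>z\<in>ext_fun r A. \<Prod>j<r. f j (z j)) = (\<Prod>j<r. \<Sum>w\<in>A j. f j w)"
proof -
  have "(\<Sum>z\<in>ext_fun r A. \<Prod>j<r. f j (z j)) = (\<Sum>g\<in>PiE {..<r} A. \<Prod>j<r. f j (if j < r then g j else 0))"
    using sum.reindex_bij_betw[OF bij_betw_ext_fun, of "\<lambda>z. \<Prod>j<r. f j (z j)" r A] by simp
  also have "\<dots> = (\<Sum>g\<in>PiE {..<r} A. \<Prod>j<r. f j (g j))" by (intro sum.cong prod.cong) auto
  also have "\<dots> = (\<Prod>j<r. \<Sum>w\<in>A j. f j w)" using assms by (subst prod_sum_PiE) auto
  finally show ?thesis .
qed

locale root_family =
  fixes r :: nat and n :: "nat \<Rightarrow> nat" and u :: "nat \<Rightarrow> complex"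
  assumes n_pos: "\<And>j. j < r \<Longrightarrow> n j > 0" and u_nz: "\<And>j. j < r \<Longrightarrow> u j \<noteq> 0"
begin

text \<open>\<open>Z\<close> is a torsor under the product of the groups of \<open>n j\<close>-th
  roots of unity; \<open>E\<close> contains one exponent for each character of that group.\<close>

definition Z :: "(nat \<Rightarrow> complex) set" where "Z = ext_fun r (\<lambda>j. {w. w ^ n j = u j})"
definition E :: "(nat \<Rightarrow> nat) set" where "E = ext_fun r (\<lambda>j. {..<n j})"

lemma fin_roots: "j < r \<Longrightarrow> finite {w. w ^ n j = u j}"
  using n_pos by (simp add: finite_nth_roots)

lemma finite_Z: "finite Z"
  unfolding Z_def by (intro finite_ext_fun fin_roots)

lemma finite_E: "finite E" unfolding E_def by (intro finite_ext_fun) auto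

lemma Z_root: "z \<in> Z \<Longrightarrow> j < r \<Longrightarrow> z j ^ n j = u j" by (auto simp: Z_def ext_fun_def)

lemma Z_nz: "z \<in> Z \<Longrightarrow> j < r \<Longrightarrow> z j \<noteq> 0"
  using Z_root[of z j] n_pos[of j] u_nz[of j] by (cases "z j = 0") (auto simp: zero_power)

lemma sum_Z_one: "(\<Sum>z\<in>Z. 1) = (\<Prod>j<r. of_nat (n j) :: complex)"
proof -
  have "(\<Sum>z\<in>Z. \<Prod>j<r. 1) = (\<Prod>j<r. \<Sum>w\<in>{w. w ^ n j = u j}. (1::complex))"
    unfolding Z_def by (intro sum_ext_fun_prod fin_roots)
  also have "\<dots> = (\<Prod>j<r. of_nat (n j))"
    using n_pos u_nz by (intro prod.cong) (auto simp: card_nth_roots)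
  finally show ?thesis by simp
qed

lemma sum_Z_monomial_eq_0:
  assumes "j < r" "\<not> int (n j) dvd m j"
  shows "(\<Sum>z\<in>Z. \<Prod>j<r. z j powi m j) = 0"
proof -
  have "(\<Sum>z\<in>Z. \<Prod>j<r. z j powi m j) = (\<Prod>j<r. \<Sum>w\<in>{w. w ^ n j = u j}. w powi m j)"
    unfolding Z_def by (intro sum_ext_fun_prod fin_roots)
  also have "\<dots> = 0"
    using assms n_pos u_nz by (intro prod_zero bexI[of _ j] sum_nth_roots_powi_eq_0) auto
  finally show ?thesis .
qed

text \<open>The quotient of two points is a tuple of roots of unity, so the sum is a product of
  geometric sums, one of which vanishes when the points differ.\<close>

lemma sum_E_dual:
  assumes "z \<in> Z" "z' \<in> Z"
  shows "(\<Sum>e\<in>E. \<Prod>j<r. (z j / z' j) ^ e j) = (if z = z' then (\<Prod>j<r. of_nat (n j)) else 0)"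
proof -
  have *: "(\<Sum>e\<in>E. \<Prod>j<r. (z j / z' j) ^ e j) = (\<Prod>j<r. \<Sum>k<n j. (z j / z' j) ^ k)"
    unfolding E_def by (intro sum_ext_fun_prod) auto
  show ?thesis
  proof (cases "z = z'")
    case True
    then show ?thesis unfolding * using Z_nz[OF assms(1)] by (auto intro!: prod.cong)
  next
    case False
    then obtain j where j: "j < r" "z j \<noteq> z' j"
      using assms ext_fun_neqE unfolding Z_def by blast
    have "(\<Sum>k<n j. (z j / z' j) ^ k) = 0"
      using j Z_nz[OF assms(2), of j] Z_root[OF assms(1), of j] Z_root[OF assms(2), of j] u_nz[of j]
      by (intro sum_powers_root_of_unity) (auto simp: power_divide)
    then show ?thesis unfolding * using False j by (auto intro!: prod_zero)
  qed
qed

text \<open>Multiplying by the inverse of the monomial \<open>e0\<close> and summing over the points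
  isolates \<open>c e0\<close>: two exponents in \<open>E\<close> differ by less than
  \<open>n j\<close> in each coordinate, so all other monomials sum to zero.\<close>

lemma coeffs_eq_0:
  assumes "\<And>z. z \<in> Z \<Longrightarrow> (\<Sum>e\<in>E. c e * (\<Prod>j<r. z j ^ e j)) = 0" and e0: "e0 \<in> E"
  shows "c e0 = 0"
proof -
  have "0 = (\<Sum>z\<in>Z. (\<Sum>e\<in>E. c e * (\<Prod>j<r. z j ^ e j)) * (\<Prod>j<r. z j powi (- int (e0 j))))"
    using assms(1) by simp
  also have "\<dots> = (\<Sum>z\<in>Z. \<Sum>e\<in>E. c e * (\<Prod>j<r. z j powi (int (e j) - int (e0 j))))"
  proof (intro sum.cong refl)
    fix z assume z: "z \<in> Z"
    have "(\<Prod>j<r. z j ^ e j) * (\<Prod>j<r. z j powi (- int (e0 j))) = (\<Prod>j<r. z j powi (int (e j) - int (e0 j)))" for e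
      unfolding prod.distrib[symmetric] using Z_nz[OF z]
      by (intro prod.cong) (auto simp: power_int_diff power_int_minus field_simps)
    then show "(\<Sum>e\<in>E. c e * (\<Prod>j<r. z j ^ e j)) * (\<Prod>j<r. z j powi (- int (e0 j)))
       = (\<Sum>e\<in>E. c e * (\<Prod>j<r. z j powi (int (e j) - int (e0 j))))"
      by (simp add: sum_distrib_right mult.assoc)
  qed
  also have "\<dots> = (\<Sum>e\<in>E. c e * (\<Sum>z\<in>Z. \<Prod>j<r. z j powi (int (e j) - int (e0 j))))"
    by (subst sum.swap) (simp add: sum_distrib_left)
  also have "\<dots> = (\<Sum>e\<in>E. if e = e0 then c e0 * (\<Prod>j<r. of_nat (n j)) else 0)"
  proof (intro sum.cong refl)
    fix e assume e: "e \<in> E"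
    show "c e * (\<Sum>z\<in>Z. \<Prod>j<r. z j powi (int (e j) - int (e0 j))) = (if e = e0 then c e0 * (\<Prod>j<r. of_nat (n j)) else 0)"
    proof (cases "e = e0")
      case True
      then show ?thesis using sum_Z_one by simp
    next
      case False
      then obtain j where j: "j < r" "e j \<noteq> e0 j"
        using e e0 ext_fun_neqE unfolding E_def by blast
      have "\<not> int (n j) dvd (int (e j) - int (e0 j))"
      proof
        assume "int (n j) dvd (int (e j) - int (e0 j))"
        then have "int (n j) \<le> \<bar>int (e j) - int (e0 j)\<bar>" using j dvd_imp_le_int[of "int (e j) - int (e0 j)" "int (n j)"] by simp
        moreover have "e j < n j" "e0 j < n j" using e e0 j by (auto simp: E_def ext_fun_def)
        ultimately show False by linarith
      qed
      then have "(\<Sum>z\<in>Z. \<Prod>j<r. z j powi (int (e j) - int (e0 j))) = 0"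
        using j by (intro sum_Z_monomial_eq_0) auto
      then show ?thesis using False by simp
    qed
  qed
  also have "\<dots> = c e0 * (\<Prod>j<r. of_nat (n j))" using e0 finite_E by simp
  finally have "c e0 * (\<Prod>j<r. of_nat (n j)) = 0" by simp
  moreover have "(\<Prod>j<r. of_nat (n j) :: complex) \<noteq> 0" using n_pos by auto
  ultimately show ?thesis by simp
qed

text \<open>Interpolates an arbitrary function on the points with exponents from \<open>E\<close>.
  The \<open>z j\<close> need not have modulus 1, so negative powers stand in for complex
  conjugates.\<close>

lemma fourier_inversion:
  assumes "z \<in> Z"
  shows "(\<Sum>e\<in>E. ((\<Sum>z'\<in>Z. G z' * (\<Prod>j<r. z' j powi (- int (e j)))) / (\<Prod>j<r. of_nat (n j))) * (\<Prod>j<r. z j ^ e j)) = G z"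
proof -
  let ?N = "\<Prod>j<r. of_nat (n j) :: complex"
  have N: "?N \<noteq> 0" using n_pos by auto
  have "(\<Sum>e\<in>E. ((\<Sum>z'\<in>Z. G z' * (\<Prod>j<r. z' j powi (- int (e j)))) / ?N) * (\<Prod>j<r. z j ^ e j))
     = (\<Sum>e\<in>E. \<Sum>z'\<in>Z. G z' / ?N * (\<Prod>j<r. (z j / z' j) ^ e j))"
  proof (intro sum.cong refl)
    fix e
    have "(\<Prod>j<r. z' j powi (- int (e j))) * (\<Prod>j<r. z j ^ e j) = (\<Prod>j<r. (z j / z' j) ^ e j)" for z'
      unfolding prod.distrib[symmetric] by (intro prod.cong) (auto simp: power_int_minus power_divide field_simps)
    then show "((\<Sum>z'\<in>Z. G z' * (\<Prod>j<r. z' j powi (- int (e j)))) / ?N) * (\<Prod>j<r. z j ^ e j)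
       = (\<Sum>z'\<in>Z. G z' / ?N * (\<Prod>j<r. (z j / z' j) ^ e j))"
      by (simp add: sum_distrib_right sum_divide_distrib mult.assoc)
  qed
  also have "\<dots> = (\<Sum>z'\<in>Z. G z' / ?N * (\<Sum>e\<in>E. \<Prod>j<r. (z j / z' j) ^ e j))"
    by (subst sum.swap) (simp add: sum_distrib_left)
  also have "\<dots> = (\<Sum>z'\<in>Z. if z' = z then G z else 0)"
    using assms N by (intro sum.cong refl) (auto simp: sum_E_dual)
  also have "\<dots> = G z" using assms finite_Z by simp
  finally show ?thesis .
qed

end

section \<open>The polytope\<close>

lemma lookup_vtx:
  assumes "i \<le> dd j" "i' < dd j'"
  shows "Poly_Mapping.lookup (vtx dd j i) (off dd j' + i' + 1) =
    (if j = j' then (if i = dd j then - 1 else if i = i' then 1 else 0) else 0)"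
proof (cases "i < dd j")
  case True
  then show ?thesis using coord_unique[of i dd j i' j'] assms
    by (auto simp: vtx_def lookup_single when_def)
next
  case False
  then have "Poly_Mapping.lookup (vtx dd j i) (off dd j' + i' + 1)
      = - (\<Sum>k<dd j. if off dd j + k + 1 = off dd j' + i' + 1 then 1 else 0)"
    by (simp add: vtx_def lookup_sum lookup_single when_def eq_commute)
  also have "\<dots> = - (\<Sum>k<dd j. if j = j' \<and> k = i' then 1 else 0)"
    using coord_unique[of _ dd j i' j'] assms by (intro arg_cong[of _ _ uminus] sum.cong) auto
  also have "\<dots> = (if j = j' then - 1 else 0)" using assms by (cases "j = j'") auto
  finally show ?thesis using False assms by auto
qed

lemma lookup_vtx_outside:
  assumes "j < r" "p = 0 \<or> p > off dd r"
  shows "Poly_Mapping.lookup (vtx dd j i) p = 0"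
proof -
  have "p \<noteq> off dd j + i' + 1" if "i' < dd j" for i'
    using assms off_mono[of "Suc j" r dd] that by (auto simp: off_Suc)
  then show ?thesis by (auto simp: vtx_def lookup_single lookup_sum when_def intro!: sum.neutral)
qed

lemma sum_vtx_block: "(\<Sum>i<Suc (dd j). vtx dd j i) = 0"
  by (simp add: vtx_def)

locale toric_blocks =
  fixes r :: nat and dd :: "nat \<Rightarrow> nat"
  assumes r_pos: "r \<ge> 1" and dd_pos: "\<And>j. j < r \<Longrightarrow> dd j \<ge> 1"
begin

abbreviation d where "d \<equiv> off dd r"
abbreviation V where "V \<equiv> Vset r dd"
abbreviation idx where "idx \<equiv> Sigma {..<r} (\<lambda>j. {..<Suc (dd j)})"

lemma d_pos: "d \<ge> 1"
  using off_mono[of "Suc 0" r dd] dd_pos[of 0] r_pos by (simp add: off_def)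

lemma vtx_eq_iff:
  assumes "j < r" "i \<le> dd j" "j' < r" "i' \<le> dd j'"
  shows "vtx dd j i = vtx dd j' i' \<longleftrightarrow> j = j' \<and> i = i'"
proof
  assume eq: "vtx dd j i = vtx dd j' i'"
  have "Poly_Mapping.lookup (vtx dd j i) (off dd j + l + 1) = Poly_Mapping.lookup (vtx dd j' i') (off dd j + l + 1)" for l
    using eq by simp
  then have *: "(if i = dd j then - 1 else if i = l then 1 else 0) =
     (if j' = j then (if i' = dd j then - 1 else if i' = l then 1 else 0) else (0::int))" if "l < dd j" for l
    using lookup_vtx[of i dd j l j] lookup_vtx[of i' dd j' l j] assms that by auto
  have "j = j'" using *[of "if i = dd j then 0 else i"] assms dd_pos[of j]
    by (cases "i = dd j") (auto split: if_splits)
  moreover have "i = i'"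
    using *[of "if i = dd j then (if i' = dd j then 0 else i') else i"] \<open>j = j'\<close> assms dd_pos[of j]
    by (cases "i = dd j"; cases "i' = dd j") (auto split: if_splits)
  ultimately show "j = j' \<and> i = i'" by simp
qed auto

lemma inj_vtx: "inj_on (\<lambda>(j, i). vtx dd j i) idx"
  by (auto simp: inj_on_def vtx_eq_iff less_Suc_eq_le)

lemma V_eq: "V = (\<lambda>(j, i). vtx dd j i) ` idx"
  unfolding Vset_def by force

lemma finite_V: "finite V" unfolding V_eq by auto

lemma vtx_in_V: "j < r \<Longrightarrow> i \<le> dd j \<Longrightarrow> vtx dd j i \<in> V"
  unfolding Vset_def by (auto simp: less_Suc_eq_le)

lemma zero_notin_V: "0 \<notin> V"
proof
  assume "0 \<in> V"
  then obtain j i where ji: "j < r" "i \<le> dd j" "vtx dd j i = 0" by (auto simp: Vset_def less_Suc_eq_le)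
  have "Poly_Mapping.lookup (vtx dd j i) (off dd j + (if i = dd j then 0 else i) + 1) = 0" using ji by simp
  then show False using lookup_vtx[of i dd j "if i = dd j then 0 else i" j] ji dd_pos[of j]
    by (cases "i = dd j") auto
qed

lemma lookup_V_0: "v \<in> V \<Longrightarrow> Poly_Mapping.lookup v 0 = 0"
  by (auto simp: Vset_def lookup_vtx_outside)

lemma sum_V: "(\<Sum>v\<in>V. g v) = (\<Sum>j<r. \<Sum>i<Suc (dd j). g (vtx dd j i))"
  unfolding V_eq by (subst sum.reindex[OF inj_vtx]) (simp add: sum.Sigma case_prod_unfold del: sum.lessThan_Suc)

text \<open>\<open>in_dil\<close> and \<open>realDelta\<close> attach weights to vertices, while
  computations index them by block and position; injectivity of the indexing allows the
  translation.\<close>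

lemma extend_to_V: "\<exists>c. \<forall>j<r. \<forall>i\<le>dd j. c (vtx dd j i) = C j i"
  by (rule exI[of _ "\<lambda>v. case inv_into idx (\<lambda>(j, i). vtx dd j i) v of (j, i) \<Rightarrow> C j i"])
    (use inv_into_f_f[OF inj_vtx] in \<open>force simp: less_Suc_eq_le\<close>)

text \<open>Only two vertices of the block see this coordinate with separate weights: the basis
  vector with 1 and the last vertex with -1. The ring is left general because real and integer
  weights, complex values and Laurent polynomials all occur as \<open>C\<close>.\<close>

lemma sum_block_coord:
  fixes C :: "nat \<Rightarrow> nat \<Rightarrow> 'a::comm_ring_1"
  assumes "j < r" "l < dd j"
  shows "(\<Sum>j'<r. \<Sum>i<Suc (dd j'). C j' i * of_int (Poly_Mapping.lookup (vtx dd j' i) (off dd j + l + 1))) = C j l - C j (dd j)"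
proof -
  have "(\<Sum>i<Suc (dd j'). C j' i * of_int (Poly_Mapping.lookup (vtx dd j' i) (off dd j + l + 1)))
      = (if j' = j then C j l - C j (dd j) else 0)" for j'
  proof -
    have "(\<Sum>i<Suc (dd j'). C j' i * of_int (Poly_Mapping.lookup (vtx dd j' i) (off dd j + l + 1)))
       = (\<Sum>i<Suc (dd j'). if j' = j then (if i = dd j then - C j (dd j) else if i = l then C j l else 0) else 0)"
      using assms by (intro sum.cong refl) (auto simp: lookup_vtx[simplified] less_Suc_eq_le)
    also have "\<dots> = (if j' = j then C j l - C j (dd j) else 0)" using assms by (auto simp: sum.If_cases)
    finally show ?thesis .
  qed
  then show ?thesis using assms by simp
qed

section \<open>Gauge and normalized volume of the polytope\<close>

lemma V_rep_imp_gauge_le: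
  assumes c: "\<forall>v\<in>V. c v \<ge> 0" "(\<Sum>v\<in>V. c v) = s"
    and x: "\<forall>p\<in>{1..d}. x p = (\<Sum>v\<in>V. c v * real_of_int (Poly_Mapping.lookup v p))"
  shows "(\<Sum>j<r. block_gauge (block dd j) x) \<le> s"
proof -
  define C where "C j i = c (vtx dd j i)" for j i
  have C0: "C j i \<ge> 0" if "j < r" "i \<le> dd j" for j i using c vtx_in_V[OF that] by (auto simp: C_def)
  have xC: "x (off dd j + l + 1) = C j l - C j (dd j)" if "j < r" "l < dd j" for j l
  proof -
    have "off dd j + l + 1 \<in> {1..d}" using block_subset[of j r dd] that by (auto simp: block_def)
    then show ?thesis using x sum_block_coord[OF that, of C] by (simp add: sum_V C_def)
  qed
  have "block_gauge (block dd j) x \<le> (\<Sum>i<Suc (dd j). C j i)" if j: "j < r" for j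
  proof -
    let ?M = "Max (insert 0 ((\<lambda>i. - x i) ` block dd j))"
    \<comment> \<open>The weight \<open>C j l = x_l + C j (dd j)\<close> is nonnegative, so the
      weight of the last vertex bounds every \<open>- x_l\<close>; the weight of any representation
      is therefore at least the gauge.\<close>
    have M: "?M \<le> C j (dd j)"
      unfolding block_eq_image using xC[OF j] C0[OF j] by (subst Max_le_iff) (auto simp: less_imp_le)
    have "sum x (block dd j) = (\<Sum>l<dd j. C j l - C j (dd j))"
      unfolding block_eq_image using xC[OF j] by (subst sum.reindex) (auto simp: inj_on_def)
    moreover have "(real (card (block dd j)) + 1) * ?M \<le> (real (dd j) + 1) * C j (dd j)"
      using M by (simp add: block_def mult_left_mono del: Max_insert Max_le_iff)
    ultimately show ?thesis
      unfolding block_gauge_def by (simp add: sum_subtractf distrib_right del: Max_insert)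
  qed
  then have "(\<Sum>j<r. block_gauge (block dd j) x) \<le> (\<Sum>j<r. \<Sum>i<Suc (dd j). C j i)"
    by (intro sum_mono) auto
  also have "\<dots> = s" using c by (simp add: sum_V C_def)
  finally show ?thesis .
qed

lemma gauge_le_imp_V_rep:
  assumes "(\<Sum>j<r. block_gauge (block dd j) x) \<le> s"
  shows "\<exists>c. (\<forall>v\<in>V. c v \<ge> 0) \<and> (\<Sum>v\<in>V. c v) = s \<and>
     (\<forall>p\<in>{1..d}. x p = (\<Sum>v\<in>V. c v * real_of_int (Poly_Mapping.lookup v p)))"
proof -
  define \<delta> where "\<delta> = s - (\<Sum>j<r. block_gauge (block dd j) x)"
  define M where "M j = Max (insert 0 ((\<lambda>i. - x i) ` block dd j))" for j
  \<comment> \<open>The surplus \<open>\<delta>\<close> is spread evenly over the vertices of block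
    0. They sum to zero, so the total weight becomes \<open>s\<close> while the represented point
    stays.\<close>
  define b where "b j = M j + (if j = 0 then \<delta> / real (dd 0 + 1) else 0)" for j
  define C where "C j i = (if i < dd j then x (off dd j + i + 1) + b j else b j)" for j i
  have b_ge: "b j \<ge> 0" "b j \<ge> - x (off dd j + i + 1)" if "i < dd j" for i j
  proof -
    have "M j \<ge> 0" "M j \<ge> - x (off dd j + i + 1)"
      using that unfolding M_def block_eq_image by (intro Max_ge; auto)+
    moreover have "\<delta> / real (dd 0 + 1) \<ge> 0" using assms by (simp add: \<delta>_def)
    ultimately show "b j \<ge> 0" "b j \<ge> - x (off dd j + i + 1)" by (auto simp: b_def)
  qed
  have sumC: "(\<Sum>i<Suc (dd j). C j i) = block_gauge (block dd j) x + (if j = 0 then \<delta> else 0)" for j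
  proof -
    have "sum x (block dd j) = (\<Sum>l<dd j. x (off dd j + l + 1))"
      unfolding block_eq_image by (subst sum.reindex) (auto simp: inj_on_def)
    moreover have "(\<Sum>i<Suc (dd j). C j i) = (\<Sum>l<dd j. x (off dd j + l + 1)) + (real (dd j) + 1) * b j"
      by (simp add: C_def sum.distrib algebra_simps)
    moreover have "block_gauge (block dd j) x = sum x (block dd j) + (real (dd j) + 1) * M j"
      by (simp add: block_gauge_def M_def block_def)
    moreover have "(real (dd j) + 1) * b j = (real (dd j) + 1) * M j + (if j = 0 then \<delta> else 0)"
      by (simp add: b_def distrib_left add.commute[of 1])
    ultimately show ?thesis by simp
  qed
  obtain c where c: "\<forall>j<r. \<forall>i\<le>dd j. c (vtx dd j i) = C j i" using extend_to_V[of C] by blast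
  have sumV: "(\<Sum>v\<in>V. c v * g v) = (\<Sum>j<r. \<Sum>i<Suc (dd j). C j i * g (vtx dd j i))" for g :: "_ \<Rightarrow> real"
    unfolding sum_V using c by (intro sum.cong) (auto simp: less_Suc_eq_le)
  show ?thesis
  proof (intro exI[of _ c] conjI ballI)
    fix v assume "v \<in> V"
    then obtain j i where "j < r" "i \<le> dd j" "v = vtx dd j i" by (auto simp: Vset_def less_Suc_eq_le)
    then show "c v \<ge> 0" using c b_ge[of i j] b_ge(1)[of 0 j] dd_pos[of j] by (force simp: C_def)
  next
    have "(\<Sum>v\<in>V. c v) = (\<Sum>j<r. \<Sum>i<Suc (dd j). C j i)" using sumV[of "\<lambda>_. 1"] by simp
    also have "\<dots> = s" using r_pos by (simp add: sumC sum.distrib \<delta>_def del: sum.lessThan_Suc)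
    finally show "(\<Sum>v\<in>V. c v) = s" .
  next
    fix p assume "p \<in> {1..d}"
    then obtain j i where ji: "j < r" "i < dd j" "p = off dd j + i + 1" by (rule coord_exhaust)
    then show "x p = (\<Sum>v\<in>V. c v * real_of_int (Poly_Mapping.lookup v p))"
      unfolding sumV using sum_block_coord[of j i C] by (simp add: C_def)
  qed
qed

text \<open>The polytope is the free sum of the block simplices, so its gauge is the sum of the
  block gauges and the exponential integral is a product.\<close>

lemma normVol_V: "normVol d V = (\<Prod>j<r. real (dd j + 1))"
proof -
  let ?P = "PiM {1..d} (\<lambda>_. lborel :: real measure)"
  let ?N = "\<lambda>x. \<Sum>j<r. block_gauge (block dd j) x"
  have fin: "finite (block dd j)" for j by (simp add: block_def)
  have eq: "realDelta d V = {x \<in> space ?P. ?N x \<le> 1}"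
    unfolding realDelta_def space_PiM
    using V_rep_imp_gauge_le[of _ 1] gauge_le_imp_V_rep[of _ 1] by auto
  have meas: "?N \<in> borel_measurable ?P"
    by (intro borel_measurable_sum block_gauge_measurable fin block_subset) simp
  have nonneg: "?N x \<ge> 0" for x
  proof (intro sum_nonneg)
    fix j assume "j \<in> {..<r}"
    let ?M = "Max (insert 0 ((\<lambda>i. - x i) ` block dd j))"
    have "?M \<ge> 0" and "\<And>i. i \<in> block dd j \<Longrightarrow> ?M \<ge> - x i" using fin by auto
    then have "(\<Sum>i\<in>block dd j. - x i) \<le> (\<Sum>i\<in>block dd j. ?M)" by (intro sum_mono) auto
    then show "block_gauge (block dd j) x \<ge> 0" using \<open>?M \<ge> 0\<close>
      by (simp add: block_gauge_def sum_negf algebra_simps)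
  qed
  have scale: "?N (\<lambda>i\<in>{1..d}. s * x i) = s * ?N x" if "s > 0" for s x
  proof -
    have "block_gauge (block dd j) (\<lambda>i\<in>{1..d}. s * x i) = s * block_gauge (block dd j) x" if "j < r" for j
    proof -
      have "block_gauge (block dd j) (\<lambda>i\<in>{1..d}. s * x i) = block_gauge (block dd j) (\<lambda>i. s * x i)"
        using block_subset[OF that, of dd] by (intro block_gauge_cong) auto
      then show ?thesis using \<open>s > 0\<close> fin by (simp add: block_gauge_scale)
    qed
    then show ?thesis by (simp add: sum_distrib_left)
  qed
  have "ennreal (fact d) * emeasure ?P (realDelta d V) = (\<Prod>j<r. of_nat (dd j + 1))"
    using nn_integral_exp_gauge[OF _ meas nonneg scale] nn_integral_exp_sum_block_gauge[where r = r and dd = dd] unfolding eq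
    by simp
  also have "\<dots> = ennreal (\<Prod>j<r. real (dd j + 1))"
    by (simp only: prod_ennreal[symmetric] ennreal_of_nat_eq_real_of_nat of_nat_0_le_iff)
  finally have "enn2real (ennreal (fact d) * emeasure ?P (realDelta d V)) = (\<Prod>j<r. real (dd j + 1))"
    by (simp add: prod_nonneg)
  then show ?thesis by (simp add: normVol_def measure_def enn2real_mult)
qed

section \<open>Lattice points of the dilated polytope\<close>

lemma in_dilI:
  assumes "\<And>j i. j < r \<Longrightarrow> i \<le> dd j \<Longrightarrow> C j i \<ge> 0" "(\<Sum>j<r. \<Sum>i<Suc (dd j). C j i) = real k"
    "\<And>p. p \<ge> 1 \<Longrightarrow> real_of_int (Poly_Mapping.lookup m p) =
        (\<Sum>j<r. \<Sum>i<Suc (dd j). C j i * real_of_int (Poly_Mapping.lookup (vtx dd j i) p))"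
  shows "in_dil V k m"
proof -
  obtain c where c: "\<forall>j<r. \<forall>i\<le>dd j. c (vtx dd j i) = C j i" using extend_to_V[of C] by blast
  have sumV: "(\<Sum>v\<in>V. c v * g v) = (\<Sum>j<r. \<Sum>i<Suc (dd j). C j i * g (vtx dd j i))" for g :: "_ \<Rightarrow> real"
    unfolding sum_V using c by (intro sum.cong) (auto simp: less_Suc_eq_le)
  show ?thesis unfolding in_dil_def
  proof (intro exI[of _ c] conjI ballI allI impI)
    fix v assume "v \<in> V"
    then obtain j i where "j < r" "i \<le> dd j" "v = vtx dd j i" by (auto simp: Vset_def less_Suc_eq_le)
    then show "c v \<ge> 0" using c assms(1) by auto
  next
    show "(\<Sum>v\<in>V. c v) = real k" using sumV[of "\<lambda>_. 1"] assms(2) by simp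
  qed (use assms(3) in \<open>simp add: sumV\<close>)
qed

lemma in_dil_vtx: "v \<in> V \<Longrightarrow> in_dil V 1 v"
  unfolding in_dil_def
  by (rule exI[of _ "\<lambda>w. if w = v then 1 else 0"]) (auto simp: finite_V if_distrib[of "\<lambda>c. c * _"] cong: if_cong)

lemma in_dil_origin: "in_dil V k 0"
\<comment> \<open>Equal weights on the vertices of block 0 represent the origin with any prescribed
  total weight.\<close>
proof (rule in_dilI[of "\<lambda>j i. if j = 0 then real k / real (dd 0 + 1) else 0"])
  show "(\<Sum>j<r. \<Sum>i<Suc (dd j). if j = 0 then real k / real (dd 0 + 1) else 0) = real k"
  proof -
    have "(\<Sum>j<r. \<Sum>i<Suc (dd j). if j = 0 then real k / real (dd 0 + 1) else 0) = (\<Sum>j<r. if j = 0 then real k else 0)"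
      by (intro sum.cong refl) (simp del: sum.lessThan_Suc add: nonzero_mult_div_cancel_left)
    then show ?thesis using r_pos by simp
  qed
next
  fix p :: nat
  have "(\<Sum>i<Suc (dd j). Poly_Mapping.lookup (vtx dd j i) p) = 0" for j
    using arg_cong[OF sum_vtx_block[of dd j], of "\<lambda>m. Poly_Mapping.lookup m p"] by (simp only: lookup_sum lookup_zero)
  then have "(\<Sum>i<Suc (dd j). real_of_int (Poly_Mapping.lookup (vtx dd j i) p)) = 0" for j
    by (metis of_int_0 of_int_sum)
  then have "(\<Sum>i<Suc (dd j). (if j = 0 then real k / real (dd 0 + 1) else 0) * real_of_int (Poly_Mapping.lookup (vtx dd j i) p)) = 0" for j
    unfolding sum_distrib_left[symmetric] by simp
  then show "real_of_int (Poly_Mapping.lookup 0 p) = (\<Sum>j<r. \<Sum>i<Suc (dd j). (if j = 0 then real k / real (dd 0 + 1) else 0) *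
      real_of_int (Poly_Mapping.lookup (vtx dd j i) p))" by simp
qed simp

lemma in_dil_mono: "in_dil V k m \<Longrightarrow> k \<le> k' \<Longrightarrow> in_dil V k' m"
  using in_dil_add[of V k m "k' - k" 0] in_dil_origin by simp

lemma in_dil_sum_V: "T \<subseteq> V \<Longrightarrow> in_dil V (card T) (\<Sum>v\<in>T. v)"
proof (induction T rule: infinite_finite_induct)
  case (insert v T)
  then show ?case using in_dil_add[of V 1 v "card T" "\<Sum>v\<in>T. v"] in_dil_vtx[of v] by simp
qed (auto simp: in_dil_zero)

text \<open>The cheapest representation of a lattice point has integer weights, and each of them is
  bounded by the corresponding weight of any real representation. This is why \<open>t_0\<close> and
  the \<open>x_{ji}\<close> generate \<open>S\<close>, the missing weight becoming a power of
  \<open>t_0\<close>.\<close>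

lemma in_dil_integral:
  assumes "in_dil V k m"
  obtains e :: "nat \<Rightarrow> nat \<Rightarrow> nat" where "(\<Sum>j<r. \<Sum>i<Suc (dd j). e j i) \<le> k"
    "\<And>p. p \<ge> 1 \<Longrightarrow> Poly_Mapping.lookup m p = (\<Sum>j<r. \<Sum>i<Suc (dd j). int (e j i) * Poly_Mapping.lookup (vtx dd j i) p)"
proof -
  obtain c where c: "\<forall>v\<in>V. c v \<ge> 0" "(\<Sum>v\<in>V. c v) = real k"
      "\<forall>p\<ge>1. real_of_int (Poly_Mapping.lookup m p) = (\<Sum>v\<in>V. c v * real_of_int (Poly_Mapping.lookup v p))"
    using assms unfolding in_dil_def by blast
  define C where "C j i = c (vtx dd j i)" for j i
  have C0: "C j i \<ge> 0" if "j < r" "i \<le> dd j" for j i using c vtx_in_V[OF that] by (auto simp: C_def)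
  define x where "x j l = Poly_Mapping.lookup m (off dd j + l + 1)" for j l
  have xC: "real_of_int (x j l) = C j l - C j (dd j)" if "j < r" "l < dd j" for j l
    using c(3) sum_block_coord[OF that, of C] by (simp add: sum_V C_def x_def)
  define b where "b j = Max (insert 0 ((\<lambda>l. - x j l) ` {..<dd j}))" for j
  have b: "b j \<ge> 0" "l < dd j \<Longrightarrow> b j \<ge> - x j l" for j l by (auto simp: b_def)
  have bC: "real_of_int (b j) \<le> C j (dd j)" if "j < r" for j
  proof -
    have "b j \<in> insert 0 ((\<lambda>l. - x j l) ` {..<dd j})" unfolding b_def by (intro Max_in) auto
    then show ?thesis using xC[OF that] C0[OF that] by fastforce
  qed
  define e where "e j i = nat (if i < dd j then x j i + b j else b j)" for j i
  have e: "int (e j i) = (if i < dd j then x j i + b j else b j)" for j i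
    using b(2)[of i j] b(1)[of j] by (auto simp: e_def)
  have eC: "real (e j i) \<le> C j i" if "j < r" "i \<le> dd j" for j i
  proof -
    have "real (e j i) = real_of_int (int (e j i))" by simp
    also have "\<dots> = real_of_int (if i < dd j then x j i + b j else b j)" by (simp only: e)
    finally have "real (e j i) = real_of_int (if i < dd j then x j i + b j else b j)" .
    then show ?thesis using xC[of j i] bC[of j] that by (auto simp: not_less)
  qed
  have "real (\<Sum>j<r. \<Sum>i<Suc (dd j). e j i) \<le> (\<Sum>j<r. \<Sum>i<Suc (dd j). C j i)"
    unfolding of_nat_sum using eC by (intro sum_mono) (auto simp: less_Suc_eq_le)
  also have "\<dots> = real k" using c(2) by (simp add: sum_V C_def)
  finally have 1: "(\<Sum>j<r. \<Sum>i<Suc (dd j). e j i) \<le> k" by (simp only: of_nat_le_iff)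
  have 2: "Poly_Mapping.lookup m p = (\<Sum>j<r. \<Sum>i<Suc (dd j). int (e j i) * Poly_Mapping.lookup (vtx dd j i) p)"
    if "p \<ge> 1" for p
  proof (cases "p \<le> d")
    case True
    then have "p \<in> {1..d}" using that by simp
    then obtain j i where ji: "j < r" "i < dd j" "p = off dd j + i + 1" by (rule coord_exhaust)
    show ?thesis using sum_block_coord[OF ji(1,2), of "\<lambda>j i. int (e j i)"] ji e
      by (simp add: x_def)
  next
    case False
    then have "Poly_Mapping.lookup v p = 0" if "v \<in> V" for v
      using that by (auto simp: Vset_def lookup_vtx_outside)
    then have "real_of_int (Poly_Mapping.lookup m p) = 0" using c(3) that by simp
    then show ?thesis using False by (simp add: lookup_vtx_outside)
  qed
  show ?thesis using that 1 2 by blast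
qed

end

section \<open>The Laurent polynomial and consequences of regularity\<close>

text \<open>Exponent vectors are themselves elements of a ring type; the simplifier must not rewrite the
  exponent \<open>single 0 (int k)\<close> of \<open>t_0\<close> to \<open>of_nat k\<close>.\<close>
declare single_of_nat [simp del] single_of_int [simp del]

lemma in_dil_cong:
  "(\<And>p. p \<ge> 1 \<Longrightarrow> Poly_Mapping.lookup m p = Poly_Mapping.lookup m' p) \<Longrightarrow> in_dil V k m \<longleftrightarrow> in_dil V k m'"
  unfolding in_dil_def by simp

lemma theta_diff: "theta i (p - q) = theta i p - theta i q"
  by (rule poly_mapping_eqI) (simp add: lookup_theta lookup_minus right_diff_distrib)

lemma fder_sum: "fder (sum g B) i = (\<Sum>b\<in>B. fder (g b) i)"
  by (simp add: fder_def)

lemma t0pow_mult_single: "t0pow k * Poly_Mapping.single m c = Poly_Mapping.single (Poly_Mapping.single 0 (int k) + m) c"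
  by (simp add: t0pow_def mult_single)

lemma t0pow_power: "t0pow 1 ^ k = t0pow k"
  by (induction k) (simp_all add: t0pow_def mult_single single_add)

lemma single_in_S_deg:
  assumes "c \<noteq> 0 \<Longrightarrow> Poly_Mapping.lookup m 0 = 0 \<and> in_dil V k m"
  shows "Poly_Mapping.single (Poly_Mapping.single 0 (int k) + m) c \<in> S_deg V k"
  using assms in_dil_cong[of "Poly_Mapping.single 0 (int k) + m" m V k]
  by (auto simp: S_deg_def lookup_add lookup_single when_def)

text \<open>The homogeneous coordinates \<open>(1, w)\<close> of an exponent, so that
  \<open>fder\<close> acts on monomials by one formula, index 0 included.\<close>

definition hat :: "(nat \<Rightarrow>\<^sub>0 int) \<Rightarrow> nat \<Rightarrow> complex" where
  "hat w q = (if q = 0 then 1 else of_int (Poly_Mapping.lookup w q))"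

lemma fder_single: "fder (Poly_Mapping.single w c) q = Poly_Mapping.single w (hat w q * c)"
  by (simp add: fder_def hat_def)

context toric_blocks begin

lemma card_V: "card V = d + r"
proof -
  have "real (card V) = (\<Sum>v\<in>V. 1)" by simp
  also have "\<dots> = real (d + r)" unfolding sum_V by (simp add: off_def sum.distrib)
  finally show ?thesis by (simp only: of_nat_eq_iff)
qed

text \<open>There are \<open>d + r\<close> vertices in all, so \<open>d + 1\<close> of them leave
  out only \<open>r - 1\<close>, fewer than one per block.\<close>

lemma block_contained:
  assumes T: "T \<subseteq> V" "card T = Suc d"
  obtains j where "j < r" "\<And>i. i \<le> dd j \<Longrightarrow> vtx dd j i \<in> T"
proof -
  have "\<exists>j<r. \<forall>i\<le>dd j. vtx dd j i \<in> T"
  proof (rule ccontr)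
    assume "\<not> ?thesis"
    then obtain s where s: "\<And>j. j < r \<Longrightarrow> s j \<le> dd j \<and> vtx dd j (s j) \<notin> T" by metis
    let ?U = "(\<lambda>j. vtx dd j (s j)) ` {..<r}"
    have "inj_on (\<lambda>j. vtx dd j (s j)) {..<r}"
      using s by (auto simp: inj_on_def vtx_eq_iff)
    then have "card ?U = r" by (simp add: card_image)
    moreover have U: "?U \<subseteq> V" using s vtx_in_V by auto
    moreover have "T \<subseteq> V - ?U" using s T by auto
    then have "card T \<le> card (V - ?U)" using finite_V by (intro card_mono) auto
    ultimately show False using T card_V finite_V by (simp add: card_Diff_subset)
  qed
  then show ?thesis using that by blast
qed

text \<open>Any \<open>d + 1\<close> vertices contain all those of one block, whose sum is zero; this is why the
  toric Hessian lies in degree \<open>d\<close> and not just \<open>d + 1\<close>.\<close>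
lemma in_dil_sum_distinct:
  assumes T: "T \<subseteq> insert 0 V" "card T = Suc d"
  shows "in_dil V d (\<Sum>v\<in>T. v)"
proof (cases "0 \<in> T")
  case True
  have fin: "finite T" using T by (auto intro: card_ge_0_finite)
  have "in_dil V (card (T - {0})) (\<Sum>v\<in>T-{0}. v)" using T by (intro in_dil_sum_V) auto
  then show ?thesis using True T fin by (simp add: sum.remove[of T 0])
next
  case False
  then have TV: "T \<subseteq> V" using T by auto
  have fin: "finite T" using TV finite_V finite_subset by blast
  obtain j where j: "j < r" "\<And>i. i \<le> dd j \<Longrightarrow> vtx dd j i \<in> T" using block_contained[OF TV T(2)] by blast
  let ?B = "vtx dd j ` {..<Suc (dd j)}"
  have B: "?B \<subseteq> T" using j by (auto simp: less_Suc_eq_le)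
  have inj: "inj_on (vtx dd j) {..<Suc (dd j)}" using j(1) by (auto simp: inj_on_def vtx_eq_iff less_Suc_eq_le)
  have "(\<Sum>v\<in>?B. v) = 0" using sum_vtx_block[of dd j] by (subst sum.reindex[OF inj]) (simp del: sum.lessThan_Suc)
  then have "(\<Sum>v\<in>T. v) = (\<Sum>v\<in>T-?B. v)" using sum.subset_diff[OF B fin, of "\<lambda>v. v"] by simp
  moreover have "in_dil V (card (T - ?B)) (\<Sum>v\<in>T-?B. v)" using TV by (intro in_dil_sum_V) auto
  moreover have "card (T - ?B) \<le> d" using B T fin by (simp add: card_Diff_subset card_image[OF inj])
  ultimately show ?thesis using in_dil_mono by simp
qed

text \<open>Expanding row by row, a choice \<open>g\<close> of one exponent per row contributes the
  monomial with exponent \<open>\<Sum> g i\<close> times a multiple of the determinant with rows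
  \<open>(1, g i)\<close>. A repeated exponent makes two rows equal, so only \<open>d + 1\<close>
  distinct exponents survive, and \<open>in_dil_sum_distinct\<close> applies to their sum.\<close>

lemma hessH_in_S_deg:
  assumes f: "f = (\<Sum>w\<in>insert 0 V. Poly_Mapping.single w (c w))"
  shows "hessH d f \<in> S_deg V d"
proof -
  let ?W = "insert 0 V" and ?I = "{0..d}"
  have f2: "fder (fder f q) p = (\<Sum>w\<in>?W. Poly_Mapping.single w (hat w p * (hat w q * c w)))" for p q
    unfolding f fder_sum fder_single ..
  have of_int_single: "of_int k * Poly_Mapping.single m x = (Poly_Mapping.single m (of_int k * x) :: lpoly)" for k m x
    unfolding single_of_int[symmetric] by (simp add: mult_single)
  let ?det = "\<lambda>g. \<Sum>\<sigma> | \<sigma> permutes ?I. of_int (sign \<sigma>) * (\<Prod>i\<in>?I. hat (g i) (\<sigma> i))"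
  have "(\<Sum>\<sigma> | \<sigma> permutes ?I. of_int (sign \<sigma>) * (\<Prod>i\<in>?I. fder (fder f (\<sigma> i)) i))
     = (\<Sum>\<sigma> | \<sigma> permutes ?I. \<Sum>g\<in>?I \<rightarrow>\<^sub>E ?W. Poly_Mapping.single (\<Sum>i\<in>?I. g i)
          ((\<Prod>i\<in>?I. hat (g i) i * c (g i)) * (of_int (sign \<sigma>) * (\<Prod>i\<in>?I. hat (g i) (\<sigma> i)))))"
  proof (intro sum.cong refl)
    fix \<sigma>
    have "(\<Prod>i\<in>?I. fder (fder f (\<sigma> i)) i)
       = (\<Sum>g\<in>?I \<rightarrow>\<^sub>E ?W. \<Prod>i\<in>?I. Poly_Mapping.single (g i) (hat (g i) i * (hat (g i) (\<sigma> i) * c (g i))))"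
      unfolding f2 using finite_V by (intro prod_sum_PiE) auto
    also have "\<dots> = (\<Sum>g\<in>?I \<rightarrow>\<^sub>E ?W. Poly_Mapping.single (\<Sum>i\<in>?I. g i) (\<Prod>i\<in>?I. hat (g i) i * (hat (g i) (\<sigma> i) * c (g i))))"
      unfolding prod_single ..
    finally show "of_int (sign \<sigma>) * (\<Prod>i\<in>?I. fder (fder f (\<sigma> i)) i)
       = (\<Sum>g\<in>?I \<rightarrow>\<^sub>E ?W. Poly_Mapping.single (\<Sum>i\<in>?I. g i)
          ((\<Prod>i\<in>?I. hat (g i) i * c (g i)) * (of_int (sign \<sigma>) * (\<Prod>i\<in>?I. hat (g i) (\<sigma> i)))))"
      by (simp add: sum_distrib_left of_int_single prod.distrib mult_ac)
  qed
  also have "\<dots> = (\<Sum>g\<in>?I \<rightarrow>\<^sub>E ?W. Poly_Mapping.single (\<Sum>i\<in>?I. g i) ((\<Prod>i\<in>?I. hat (g i) i * c (g i)) * ?det g))"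
  proof (subst sum.swap, intro sum.cong refl)
    fix g
    have single_sum: "(\<Sum>\<sigma>\<in>B. Poly_Mapping.single m (h \<sigma>)) = Poly_Mapping.single m (sum h B)"
      for B :: "(nat \<Rightarrow> nat) set" and m :: "nat \<Rightarrow>\<^sub>0 int" and h :: "_ \<Rightarrow> complex"
      by (induction B rule: infinite_finite_induct) (simp_all add: single_add)
    show "(\<Sum>\<sigma> | \<sigma> permutes ?I. Poly_Mapping.single (\<Sum>i\<in>?I. g i)
          ((\<Prod>i\<in>?I. hat (g i) i * c (g i)) * (of_int (sign \<sigma>) * (\<Prod>i\<in>?I. hat (g i) (\<sigma> i)))))
       = Poly_Mapping.single (\<Sum>i\<in>?I. g i) ((\<Prod>i\<in>?I. hat (g i) i * c (g i)) * ?det g)"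
      unfolding single_sum sum_distrib_left ..
  qed
  finally have "hessH d f = (\<Sum>g\<in>?I \<rightarrow>\<^sub>E ?W. Poly_Mapping.single (Poly_Mapping.single 0 (int d) + (\<Sum>i\<in>?I. g i))
      ((\<Prod>i\<in>?I. hat (g i) i * c (g i)) * ?det g))"
    unfolding hessH_def by (simp add: sum_distrib_left t0pow_mult_single)
  also have "\<dots> \<in> S_deg V d"
  proof (intro S_deg_sum single_in_S_deg conjI)
    fix g assume g: "g \<in> ?I \<rightarrow>\<^sub>E ?W" and nz: "(\<Prod>i\<in>?I. hat (g i) i * c (g i)) * ?det g \<noteq> 0"
    have I: "?I = {0..<Suc d}" by auto
    have gW: "g i \<in> ?W" if "i \<in> ?I" for i using g that by (rule PiE_mem)
    have inj: "inj_on g ?I"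
    proof (rule ccontr)
      assume "\<not> inj_on g ?I"
      then obtain i j where "i \<in> ?I" "j \<in> ?I" "i \<noteq> j" "g i = g j" by (auto simp: inj_on_def)
      then have "?det g = 0"
        unfolding I by (intro leibniz_identical_rows_zero[of i "Suc d" j "\<lambda>i. hat (g i)"]) auto
      then show False using nz by simp
    qed
    have "in_dil V d (\<Sum>v\<in>g ` ?I. v)"
      using gW by (intro in_dil_sum_distinct image_subsetI) (auto simp: card_image[OF inj])
    then show "in_dil V d (\<Sum>i\<in>?I. g i)" by (simp add: sum.reindex[OF inj])
    show "Poly_Mapping.lookup (\<Sum>i\<in>?I. g i) 0 = 0"
      unfolding lookup_sum using gW lookup_V_0 by (intro sum.neutral) force
  qed
  finally show ?thesis .
qed

end

locale toric_poly = toric_blocks r dd for r dd +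
  fixes a :: "nat \<Rightarrow> nat \<Rightarrow> complex"
begin

abbreviation f where "f \<equiv> fpoly r dd a"
abbreviation S where "S \<equiv> S_ring V"
abbreviation t0 where "t0 \<equiv> t0pow 1"

sublocale S: comm_subring S by (rule S_ring_comm_subring)

definition X :: "nat \<Rightarrow> nat \<Rightarrow> lpoly" where "X j i = t0 * Poly_Mapping.single (vtx dd j i) 1"
definition Y :: "nat \<Rightarrow> nat \<Rightarrow> lpoly" where "Y j i = t0 * Poly_Mapping.single (vtx dd j i) (a j i)"

lemma Y_eq: "Y j i = Poly_Mapping.single 0 (a j i) * X j i"
  by (simp add: X_def Y_def t0pow_mult_single mult_single)

lemma f_expand: "\<exists>c. f = (\<Sum>w\<in>insert 0 V. Poly_Mapping.single w (c w))"
proof -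
  obtain c where c: "\<forall>j<r. \<forall>i\<le>dd j. c (vtx dd j i) = - a j i" using extend_to_V[of "\<lambda>j i. - a j i"] by blast
  have "(\<Sum>w\<in>insert 0 V. Poly_Mapping.single w ((c(0 := 1)) w)) = 1 + (\<Sum>v\<in>V. Poly_Mapping.single v ((c(0 := 1)) v))"
    using finite_V zero_notin_V by simp
  also have "(\<Sum>v\<in>V. Poly_Mapping.single v ((c(0 := 1)) v)) = (\<Sum>v\<in>V. Poly_Mapping.single v (c v))"
    using zero_notin_V by (intro sum.cong) auto
  also have "\<dots> = (\<Sum>j<r. \<Sum>i<Suc (dd j). - Poly_Mapping.single (vtx dd j i) (a j i))"
    unfolding sum_V using c by (intro sum.cong) (auto simp: less_Suc_eq_le single_uminus)
  finally have "f = (\<Sum>w\<in>insert 0 V. Poly_Mapping.single w ((c(0 := 1)) w))"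
    unfolding fpoly_def sum_negf by simp
  then show ?thesis by blast
qed

lemma hessH_f_in_S_deg: "hessH d f \<in> S_deg V d"
  using f_expand hessH_in_S_deg by blast

lemma t0_in_S_deg: "t0 \<in> S_deg V 1"
  using single_in_S_deg[of 1 0 V 1] in_dil_origin[of 1] by (simp add: t0pow_def)

lemma X_in_S_deg: "j < r \<Longrightarrow> i \<le> dd j \<Longrightarrow> X j i \<in> S_deg V 1"
  unfolding X_def t0pow_mult_single using lookup_V_0 in_dil_vtx vtx_in_V by (intro single_in_S_deg) auto

lemma Y_in_S_deg: "j < r \<Longrightarrow> i \<le> dd j \<Longrightarrow> Y j i \<in> S_deg V 1"
  unfolding Y_eq by (intro S_deg_smult X_in_S_deg)

lemma in_S [simp, intro]: "t0 \<in> S" "Poly_Mapping.single 0 c \<in> S"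
    "j < r \<Longrightarrow> i \<le> dd j \<Longrightarrow> X j i \<in> S" "j < r \<Longrightarrow> i \<le> dd j \<Longrightarrow> Y j i \<in> S"
  using t0_in_S_deg S_deg_const X_in_S_deg Y_in_S_deg S_deg_subset_S_ring by blast+

lemma t0pow_in_S [simp, intro]: "t0pow k \<in> S"
  using S.power_closed[OF in_S(1), of k] by (simp only: t0pow_power)

lemma Fgen_0: "Fgen f 0 = t0 - (\<Sum>j<r. \<Sum>i<Suc (dd j). Y j i)"
  by (simp add: Fgen_def fder_def fpoly_def Y_def right_diff_distrib sum_distrib_left distrib_left del: sum.lessThan_Suc)

lemma Fgen_coord:
  assumes "j < r" "i < dd j"
  shows "Fgen f (off dd j + i + 1) = Y j (dd j) - Y j i"
proof -
  let ?p = "off dd j + i + 1"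
  have "theta ?p f = - (\<Sum>j'<r. \<Sum>i'<Suc (dd j'). Poly_Mapping.single (vtx dd j' i') (a j' i') *
       of_int (Poly_Mapping.lookup (vtx dd j' i') ?p))"
  proof -
    have 1: "Poly_Mapping.single m (of_int k * c) = (Poly_Mapping.single m c * of_int k :: lpoly)" for m k c
      unfolding single_of_int[symmetric] by (simp add: mult_single mult.commute)
    have "theta ?p 1 = 0" using theta_single[of ?p 0 1] by simp
    then show ?thesis unfolding fpoly_def theta_diff theta_sum theta_single 1 by simp
  qed
  also have "\<dots> = - (Poly_Mapping.single (vtx dd j i) (a j i) - Poly_Mapping.single (vtx dd j (dd j)) (a j (dd j)))"
    using sum_block_coord[OF assms, of "\<lambda>j i. Poly_Mapping.single (vtx dd j i) (a j i) :: lpoly"] by simp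
  finally show ?thesis by (simp add: Fgen_def fder_def Y_def right_diff_distrib)
qed

lemma Fgen_in_S_deg: assumes "p \<le> d" shows "Fgen f p \<in> S_deg V 1"
proof (cases "p = 0")
  case True
  then show ?thesis unfolding True Fgen_0
    by (intro S_deg_diff S_deg_sum t0_in_S_deg Y_in_S_deg) auto
next
  case False
  then have "p \<in> {1..d}" using assms by auto
  then obtain j i where "j < r" "i < dd j" "p = off dd j + i + 1" by (rule coord_exhaust)
  then show ?thesis using S_deg_diff[OF Y_in_S_deg Y_in_S_deg, of j "dd j" j i] by (simp add: Fgen_coord[simplified])
qed

lemma Fgen_in_S: "p \<le> d \<Longrightarrow> Fgen f p \<in> S"
  using Fgen_in_S_deg S_deg_subset_S_ring by blast

lemma prod_X_block: "(\<Prod>i<Suc (dd j). X j i) = t0 ^ Suc (dd j)"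
proof -
  have "(\<Prod>i<Suc (dd j). X j i) = (\<Prod>i<Suc (dd j). t0) * (\<Prod>i<Suc (dd j). Poly_Mapping.single (vtx dd j i) 1)"
    unfolding X_def by (simp only: prod.distrib)
  also have "(\<Prod>i<Suc (dd j). Poly_Mapping.single (vtx dd j i) (1::complex)) = 1"
    unfolding prod_single sum_vtx_block by simp
  finally show ?thesis by simp
qed

lemma prod_Y_block: "(\<Prod>i<Suc (dd j). Y j i) = Poly_Mapping.single 0 (\<Prod>i<Suc (dd j). a j i) * t0 ^ Suc (dd j)"
  unfolding Y_eq prod.distrib prod_X_block prod_single by simp

abbreviation J where "J \<equiv> S.gen (Fgen f) {1..d}"

lemma Y_cong_last:
  assumes "j < r" "i \<le> dd j" shows "Y j i - Y j (dd j) \<in> J"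
proof (cases "i < dd j")
  case True
  have "off dd j + i + 1 \<in> {1..d}" using block_subset[of j r dd] assms True by (auto simp: block_def)
  then have "Fgen f (off dd j + i + 1) \<in> J" by (intro S.gen_generator) auto
  then show ?thesis using Fgen_coord[OF assms(1) True] S.gen_uminus[of "Fgen f (off dd j + i + 1)"] by simp
next
  case False
  then show ?thesis using assms by simp
qed

lemma Y_power_cong:
  assumes "j < r"
  shows "Y j (dd j) ^ Suc (dd j) - Poly_Mapping.single 0 (\<Prod>i<Suc (dd j). a j i) * t0 ^ Suc (dd j) \<in> J"
proof -
  have "(\<Prod>i<Suc (dd j). Y j i) - (\<Prod>i<Suc (dd j). Y j (dd j)) \<in> J"
    using assms by (intro S.gen_cong_prod Y_cong_last) auto
  then show ?thesis unfolding prod_Y_block using S.gen_cong_sym by simp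
qed

section \<open>What regularity forces on the coefficients\<close>

lemma Fideal_eq: "Fideal V f i = S.gen (Fgen f) {..<i}"
  unfolding Fideal_def S.gen_def by auto

lemma regularD:
  "delta_regular V d f \<Longrightarrow> i < Suc d \<Longrightarrow> g \<in> S \<Longrightarrow> Fgen f i * g \<in> S.gen (Fgen f) {..<i} \<Longrightarrow> g \<in> S.gen (Fgen f) {..<i}"
  unfolding delta_regular_def Fideal_eq by auto

lemma one_notin_gen:
  assumes "delta_regular V d f" shows "1 \<notin> S.gen (Fgen f) {..<Suc d}"
proof
  assume "1 \<in> S.gen (Fgen f) {..<Suc d}"
  then have "S \<subseteq> S.gen (Fgen f) {..<Suc d}" using S.gen_mult[of 1 "Fgen f" "{..<Suc d}"] by auto
  then show False using assms unfolding delta_regular_def Fideal_eq by blast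
qed

lemma J_eq: "J = S.gen (Fgen f) ({..<Suc d} - {0})"
  by (rule arg_cong[of _ _ "S.gen (Fgen f)"]) auto

lemma one_notin_J: "delta_regular V d f \<Longrightarrow> 1 \<notin> J"
  unfolding J_eq using one_notin_gen S.gen_mono[of "{..<Suc d}" "{..<Suc d} - {0}" "Fgen f"] by blast

lemma F0_nonzerodivisor:
  assumes "delta_regular V d f" "g \<in> S" "Fgen f 0 * g \<in> J"
  shows "g \<in> J"
  unfolding J_eq
  by (rule S.regular_nonzerodivisor[of "Suc d" "Fgen f" g 0, OF regularD[OF assms(1)]])
    (use assms(2,3) Fgen_in_S J_eq in auto)

lemma F0_not_nilpotent:
  assumes "delta_regular V d f" shows "Fgen f 0 ^ n \<notin> J"
proof (induction n)
  case 0
  then show ?case using one_notin_J[OF assms] by simp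
next
  case (Suc n)
  then show ?case using F0_nonzerodivisor[OF assms, of "Fgen f 0 ^ n"] Fgen_in_S[of 0] by auto
qed

text \<open>A vanishing coefficient puts all \<open>Y\<close> of its block into \<open>J\<close>. If
  another coefficient of the block survives, its \<open>X\<close> lies in \<open>J\<close>, and the
  product relation gives \<open>t_0^{n_j}\<close> in \<open>J\<close>; then \<open>t_0\<close>, all
  \<open>Y\<close> and hence \<open>F_0\<close> are nilpotent modulo \<open>J\<close>. If the whole
  block vanishes, some \<open>F_p\<close> is zero, which cannot occur in a regular sequence
  generating a proper ideal.\<close>

lemma regular_imp_nonzero:
  assumes reg: "delta_regular V d f" and ji: "j < r" "i \<le> dd j"
  shows "a j i \<noteq> 0"
proof
  assume a0: "a j i = 0"
  have YJ: "Y j i' \<in> J" if "i' \<le> dd j" for i'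
  proof -
    have "Y j i' - Y j i \<in> J"
      using S.gen_cong_trans[OF Y_cong_last[OF ji(1) that] S.gen_cong_sym[OF Y_cong_last[OF ji]]] .
    then show ?thesis using a0 by (simp add: Y_eq)
  qed
  show False
  proof (cases "\<exists>i'\<le>dd j. a j i' \<noteq> 0")
    case True
    then obtain i' where i': "i' \<le> dd j" "a j i' \<noteq> 0" by blast
    have "X j i' = Poly_Mapping.single 0 (1 / a j i') * Y j i'"
      using i' by (simp add: Y_eq mult.assoc[symmetric] mult_single)
    then have XJ: "X j i' \<in> J" using S.gen_mult[OF YJ[OF i'(1)]] by simp
    have "(\<Prod>i\<in>{..<Suc (dd j)} - {i'}. X j i) \<in> S" using ji by (intro S.prod_closed) auto
    from S.gen_mult[OF XJ this] have t0J: "t0 ^ Suc (dd j) \<in> J"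
      unfolding prod_X_block[symmetric] using i' prod.remove[of "{..<Suc (dd j)}" i' "X j"] by (simp add: mult.commute)
    have Ynil: "Y j' i ^ (Suc (dd j') * Suc (dd j)) \<in> J" if j': "j' < r" "i \<le> dd j'" for j' i
    proof -
      let ?n' = "Suc (dd j')" and ?n = "Suc (dd j)" and ?c = "Poly_Mapping.single 0 (\<Prod>i<Suc (dd j'). a j' i)"
      have 1: "(Y j' (dd j') ^ ?n') ^ ?n - (?c * t0 ^ ?n') ^ ?n \<in> J"
        using j' by (intro S.gen_cong_power Y_power_cong) auto
      have "(?c * t0 ^ ?n') ^ ?n = ?c ^ ?n * t0 ^ (dd j' * ?n) * t0 ^ ?n"
        by (simp add: power_mult_distrib power_mult[symmetric] power_add[symmetric] algebra_simps)
      also have "\<dots> \<in> J" by (intro S.gen_mult[OF t0J] S.mult_closed S.power_closed in_S)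
      finally have 2: "(?c * t0 ^ ?n') ^ ?n \<in> J" .
      have "Y j' (dd j') ^ (?n' * ?n) \<in> J"
        using S.gen_add[OF 1 2] by (simp only: diff_add_cancel power_mult)
      moreover have "Y j' i ^ (?n' * ?n) - Y j' (dd j') ^ (?n' * ?n) \<in> J"
        using j' by (intro S.gen_cong_power Y_cong_last) auto
      ultimately have "Y j' i ^ (?n' * ?n) - Y j' (dd j') ^ (?n' * ?n) + Y j' (dd j') ^ (?n' * ?n) \<in> J"
        by (intro S.gen_add)
      then show ?thesis by (simp only: diff_add_cancel)
    qed
    have Yneg: "\<exists>n. (- Y j' i) ^ n \<in> J" if j': "j' < r" "i \<le> dd j'" for j' i
    proof -
      let ?N = "Suc (dd j') * Suc (dd j)"
      have "(-1) ^ ?N * Y j' i ^ ?N \<in> J" by (rule S.gen_mult[OF Ynil[OF that]]) auto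
      then show ?thesis by (simp only: power_minus[of "Y j' i", symmetric]) blast
    qed
    have Yneg_sum: "\<exists>n. (\<Sum>i<Suc (dd j'). - Y j' i) ^ n \<in> J" if "j' < r" for j'
      by (rule S.gen_power_sum) (use that Yneg in simp_all)
    have "\<exists>n. (\<Sum>j'<r. \<Sum>i<Suc (dd j'). - Y j' i) ^ n \<in> J"
      by (rule S.gen_power_sum) (use Yneg_sum in \<open>auto intro!: S.sum_closed S.add_closed\<close>)
    then obtain n where n: "(\<Sum>j'<r. \<Sum>i<Suc (dd j'). - Y j' i) ^ n \<in> J" by blast
    have "(t0 + (\<Sum>j'<r. \<Sum>i<Suc (dd j'). - Y j' i)) ^ (Suc (dd j) + n) \<in> J"
      by (intro S.gen_power_add t0J n S.sum_closed) auto
    then have "Fgen f 0 ^ (Suc (dd j) + n) \<in> J" by (simp only: Fgen_0 sum_negf diff_conv_add_uminus)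
    then show False using F0_not_nilpotent[OF reg] by blast
  next
    case False
    let ?p = "off dd j + 0 + 1"
    have Fp: "Fgen f ?p = 0" using Fgen_coord[of j 0] False dd_pos[OF ji(1)] ji by (simp add: Y_eq)
    have p: "?p < Suc d" using block_subset[of j r dd] ji dd_pos[of j] by (auto simp: block_def)
    have "1 \<in> S.gen (Fgen f) {..<?p}" by (rule regularD[OF reg p S.one_closed]) (simp only: Fp S.gen_zero mult_zero_left)
    moreover have "{..<?p} \<subseteq> {..<Suc d}" using p by auto
    ultimately show False using S.gen_mono[of "{..<Suc d}" "{..<?p}" "Fgen f"] one_notin_gen[OF reg] by blast
  qed
qed

end

section \<open>Evaluation at the points\<close>

lemma coord_in_block:
  assumes "l < dd j" shows "off dd j + l + 1 \<in> block dd j' \<longleftrightarrow> j' = j"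
proof
  assume "off dd j + l + 1 \<in> block dd j'"
  then obtain l' where "l' < dd j'" "off dd j + l + 1 = off dd j' + l' + 1" unfolding block_eq_image by auto
  then show "j' = j" using coord_unique[of l dd j l' j'] assms by auto
qed (use assms in \<open>auto simp: block_def\<close>)

lemma mon_eval_const_mult:
  "mon_eval \<phi> (Poly_Mapping.single 0 c * p) = c * mon_eval \<phi> (p :: 'a::monoid_add \<Rightarrow>\<^sub>0 complex)"
  by (induction p rule: poly_mapping_induct) (auto simp: mult_single distrib_left mult.assoc)

locale toric_poly_nz = toric_poly r dd a for r dd a +
  assumes a_nz: "\<And>j i. j < r \<Longrightarrow> i \<le> dd j \<Longrightarrow> a j i \<noteq> 0"
begin

abbreviation n :: "nat \<Rightarrow> nat" where "n j \<equiv> Suc (dd j)"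

definition u :: "nat \<Rightarrow> complex" where "u j = of_nat (n j) ^ n j * (\<Prod>i<n j. a j i)"

sublocale root_family r n u
proof
  fix j assume "j < r"
  then show "u j \<noteq> 0" using a_nz[of j] by (auto simp: u_def less_Suc_eq_le simp del: of_nat_Suc prod.lessThan_Suc)
qed simp

definition y :: "(nat \<Rightarrow> complex) \<Rightarrow> nat \<Rightarrow> complex" where "y z j = z j / of_nat (n j)"

lemma y_nz: "z \<in> Z \<Longrightarrow> j < r \<Longrightarrow> y z j \<noteq> 0"
  using Z_nz[of z j] by (simp add: y_def del: of_nat_Suc)

lemma y_power: "z \<in> Z \<Longrightarrow> j < r \<Longrightarrow> y z j ^ n j = (\<Prod>i<n j. a j i)"
  using Z_root[of z j] by (simp add: y_def power_divide u_def del: of_nat_Suc power_Suc prod.lessThan_Suc)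

text \<open>Monomials in \<open>t_1, \<dots>, t_d\<close> at the torus point where \<open>a_{ji} t^{v_{ji}} = y_j\<close> for all \<open>i\<close>, with \<open>t_0 = 1\<close>.\<close>
definition chi :: "(nat \<Rightarrow> complex) \<Rightarrow> (nat \<Rightarrow>\<^sub>0 int) \<Rightarrow> complex" where
  "chi z m = (\<Prod>j<r. \<Prod>i<dd j. (y z j / a j i) powi Poly_Mapping.lookup m (off dd j + i + 1))"

abbreviation phi where "phi z \<equiv> mon_eval (chi z)"

lemma chi_add: "z \<in> Z \<Longrightarrow> chi z (m + m') = chi z m * chi z m'"
  unfolding chi_def lookup_add prod.distrib[symmetric]
  using y_nz a_nz by (intro prod.cong refl power_int_add) auto

lemma phi_mult: "z \<in> Z \<Longrightarrow> phi z (p * q) = phi z p * phi z q"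
  by (intro mon_eval_mult chi_add)

lemma phi_one [simp]: "phi z 1 = 1"
  unfolding single_one[symmetric] mon_eval_single by (simp add: chi_def del: single_one)

lemma phi_power: "z \<in> Z \<Longrightarrow> phi z (p ^ k) = phi z p ^ k"
  by (induction k) (auto simp: phi_mult)

lemma phi_prod: "z \<in> Z \<Longrightarrow> phi z (prod g B) = (\<Prod>i\<in>B. phi z (g i))"
  by (induction B rule: infinite_finite_induct) (auto simp: phi_mult)

lemma phi_t0pow [simp]: "phi z (t0pow k) = 1"
  by (simp add: t0pow_def chi_def lookup_single when_def)

text \<open>For a basis vertex this is the choice of the point; for the last vertex it is the
  equation \<open>y_power\<close>.\<close>

lemma chi_vtx:
  assumes z: "z \<in> Z" and ji: "j < r" "i \<le> dd j"
  shows "a j i * chi z (vtx dd j i) = y z j"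
proof -
  have "chi z (vtx dd j i) = (\<Prod>j'<r. if j' = j then \<Prod>i'<dd j. (y z j / a j i') powi (if i = dd j then - 1 else if i = i' then 1 else 0) else 1)"
    unfolding chi_def using lookup_vtx[of i dd j, OF ji(2), simplified] by (intro prod.cong) (auto intro!: prod.neutral)
  also have "\<dots> = (\<Prod>i'<dd j. (y z j / a j i') powi (if i = dd j then - 1 else if i = i' then 1 else 0))"
    using ji by simp
  also have "a j i * \<dots> = y z j"
  proof (cases "i = dd j")
    case True
    have "(\<Prod>i'<dd j. (y z j / a j i') powi (if i = dd j then - 1 else if i = i' then 1 else 0)) = (\<Prod>i'<dd j. a j i' / y z j)"
      using True by (intro prod.cong) (auto simp: power_int_minus)
    also have "\<dots> = (\<Prod>i'<dd j. a j i') / y z j ^ dd j" by (simp add: prod_dividef)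
    also have "a j i * \<dots> = (\<Prod>i'<n j. a j i') / y z j ^ dd j" using True by simp
    also have "\<dots> = y z j" unfolding y_power[OF z ji(1), symmetric] using y_nz[OF z ji(1)] by simp
    finally show ?thesis .
  next
    case False
    then have i: "i < dd j" using ji by simp
    have "(\<Prod>i'<dd j. (y z j / a j i') powi (if i = dd j then - 1 else if i = i' then 1 else 0))
       = (\<Prod>i'<dd j. if i' = i then y z j / a j i else 1)"
      using False by (intro prod.cong) auto
    also have "\<dots> = y z j / a j i" using i by simp
    finally show ?thesis using a_nz[OF ji] by simp
  qed
  finally show ?thesis .
qed

lemma phi_Y: "z \<in> Z \<Longrightarrow> j < r \<Longrightarrow> i \<le> dd j \<Longrightarrow> phi z (Y j i) = y z j"
  using chi_vtx[of z j i] by (simp add: Y_def phi_mult)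

lemma phi_F0:
  assumes "z \<in> Z" shows "phi z (Fgen f 0) = 1 - (\<Sum>j<r. z j)"
proof -
  have "(\<Sum>j<r. \<Sum>i<n j. phi z (Y j i)) = (\<Sum>j<r. \<Sum>i<n j. y z j)"
    using assms by (intro sum.cong phi_Y) auto
  also have "\<dots> = (\<Sum>j<r. z j)" by (intro sum.cong) (simp_all add: y_def del: sum.lessThan_Suc of_nat_Suc)
  finally show ?thesis unfolding Fgen_0 by (simp del: sum.lessThan_Suc)
qed

lemma phi_F:
  assumes "z \<in> Z" "p \<in> {1..d}" shows "phi z (Fgen f p) = 0"
proof -
  obtain j i where "j < r" "i < dd j" "p = off dd j + i + 1" using assms(2) by (rule coord_exhaust)
  then show ?thesis using assms phi_Y[of z j] by (simp add: Fgen_coord[simplified])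
qed

lemma phi_J: assumes "z \<in> Z" "p \<in> J" shows "phi z p = 0"
proof -
  obtain h where "p = (\<Sum>l\<in>{1..d}. Fgen f l * h l)" by (rule S.genE[OF assms(2)]) blast
  then show ?thesis using assms(1) phi_F by (simp add: phi_mult)
qed

abbreviation C where "C c \<equiv> (Poly_Mapping.single 0 c :: lpoly)"

lemma C_mult: "C c * C c' = C (c * c')" by (simp add: mult_single)

lemma C_power: "C c ^ k = C (c ^ k)" by (simp add: single_power)

lemma C_prod: "(\<Prod>i\<in>B. C (c i)) = C (\<Prod>i\<in>B. c i)" by (simp add: prod_single)

text \<open>If \<open>z\<close> violates the claim, then \<open>F_0\<close> times the interpolation polynomial of the point \<open>z\<close>
  lies in \<open>J\<close>, contradicting that \<open>F_0\<close> is a nonzerodivisor modulo \<open>J\<close>.\<close>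
lemma regular_imp_sum_neq_1:
  assumes reg: "delta_regular V d f" and z: "z \<in> Z"
  shows "(\<Sum>j<r. z j) \<noteq> 1"
proof
  assume sum1: "(\<Sum>j<r. z j) = 1"
  define w where "w j = C (y z j) * t0" for j
  \<comment> \<open>The cofactor of \<open>Y j (dd j) - w j\<close> in the difference of the
    \<open>n j\<close>-th powers: it vanishes at the other roots of the block, and the
    \<open>t_0\<close> inside \<open>w j\<close> keeps it homogeneous.\<close>
  define G where "G j = (\<Sum>i<n j. w j ^ (n j - Suc i) * Y j (dd j) ^ i)" for j
  define g where "g = (\<Prod>j<r. G j)"
  have wS: "w j \<in> S" for j by (simp add: w_def)
  have GS: "G j \<in> S" if "j < r" for j
    unfolding G_def using that wS by (intro S.sum_closed S.mult_closed S.power_closed) auto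
  have gS: "g \<in> S" unfolding g_def using GS by (intro S.prod_closed) auto
  have G: "(Y j (dd j) - w j) * G j \<in> J" if "j < r" for j
  proof -
    have "w j ^ n j = C (\<Prod>i<n j. a j i) * t0 ^ n j"
      unfolding w_def power_mult_distrib C_power y_power[OF z that] ..
    then have "Y j (dd j) ^ n j - w j ^ n j \<in> J" using Y_power_cong[OF that] by (simp only:)
    then show ?thesis unfolding G_def power_diff_sumr2 .
  qed
  have wg: "(Y j (dd j) - w j) * g \<in> J" if "j < r" for j
  proof -
    have "(\<Prod>j'\<in>{..<r}-{j}. G j') * ((Y j (dd j) - w j) * G j) \<in> J"
      using GS by (intro S.gen_mult[OF G[OF that]] S.prod_closed) auto
    also have "(\<Prod>j'\<in>{..<r}-{j}. G j') * ((Y j (dd j) - w j) * G j) = (Y j (dd j) - w j) * g"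
      unfolding g_def using that by (subst prod.remove[of "{..<r}" j]) (auto simp: mult_ac)
    finally show ?thesis .
  qed
  have Yg: "(Y j i - w j) * g \<in> J" if "j < r" "i \<le> dd j" for j i
  proof -
    have "g * (Y j i - Y j (dd j)) \<in> J" by (rule S.gen_mult[OF Y_cong_last[OF that] gS])
    from S.gen_add[OF this wg[OF that(1)]] show ?thesis by (simp add: algebra_simps)
  qed
  \<comment> \<open>Modulo \<open>J\<close> each \<open>Y j i\<close> acts on \<open>g\<close> as
    \<open>w j\<close>. Since \<open>n j * y z j = z j\<close> and the \<open>z j\<close> sum to 1,
    the \<open>w j\<close> add up to \<open>t_0\<close>, whence \<open>F_0 * g\<close> lies in
    \<open>J\<close>.\<close>
  have "(\<Sum>j<r. \<Sum>i<n j. (Y j i - w j) * g) \<in> J" using Yg by (intro S.gen_sum) auto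
  also have "(\<Sum>j<r. \<Sum>i<n j. (Y j i - w j) * g) = ((\<Sum>j<r. \<Sum>i<n j. Y j i) - (\<Sum>j<r. \<Sum>i<n j. w j)) * g"
    by (simp only: sum_distrib_right sum_subtractf left_diff_distrib)
  also have "(\<Sum>j<r. \<Sum>i<n j. w j) = t0"
  proof -
    have "(\<Sum>i<n j. w j) = C (z j) * t0" for j
    proof -
      have "(of_nat (n j) :: lpoly) = C (of_nat (n j))" by (simp only: single_of_nat)
      then have "(\<Sum>i<n j. w j) = C (of_nat (n j)) * (C (y z j) * t0)"
        by (simp only: w_def sum_constant card_lessThan)
      also have "\<dots> = C (z j) * t0"
        by (simp add: mult.assoc[symmetric] mult_single y_def del: of_nat_Suc)
      finally show ?thesis .
    qed
    then have "(\<Sum>j<r. \<Sum>i<n j. w j) = (\<Sum>j<r. C (z j)) * t0" by (simp only: sum_distrib_right)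
    also have "(\<Sum>j<r. C (z j)) = C (\<Sum>j<r. z j)"
    proof -
      have "(\<Sum>j\<in>B. C (z j)) = C (\<Sum>j\<in>B. z j)" for B
        by (induction B rule: infinite_finite_induct) (simp_all add: single_add)
      then show ?thesis .
    qed
    finally show ?thesis by (simp add: sum1)
  qed
  finally have "((\<Sum>j<r. \<Sum>i<n j. Y j i) - t0) * g \<in> J" .
  then have "- (((\<Sum>j<r. \<Sum>i<n j. Y j i) - t0) * g) \<in> J" by (rule S.gen_uminus)
  then have "Fgen f 0 * g \<in> J" by (simp only: Fgen_0 minus_mult_left minus_diff_eq)
  then have "g \<in> J" by (rule F0_nonzerodivisor[OF reg gS])
  then have "phi z g = 0" by (rule phi_J[OF z])
  \<comment> \<open>At \<open>z\<close> itself all \<open>n j\<close> terms of \<open>G j\<close>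
    coincide, so \<open>g\<close> does not vanish there.\<close>
  moreover have "phi z (G j) = of_nat (n j) * y z j ^ dd j" if "j < r" for j
  proof -
    have "phi z (G j) = (\<Sum>i<n j. y z j ^ (n j - Suc i) * y z j ^ i)"
      using z that by (simp add: G_def w_def phi_mult phi_power mon_eval_const_mult phi_Y del: sum.lessThan_Suc)
    also have "\<dots> = (\<Sum>i<n j. y z j ^ dd j)"
      by (intro sum.cong) (auto simp: power_add[symmetric])
    finally show ?thesis by (simp del: sum.lessThan_Suc)
  qed
  ultimately show False using z y_nz[OF z] by (auto simp: g_def phi_prod simp del: of_nat_Suc)
qed

section \<open>Normal forms modulo \<open>J\<close>\<close>

lemma monomial_factorization:
  assumes m: "Poly_Mapping.lookup m 0 = int k" "in_dil V k m"
  obtains e :: "nat \<Rightarrow> nat \<Rightarrow> nat" where "(\<Sum>j<r. \<Sum>i<n j. e j i) \<le> k"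
    "Poly_Mapping.single m 1 = t0 ^ (k - (\<Sum>j<r. \<Sum>i<n j. e j i)) * (\<Prod>j<r. \<Prod>i<n j. X j i ^ e j i)"
proof -
  obtain e where e: "(\<Sum>j<r. \<Sum>i<n j. e j i) \<le> k"
    "\<And>p. p \<ge> 1 \<Longrightarrow> Poly_Mapping.lookup m p = (\<Sum>j<r. \<Sum>i<n j. int (e j i) * Poly_Mapping.lookup (vtx dd j i) p)"
    using in_dil_integral[OF m(2)] by blast
  let ?b = "k - (\<Sum>j<r. \<Sum>i<n j. e j i)"
  let ?x = "\<lambda>j i. Poly_Mapping.single 0 (int 1) + vtx dd j i"
  have eq: "m = Poly_Mapping.single 0 (int ?b) + (\<Sum>j<r. \<Sum>i<n j. \<Sum>_<e j i. ?x j i)"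
  proof (rule poly_mapping_eqI)
    fix p
    have L: "Poly_Mapping.lookup (\<Sum>j<r. \<Sum>i<n j. \<Sum>_<e j i. ?x j i) p = (\<Sum>j<r. \<Sum>i<n j. int (e j i) * Poly_Mapping.lookup (?x j i) p)"
      unfolding lookup_sum by (simp only: sum_constant card_lessThan)
    show "Poly_Mapping.lookup m p = Poly_Mapping.lookup (Poly_Mapping.single 0 (int ?b) + (\<Sum>j<r. \<Sum>i<n j. \<Sum>_<e j i. ?x j i)) p"
    proof (cases "p = 0")
      case True
      have "(\<Sum>j<r. \<Sum>i<n j. int (e j i) * Poly_Mapping.lookup (?x j i) 0) = (\<Sum>j<r. \<Sum>i<n j. int (e j i))"
      proof (intro sum.cong refl)
        fix j i assume "j \<in> {..<r}"
        then have "Poly_Mapping.lookup (?x j i) 0 = 1" using lookup_vtx_outside[of j r 0 dd i] by (simp add: lookup_add)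
        then show "int (e j i) * Poly_Mapping.lookup (?x j i) 0 = int (e j i)" by simp
      qed
      also have "\<dots> = int (\<Sum>j<r. \<Sum>i<n j. e j i)" by (simp only: of_nat_sum)
      finally show ?thesis using True m(1) e(1) L by (simp add: lookup_add of_nat_diff del: sum.lessThan_Suc of_nat_sum)
    next
      case False
      then have "Poly_Mapping.lookup (?x j i) p = Poly_Mapping.lookup (vtx dd j i) p" for j i
        by (simp add: lookup_add lookup_one when_def)
      then show ?thesis using e(2)[of p] False L by (simp add: lookup_add lookup_single when_def del: sum.lessThan_Suc)
    qed
  qed
  have X: "X j i ^ l = Poly_Mapping.single (\<Sum>_<l. ?x j i) 1" for j i l
    by (simp add: X_def t0pow_mult_single single_power)
  have "t0 ^ ?b * (\<Prod>j<r. \<Prod>i<n j. X j i ^ e j i) = Poly_Mapping.single m 1"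
    unfolding X prod_single t0pow_power t0pow_mult_single by (subst eq) simp
  then show ?thesis by (intro that[OF e(1)]) (rule sym)
qed

text \<open>The monomial \<open>y^e\<close> brought to degree \<open>k\<close> by powers of
  \<open>t_0\<close>. This is meant for total degree of \<open>e\<close> at most \<open>k\<close>;
  beyond that the subtraction truncates, and \<open>reduction\<close> gives such \<open>e\<close>
  the coefficient 0.\<close>

definition M :: "nat \<Rightarrow> (nat \<Rightarrow> nat) \<Rightarrow> lpoly" where
  "M k e = t0 ^ (k - (\<Sum>j<r. e j)) * (\<Prod>j<r. Y j (dd j) ^ e j)"

lemma M_in_S_deg:
  assumes "(\<Sum>j<r. e j) \<le> k" shows "M k e \<in> S_deg V k"
proof -
  have "(\<Prod>j<r. Y j (dd j) ^ e j) \<in> S_deg V (\<Sum>j<r. 1 * e j)"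
    by (intro S_deg_prod S_deg_power Y_in_S_deg) auto
  from S_deg_mult[OF S_deg_power[OF t0_in_S_deg, of "k - (\<Sum>j<r. e j)"] this] show ?thesis
    using assms by (simp add: M_def)
qed

lemma phi_M: "z \<in> Z \<Longrightarrow> phi z (M k e) = (\<Prod>j<r. y z j ^ e j)"
  by (simp add: M_def phi_mult phi_power phi_prod phi_Y)

text \<open>Modulo \<open>J\<close> each \<open>X j i\<close> is \<open>Y j (dd j)\<close> divided
  by \<open>a j i\<close>, and dividing the total exponent by \<open>n j\<close> trades each full
  power for \<open>t_0^{n_j}\<close>. Only the existence of the scalar is recorded, since later
  values come from evaluation at the points.\<close>

lemma block_monomial_cong:
  fixes e :: "nat \<Rightarrow> nat"
  assumes "j < r"
  obtains \<alpha> where "(\<Prod>i<n j. X j i ^ e i) -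
     C \<alpha> * (t0 ^ (n j * ((\<Sum>i<n j. e i) div n j)) * Y j (dd j) ^ ((\<Sum>i<n j. e i) mod n j)) \<in> J"
proof -
  let ?k = "\<Sum>i<n j. e i" and ?Y = "Y j (dd j)" and ?A = "\<Prod>i<n j. a j i"
  define \<beta> where "\<beta> = (\<Prod>i<n j. (1 / a j i) ^ e i)"
  have X: "X j i - C (1 / a j i) * ?Y \<in> J" if "i < n j" for i
  proof -
    have "C (1 / a j i) * (Y j i - ?Y) \<in> J" using assms that by (intro S.gen_mult[OF Y_cong_last]) auto
    moreover have "C (1 / a j i) * Y j i = X j i"
      using a_nz[of j i] assms that by (simp add: Y_eq mult.assoc[symmetric] C_mult)
    ultimately show ?thesis by (simp add: right_diff_distrib)
  qed
  have "(\<Prod>i<n j. X j i ^ e i) - (\<Prod>i<n j. (C (1 / a j i) * ?Y) ^ e i) \<in> J"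
    by (rule S.gen_cong_prod, rule_tac [3] S.gen_cong_power) (use assms X in auto)
  also have "(\<Prod>i<n j. (C (1 / a j i) * ?Y) ^ e i) = C \<beta> * ?Y ^ ?k"
    unfolding power_mult_distrib prod.distrib C_power C_prod power_sum \<beta>_def ..
  finally have 1: "(\<Prod>i<n j. X j i ^ e i) - C \<beta> * ?Y ^ ?k \<in> J" .
  have "(?Y ^ n j) ^ (?k div n j) - (C ?A * t0 ^ n j) ^ (?k div n j) \<in> J"
    by (rule S.gen_cong_power[OF _ _ Y_power_cong[OF assms]]) (use assms in auto)
  then have "(C \<beta> * ?Y ^ (?k mod n j)) * ((?Y ^ n j) ^ (?k div n j) - (C ?A * t0 ^ n j) ^ (?k div n j)) \<in> J"
    by (rule S.gen_mult) (use assms in auto)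
  also have "(C \<beta> * ?Y ^ (?k mod n j)) * ((?Y ^ n j) ^ (?k div n j) - (C ?A * t0 ^ n j) ^ (?k div n j))
     = C \<beta> * (?Y ^ (n j * (?k div n j)) * ?Y ^ (?k mod n j))
       - (C \<beta> * C (?A ^ (?k div n j))) * (t0 ^ (n j * (?k div n j)) * ?Y ^ (?k mod n j))"
    unfolding power_mult_distrib C_power power_mult by (simp only: right_diff_distrib mult_ac)
  also have "?Y ^ (n j * (?k div n j)) * ?Y ^ (?k mod n j) = ?Y ^ ?k"
    by (simp only: power_add[symmetric] mult_div_mod_eq)
  finally have 2: "C \<beta> * ?Y ^ ?k - C (\<beta> * ?A ^ (?k div n j)) * (t0 ^ (n j * (?k div n j)) * ?Y ^ (?k mod n j)) \<in> J"
    unfolding C_mult .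
  show ?thesis by (rule that[OF S.gen_cong_trans[OF 1 2]])
qed

lemma monomial_reduction:
  assumes m: "Poly_Mapping.lookup m 0 = int k" "in_dil V k m"
  obtains \<alpha> e where "e \<in> E" "(\<Sum>j<r. e j) \<le> k" "Poly_Mapping.single m 1 - C \<alpha> * M k e \<in> J"
proof -
  obtain e where e: "(\<Sum>j<r. \<Sum>i<n j. e j i) \<le> k"
    "Poly_Mapping.single m 1 = t0 ^ (k - (\<Sum>j<r. \<Sum>i<n j. e j i)) * (\<Prod>j<r. \<Prod>i<n j. X j i ^ e j i)"
    using monomial_factorization[OF m] by blast
  define s where "s j = (\<Sum>i<n j. e j i)" for j
  define e' where "e' j = (if j < r then s j mod n j else 0)" for j
  let ?Q = "\<lambda>j \<alpha>. (\<Prod>i<n j. X j i ^ e j i) - C \<alpha> * (t0 ^ (n j * (s j div n j)) * Y j (dd j) ^ (s j mod n j)) \<in> J"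
  have ex: "\<exists>\<alpha>. ?Q j \<alpha>" if "j < r" for j
    using block_monomial_cong[OF that, of "e j"] unfolding s_def by blast
  define \<alpha> where "\<alpha> j = (SOME \<alpha>. ?Q j \<alpha>)" for j
  have \<alpha>: "(\<Prod>i<n j. X j i ^ e j i) - C (\<alpha> j) * (t0 ^ (n j * (s j div n j)) * Y j (dd j) ^ e' j) \<in> J" if "j < r" for j
    using someI_ex[OF ex[OF that]] that by (simp only: \<alpha>_def e'_def if_True)
  have "(\<Prod>j<r. \<Prod>i<n j. X j i ^ e j i) - (\<Prod>j<r. C (\<alpha> j) * (t0 ^ (n j * (s j div n j)) * Y j (dd j) ^ e' j)) \<in> J"
    by (rule S.gen_cong_prod) (use \<alpha> in \<open>auto intro!: S.prod_closed S.mult_closed simp del: prod.lessThan_Suc\<close>)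
  then have "t0 ^ (k - (\<Sum>j<r. s j)) * ((\<Prod>j<r. \<Prod>i<n j. X j i ^ e j i) - (\<Prod>j<r. C (\<alpha> j) * (t0 ^ (n j * (s j div n j)) * Y j (dd j) ^ e' j))) \<in> J"
    by (rule S.gen_mult) auto
  also have "t0 ^ (k - (\<Sum>j<r. s j)) * ((\<Prod>j<r. \<Prod>i<n j. X j i ^ e j i) - (\<Prod>j<r. C (\<alpha> j) * (t0 ^ (n j * (s j div n j)) * Y j (dd j) ^ e' j)))
     = Poly_Mapping.single m 1 - C (\<Prod>j<r. \<alpha> j) * (t0 ^ (k - (\<Sum>j<r. s j) + (\<Sum>j<r. n j * (s j div n j))) * (\<Prod>j<r. Y j (dd j) ^ e' j))"
    unfolding e(2) prod.distrib C_prod power_sum[symmetric] power_add s_def by (simp only: right_diff_distrib mult_ac)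
  \<comment> \<open>The powers of \<open>t_0\<close> released by the divisions make up exactly the
    degree lost by the \<open>Y\<close>.\<close>
  also have "k - (\<Sum>j<r. s j) + (\<Sum>j<r. n j * (s j div n j)) = k - (\<Sum>j<r. e' j)"
  proof -
    have "(\<Sum>j<r. s j) = (\<Sum>j<r. n j * (s j div n j) + e' j)"
      by (intro sum.cong) (auto simp: e'_def mult_div_mod_eq simp del: mult_Suc)
    then show ?thesis using e(1) unfolding s_def[symmetric] by (simp add: sum.distrib del: mult_Suc)
  qed
  finally have "Poly_Mapping.single m 1 - C (\<Prod>j<r. \<alpha> j) * M k e' \<in> J" unfolding M_def .
  moreover have "e' \<in> E" by (auto simp: E_def ext_fun_def e'_def)
  moreover have "(\<Sum>j<r. e' j) \<le> k"
  proof -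
    have "(\<Sum>j<r. e' j) \<le> (\<Sum>j<r. s j)" by (intro sum_mono) (auto simp: e'_def)
    then show ?thesis using e(1) by (simp add: s_def)
  qed
  ultimately show ?thesis using that by blast
qed

text \<open>The second clause keeps the degree bound: for \<open>k < d\<close> it excludes the
  exponent \<open>(d_1, ..., d_r)\<close>.\<close>

lemma reduction:
  assumes p: "p \<in> S_deg V k"
  obtains c where "p - (\<Sum>e\<in>E. C (c e) * M k e) \<in> J" "\<And>e. k < (\<Sum>j<r. e j) \<Longrightarrow> c e = 0"
proof -
  define P where "P q \<longleftrightarrow> (\<exists>c. q - (\<Sum>e\<in>E. C (c e) * M k e) \<in> J \<and> (\<forall>e. k < (\<Sum>j<r. e j) \<longrightarrow> c e = 0))" for q
  have P0: "P 0" unfolding P_def by (rule exI[of _ "\<lambda>_. 0"]) simp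
  have Padd: "P (q + q')" if q: "P q" and q': "P q'" for q q'
  proof -
    obtain c where c: "q - (\<Sum>e\<in>E. C (c e) * M k e) \<in> J" "\<forall>e. k < (\<Sum>j<r. e j) \<longrightarrow> c e = 0"
      using q unfolding P_def by blast
    obtain c' where c': "q' - (\<Sum>e\<in>E. C (c' e) * M k e) \<in> J" "\<forall>e. k < (\<Sum>j<r. e j) \<longrightarrow> c' e = 0"
      using q' unfolding P_def by blast
    have "q + q' - (\<Sum>e\<in>E. C (c e + c' e) * M k e)
       = (q - (\<Sum>e\<in>E. C (c e) * M k e)) + (q' - (\<Sum>e\<in>E. C (c' e) * M k e))"
      by (simp add: single_add distrib_right sum.distrib)
    also have "\<dots> \<in> J" by (rule S.gen_add[OF c(1) c'(1)])
    finally show ?thesis unfolding P_def using c(2) c'(2) by (intro exI[of _ "\<lambda>e. c e + c' e"]) auto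
  qed
  have Psingle: "P (Poly_Mapping.single m x)" if m: "m \<in> Poly_Mapping.keys p" for m x
  proof -
    obtain \<alpha> e where e: "e \<in> E" "(\<Sum>j<r. e j) \<le> k" "Poly_Mapping.single m 1 - C \<alpha> * M k e \<in> J"
      using p m monomial_reduction[of m k] unfolding S_deg_def by blast
    have "C x * (Poly_Mapping.single m 1 - C \<alpha> * M k e) \<in> J" by (rule S.gen_mult[OF e(3)]) simp
    also have "C x * (Poly_Mapping.single m 1 - C \<alpha> * M k e) = Poly_Mapping.single m x - C (x * \<alpha>) * M k e"
      by (simp add: right_diff_distrib mult_single mult.assoc[symmetric])
    also have "C (x * \<alpha>) * M k e = (\<Sum>e'\<in>E. if e' = e then C (x * \<alpha>) * M k e else 0)"
      using e(1) finite_E by simp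
    also have "\<dots> = (\<Sum>e'\<in>E. C (if e' = e then x * \<alpha> else 0) * M k e')" by (intro sum.cong) auto
    finally show ?thesis unfolding P_def using e(2) by (intro exI[of _ "\<lambda>e'. if e' = e then x * \<alpha> else 0"]) auto
  qed
  have "P (\<Sum>m\<in>B. Poly_Mapping.single m (Poly_Mapping.lookup p m))" if "B \<subseteq> Poly_Mapping.keys p" for B
    using that by (induction B rule: infinite_finite_induct) (simp_all add: P0 Padd Psingle)
  from this[OF order_refl] have "P p" unfolding poly_mapping_sum_single[of p, symmetric] .
  then show ?thesis using that unfolding P_def by blast
qed

lemma phi_reduction:
  assumes "z \<in> Z" "p - (\<Sum>e\<in>E. C (c e) * M k e) \<in> J"
  shows "phi z p = (\<Sum>e\<in>E. c e * (\<Prod>j<r. y z j ^ e j))"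
  using phi_J[OF assms] assms(1) by (simp add: mon_eval_const_mult phi_M)

text \<open>The normal form of \<open>p\<close> vanishes on all points, and its monomials are
  independent there by \<open>coeffs_eq_0\<close>, so all its coefficients are zero.\<close>

lemma vanishing_imp_in_J:
  assumes p: "p \<in> S_deg V k" and van: "\<And>z. z \<in> Z \<Longrightarrow> phi z p = 0"
  shows "p \<in> J"
proof -
  obtain c where c: "p - (\<Sum>e\<in>E. C (c e) * M k e) \<in> J" using reduction[OF p] by blast
  have "c e / (\<Prod>j<r. of_nat (n j) ^ e j) = 0" if "e \<in> E" for e
  proof (rule coeffs_eq_0[OF _ that])
    fix z assume z: "z \<in> Z"
    have "(\<Sum>e\<in>E. c e / (\<Prod>j<r. of_nat (n j) ^ e j) * (\<Prod>j<r. z j ^ e j)) = (\<Sum>e\<in>E. c e * (\<Prod>j<r. y z j ^ e j))"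
      by (intro sum.cong refl) (simp add: y_def power_divide prod_dividef del: of_nat_Suc)
    then show "(\<Sum>e\<in>E. c e / (\<Prod>j<r. of_nat (n j) ^ e j) * (\<Prod>j<r. z j ^ e j)) = 0"
      using phi_reduction[OF z c] van[OF z] by simp
  qed
  then have "c e = 0" if "e \<in> E" for e using that by (simp del: of_nat_Suc)
  then have "(\<Sum>e\<in>E. C (c e) * M k e) = 0" by (intro sum.neutral) auto
  then show ?thesis using c by simp
qed

text \<open>An analogue of the Euler-Jacobi vanishing. Below degree \<open>d\<close> the exponent
  \<open>(d_1, ..., d_r)\<close> is absent from the normal form; for any other \<open>e\<close> some
  \<open>d_j - e_j\<close> lies strictly between 0 and \<open>n_j\<close>, and the sum over the
  roots of that block vanishes.\<close>

lemma low_degree_sum_eq_0: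
  assumes p: "p \<in> S_deg V k" and k: "k < d"
  shows "(\<Sum>z\<in>Z. phi z p / (\<Prod>j<r. z j ^ dd j)) = 0"
proof -
  obtain c where c: "p - (\<Sum>e\<in>E. C (c e) * M k e) \<in> J" "\<And>e. k < (\<Sum>j<r. e j) \<Longrightarrow> c e = 0"
    using reduction[OF p] by blast
  have "(\<Sum>z\<in>Z. phi z p / (\<Prod>j<r. z j ^ dd j))
     = (\<Sum>z\<in>Z. \<Sum>e\<in>E. c e / (\<Prod>j<r. of_nat (n j) ^ e j) * (\<Prod>j<r. z j powi (int (e j) - int (dd j))))"
  proof (intro sum.cong refl)
    fix z assume z: "z \<in> Z"
    have "(\<Prod>j<r. y z j ^ e j) / (\<Prod>j<r. z j ^ dd j)
        = (\<Prod>j<r. z j powi (int (e j) - int (dd j))) / (\<Prod>j<r. of_nat (n j) ^ e j)" for e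
      unfolding prod_dividef[symmetric] using Z_nz[OF z]
      by (intro prod.cong) (auto simp: y_def power_int_diff power_divide simp del: of_nat_Suc)
    then show "phi z p / (\<Prod>j<r. z j ^ dd j)
      = (\<Sum>e\<in>E. c e / (\<Prod>j<r. of_nat (n j) ^ e j) * (\<Prod>j<r. z j powi (int (e j) - int (dd j))))"
      unfolding phi_reduction[OF z c(1)] sum_divide_distrib times_divide_eq_right[symmetric]
      by (simp del: of_nat_Suc)
  qed
  also have "\<dots> = (\<Sum>e\<in>E. c e / (\<Prod>j<r. of_nat (n j) ^ e j) * (\<Sum>z\<in>Z. \<Prod>j<r. z j powi (int (e j) - int (dd j))))"
    by (subst sum.swap) (simp only: sum_distrib_left)
  also have "\<dots> = 0"
  proof (intro sum.neutral ballI)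
    fix e assume e: "e \<in> E"
    show "c e / (\<Prod>j<r. of_nat (n j) ^ e j) * (\<Sum>z\<in>Z. \<Prod>j<r. z j powi (int (e j) - int (dd j))) = 0"
    proof (cases "\<forall>j<r. e j = dd j")
      case True
      then have "(\<Sum>j<r. e j) = d" by (simp add: off_def)
      then show ?thesis using c(2) k by simp
    next
      case False
      then obtain j where j: "j < r" "e j \<noteq> dd j" by blast
      then have "e j < dd j" using e by (auto simp: E_def ext_fun_def less_Suc_eq_le)
      then have "\<not> int (n j) dvd int (e j) - int (dd j)"
        using zdvd_not_zless[of "int (dd j) - int (e j)" "int (n j)"] by (auto simp: dvd_diff_commute)
      then show ?thesis using sum_Z_monomial_eq_0[OF j(1), of "\<lambda>j. int (e j) - int (dd j)"] by simp
    qed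
  qed
  finally show ?thesis .
qed

end

section \<open>The residue\<close>

context toric_poly_nz begin

lemma phi_fder_fder:
  assumes z: "z \<in> Z"
  shows "phi z (fder (fder f q) p) = hat 0 p * hat 0 q - (\<Sum>j<r. \<Sum>i<n j. y z j * hat (vtx dd j i) q * hat (vtx dd j i) p)"
proof -
  have fder_diff: "fder (g - h) i = fder g i - fder h i" for g h i by (simp add: fder_def theta_diff)
  have "fder (fder f q) p = Poly_Mapping.single 0 (hat 0 p * (hat 0 q * 1)) -
     (\<Sum>j<r. \<Sum>i<n j. Poly_Mapping.single (vtx dd j i) (hat (vtx dd j i) p * (hat (vtx dd j i) q * a j i)))"
    unfolding fpoly_def single_one[symmetric] fder_diff fder_sum fder_single ..
  then have "phi z (fder (fder f q) p) = hat 0 p * hat 0 q * chi z 0 -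
     (\<Sum>j<r. \<Sum>i<n j. hat (vtx dd j i) p * (hat (vtx dd j i) q * a j i) * chi z (vtx dd j i))"
    by (simp del: sum.lessThan_Suc single_one)
  also have "chi z 0 = 1" by (simp add: chi_def)
  also have "(\<Sum>j<r. \<Sum>i<n j. hat (vtx dd j i) p * (hat (vtx dd j i) q * a j i) * chi z (vtx dd j i))
     = (\<Sum>j<r. \<Sum>i<n j. y z j * hat (vtx dd j i) q * hat (vtx dd j i) p)"
  proof (intro sum.cong refl)
    fix j i assume "j \<in> {..<r}" "i \<in> {..<n j}"
    then have "a j i * chi z (vtx dd j i) = y z j" using chi_vtx[OF z] by auto
    then show "hat (vtx dd j i) p * (hat (vtx dd j i) q * a j i) * chi z (vtx dd j i) = y z j * hat (vtx dd j i) q * hat (vtx dd j i) p"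
      by (simp add: mult_ac)
  qed
  finally show ?thesis by (simp del: sum.lessThan_Suc)
qed

text \<open>Outside the corner, the first row and column contain logarithmic derivatives of
  \<open>f\<close>, which vanish at the points. Inside a block the last vertex contributes
  \<open>- y_j\<close> to every entry, and each basis vertex adds the same to its diagonal
  entry.\<close>

lemma phi_fder_fder_eq_hess_entry:
  assumes z: "z \<in> Z" and pq: "p \<le> d" "q \<le> d"
  shows "phi z (fder (fder f q) p) = hess_entry r dd (1 - (\<Sum>j<r. z j)) (y z) p q"
proof -
  have sum_y: "(\<Sum>j<r. \<Sum>i<n j. y z j) = (\<Sum>j<r. z j)"
    by (intro sum.cong) (simp_all add: y_def del: sum.lessThan_Suc of_nat_Suc)
  have hat: "hat w (off dd j + l + 1) = of_int (Poly_Mapping.lookup w (off dd j + l + 1))" for w j l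
    by (simp add: hat_def)
  consider "p = 0" "q = 0" | "p = 0" "q \<in> {1..d}" | "p \<in> {1..d}" "q = 0" | "p \<in> {1..d}" "q \<in> {1..d}"
    using pq by force
  then show ?thesis
  proof cases
    case 1
    then show ?thesis unfolding phi_fder_fder[OF z] using sum_y by (simp add: hat_def hess_entry_def del: sum.lessThan_Suc)
  next
    case 2
    then obtain j l where jl: "j < r" "l < dd j" "q = off dd j + l + 1" using coord_exhaust by blast
    have "(\<Sum>j<r. \<Sum>i<n j. y z j * hat (vtx dd j i) q * hat (vtx dd j i) p) = 0"
      using sum_block_coord[OF jl(1,2), of "\<lambda>j i. y z j"] 2 unfolding jl(3) hat
      by (simp add: hat_def[of _ 0] del: sum.lessThan_Suc)
    then show ?thesis unfolding phi_fder_fder[OF z] using 2 jl by (simp add: hat_def[of 0] hess_entry_def block_def)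
  next
    case 3
    then obtain j l where jl: "j < r" "l < dd j" "p = off dd j + l + 1" using coord_exhaust by blast
    have "(\<Sum>j<r. \<Sum>i<n j. y z j * hat (vtx dd j i) q * hat (vtx dd j i) p) = 0"
      using sum_block_coord[OF jl(1,2), of "\<lambda>j i. y z j"] 3 unfolding jl(3) hat
      by (simp add: hat_def[of _ 0] del: sum.lessThan_Suc)
    then show ?thesis unfolding phi_fder_fder[OF z] using 3 jl by (simp add: hat_def[of 0] hess_entry_def block_def)
  next
    case 4
    obtain j l where jl: "j < r" "l < dd j" "p = off dd j + l + 1" using 4(1) by (rule coord_exhaust)
    obtain j' l' where jl': "j' < r" "l' < dd j'" "q = off dd j' + l' + 1" using 4(2) by (rule coord_exhaust)
    have "(\<Sum>j<r. \<Sum>i<n j. y z j * hat (vtx dd j i) q * hat (vtx dd j i) p)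
       = y z j * hat (vtx dd j l) q - y z j * hat (vtx dd j (dd j)) q"
      using sum_block_coord[OF jl(1,2), of "\<lambda>j i. y z j * hat (vtx dd j i) q"] unfolding jl(3) hat .
    also have "\<dots> = (if j = j' then y z j * (if p = q then 2 else 1) else 0)"
      unfolding jl'(3) hat jl(3) using jl jl' by (auto simp: lookup_vtx[simplified])
    finally have "phi z (fder (fder f q) p) = - (if j = j' then y z j * (if p = q then 2 else 1) else 0)"
      unfolding phi_fder_fder[OF z] using jl by (simp add: hat_def[of 0] del: sum.lessThan_Suc)
    also have "\<dots> = (\<Sum>k<r. if k = j then (if j = j' then - y z j * (if p = q then 2 else 1) else 0) else 0)"
      using jl by simp
    also have "\<dots> = (\<Sum>k<r. if p \<in> block dd k \<and> q \<in> block dd k then - y z k * (if p = q then 2 else 1) else 0)"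
      unfolding jl(3) jl'(3) coord_in_block[of l dd j, OF jl(2)] coord_in_block[of l' dd j', OF jl'(2)] by (intro sum.cong) auto
    finally show ?thesis using jl unfolding hess_entry_def by simp
  qed
qed

lemma phi_hessH:
  assumes z: "z \<in> Z"
  shows "phi z (hessH d f) = (1 - (\<Sum>j<r. z j)) * (\<Prod>j<r. (- y z j) ^ dd j * of_nat (n j))"
proof -
  have phi_of_int: "phi z (of_int k) = of_int k" for k
    unfolding single_of_int[symmetric] by (simp add: chi_def)
  have "phi z (hessH d f) = (\<Sum>\<sigma> | \<sigma> permutes {0..d}. of_int (sign \<sigma>) * (\<Prod>i\<in>{0..d}. phi z (fder (fder f (\<sigma> i)) i)))"
    unfolding hessH_def phi_mult[OF z] phi_t0pow mon_eval_sum phi_prod[OF z] phi_of_int by simp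
  also have "\<dots> = (\<Sum>\<sigma> | \<sigma> permutes {0..d}. of_int (sign \<sigma>) * (\<Prod>i\<in>{0..d}. hess_entry r dd (1 - (\<Sum>j<r. z j)) (y z) i (\<sigma> i)))"
  proof (intro sum.cong refl arg_cong2[of _ _ _ _ "(*)"] prod.cong)
    fix \<sigma> i assume "\<sigma> \<in> {\<sigma>. \<sigma> permutes {0..d}}" "i \<in> {0..d}"
    then have "\<sigma> i \<in> {0..d}" using permutes_in_image[of \<sigma> "{0..d}" i] by simp
    then show "phi z (fder (fder f (\<sigma> i)) i) = hess_entry r dd (1 - (\<Sum>j<r. z j)) (y z) i (\<sigma> i)"
      using \<open>i \<in> {0..d}\<close> by (intro phi_fder_fder_eq_hess_entry[OF z]) auto
  qed
  finally show ?thesis unfolding leibniz_hess_entry by simp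
qed

definition w :: "(nat \<Rightarrow> complex) \<Rightarrow> complex" where
  "w z = (\<Prod>j<r. z j ^ dd j) * (1 - (\<Sum>j<r. z j))"

text \<open>The inverse of \<open>(-1)^d \<Prod> n_j^{1 - d_j}\<close>, the value of the Hessian
  divided by \<open>w\<close>, which is the same at every point. The number
  \<open>\<Prod> n_j\<close> of points then accounts for the normalized volume.\<close>

definition kappa :: complex where
  "kappa = (-1) ^ d * (\<Prod>j<r. of_nat (n j) powi (int (dd j) - 1))"

text \<open>The value 0 off \<open>S_deg V d\<close> matches the last clause of
  \<open>is_toric_res\<close>, which determines the function on the whole type.\<close>

definition res :: "lpoly \<Rightarrow> complex" where
  "res p = (if p \<in> S_deg V d then kappa * (\<Sum>z\<in>Z. phi z p / w z) else 0)"

lemma kappa_nz: "kappa \<noteq> 0" by (auto simp: kappa_def simp del: of_nat_Suc)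

context
  assumes sum_neq_1: "\<And>z. z \<in> Z \<Longrightarrow> (\<Sum>j<r. z j) \<noteq> 1"
begin

lemma res_hessH: "res (hessH d f) = of_real (normVol d V)"
proof -
  have "phi z (hessH d f) / w z = (-1) ^ d * (\<Prod>j<r. of_nat (n j) powi (1 - int (dd j)))" if z: "z \<in> Z" for z
  proof -
    have z1: "1 - (\<Sum>j<r. z j) \<noteq> 0" using sum_neq_1[OF z] by simp
    have "phi z (hessH d f) / w z = (\<Prod>j<r. (- y z j) ^ dd j * of_nat (n j)) / (\<Prod>j<r. z j ^ dd j)"
      unfolding phi_hessH[OF z] w_def using z1 by (simp del: of_nat_Suc add: mult.commute)
    also have "\<dots> = (\<Prod>j<r. (-1) ^ dd j * of_nat (n j) powi (1 - int (dd j)))"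
      unfolding prod_dividef[symmetric]
    proof (intro prod.cong refl)
      fix j assume "j \<in> {..<r}"
      then have "z j \<noteq> 0" using Z_nz[OF z] by simp
      then show "(- y z j) ^ dd j * of_nat (n j) / z j ^ dd j = (-1) ^ dd j * of_nat (n j) powi (1 - int (dd j))"
        unfolding power_minus[of "y z j"] by (simp add: y_def power_divide power_int_diff del: of_nat_Suc)
    qed
    also have "\<dots> = (-1) ^ d * (\<Prod>j<r. of_nat (n j) powi (1 - int (dd j)))"
      by (simp add: prod.distrib power_sum[symmetric] off_def del: of_nat_Suc)
    finally show ?thesis .
  qed
  then have "(\<Sum>z\<in>Z. phi z (hessH d f) / w z) = (\<Sum>z\<in>Z. 1 * ((-1) ^ d * (\<Prod>j<r. of_nat (n j) powi (1 - int (dd j)))))"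
    by (intro sum.cong) simp_all
  also have "\<dots> = (\<Prod>j<r. of_nat (n j)) * ((-1) ^ d * (\<Prod>j<r. of_nat (n j) powi (1 - int (dd j))))"
    unfolding sum_distrib_right[symmetric] sum_Z_one ..
  finally have "res (hessH d f) = (((-1) ^ d * (-1) ^ d) * (\<Prod>j<r. of_nat (n j) powi (int (dd j) - 1) * (of_nat (n j) powi (1 - int (dd j))))) * (\<Prod>j<r. of_nat (n j))"
    using hessH_f_in_S_deg unfolding prod.distrib by (simp add: res_def kappa_def mult_ac del: of_nat_Suc)
  also have "(\<Prod>j<r. of_nat (n j) powi (int (dd j) - 1) * (of_nat (n j) powi (1 - int (dd j)))) = (1::complex)"
    by (intro prod.neutral ballI) (simp add: power_int_add[symmetric] del: of_nat_Suc)
  also have "(-1) ^ d * (-1) ^ d = (1::complex)" by (simp add: power_add[symmetric])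
  finally show ?thesis unfolding normVol_V by simp
qed

lemma res_is_toric_res: "is_toric_res V d f res"
  unfolding is_toric_res_def
proof (intro conjI ballI allI impI)
  fix p q assume "p \<in> S_deg V d" "q \<in> S_deg V d"
  then show "res (p + q) = res p + res q"
    by (simp add: res_def S_deg_add add_divide_distrib sum.distrib distrib_left)
next
  fix c p assume "p \<in> S_deg V d"
  then show "res (Poly_Mapping.single 0 c * p) = c * res p"
    by (simp add: res_def S_deg_smult mon_eval_const_mult) (simp add: sum_distrib_left mult_ac)
next
  fix g assume g: "\<forall>i\<le>d. g i \<in> S_deg V (d - 1)"
  \<comment> \<open>Only the term with \<open>F_0\<close> survives at a point, and its value cancels
    the factor \<open>1 - \<Sum> z_j\<close> of \<open>w\<close>, so
    \<open>low_degree_sum_eq_0\<close> becomes applicable.\<close>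
  have "phi z (\<Sum>i\<le>d. Fgen f i * g i) / w z = phi z (g 0) / (\<Prod>j<r. z j ^ dd j)" if z: "z \<in> Z" for z
  proof -
    have "phi z (\<Sum>i\<le>d. Fgen f i * g i) = (\<Sum>i\<le>d. phi z (Fgen f i) * phi z (g i))"
      using z by (simp add: phi_mult)
    also have "\<dots> = (\<Sum>i\<le>d. if i = 0 then phi z (Fgen f 0) * phi z (g 0) else 0)"
      using phi_F[OF z] by (intro sum.cong) auto
    also have "\<dots> = (1 - (\<Sum>j<r. z j)) * phi z (g 0)" using phi_F0[OF z] by simp
    finally show ?thesis using sum_neq_1[OF z] by (simp add: w_def)
  qed
  then have "(\<Sum>z\<in>Z. phi z (\<Sum>i\<le>d. Fgen f i * g i) / w z) = 0"
    using low_degree_sum_eq_0[of "g 0" "d - 1"] g d_pos by simp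
  then show "res (\<Sum>i\<le>d. Fgen f i * g i) = 0" by (simp add: res_def)
next
  show "res (hessH d f) = of_real (normVol d V)" by (rule res_hessH)
qed (simp add: res_def)

lemma J_graded:
  assumes q: "q \<in> J" "q \<in> S_deg V d"
  obtains g where "\<And>l. l \<in> {1..d} \<Longrightarrow> g l \<in> S_deg V (d - 1)" "q = (\<Sum>l\<in>{1..d}. Fgen f l * g l)"
proof -
  obtain h where h: "\<And>l. l \<in> {1..d} \<Longrightarrow> h l \<in> S" "q = (\<Sum>l\<in>{1..d}. Fgen f l * h l)"
    by (rule S.genE[OF q(1)]) blast
  have "q = deg_part (Suc (d - 1)) q" using deg_part_id[OF q(2)] d_pos by simp
  also have "\<dots> = (\<Sum>l\<in>{1..d}. Fgen f l * deg_part (d - 1) (h l))"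
    unfolding h(2) deg_part_sum
    using Fgen_in_S_deg by (intro sum.cong refl deg_part_mult) (auto simp: S_deg_def)
  finally show ?thesis using h(1) deg_part_in_S_deg by (intro that[of "\<lambda>l. deg_part (d - 1) (h l)"]) auto
qed

text \<open>If \<open>q\<close> equals \<open>F_0 * g0\<close> modulo \<open>J\<close>, then
  \<open>g0\<close> must take the values \<open>G z\<close>. Interpolation of \<open>G\<close> stays
  in degree \<open>d - 1\<close> once its coefficient at \<open>top\<close> vanishes, and that
  coefficient is \<open>res q\<close> up to a nonzero factor.\<close>

lemma res_kernel:
  assumes q: "q \<in> S_deg V d" "res q = 0"
  obtains g where "\<forall>i\<le>d. g i \<in> S_deg V (d - 1)" "q = (\<Sum>i\<le>d. Fgen f i * g i)"
proof -
  let ?N = "\<Prod>j<r. of_nat (n j) :: complex"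
  define G where "G z = phi z q / (1 - (\<Sum>j<r. z j))" for z
  define h where "h e = (\<Sum>z'\<in>Z. G z' * (\<Prod>j<r. z' j powi (- int (e j)))) / ?N" for e
  define top where "top j = (if j < r then dd j else 0)" for j
  have topE: "top \<in> E" by (auto simp: E_def ext_fun_def top_def)
  have htop: "h top = 0"
  proof -
    have "(\<Sum>z\<in>Z. G z * (\<Prod>j<r. z j powi (- int (top j)))) = (\<Sum>z\<in>Z. phi z q / w z)"
    proof (intro sum.cong refl)
      fix z :: "nat \<Rightarrow> complex"
      have "(\<Prod>j<r. z j powi (- int (top j))) = (\<Prod>j<r. inverse (z j ^ dd j))"
        by (intro prod.cong) (auto simp: top_def power_int_minus)
      also have "\<dots> = inverse (\<Prod>j<r. z j ^ dd j)" by (simp add: prod_inversef[symmetric] comp_def)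
      finally show "G z * (\<Prod>j<r. z j powi (- int (top j))) = phi z q / w z"
        by (simp add: G_def w_def field_simps)
    qed
    also have "\<dots> = 0" using q kappa_nz by (simp add: res_def)
    finally show ?thesis by (simp add: h_def)
  qed
  \<comment> \<open>\<open>M (d - 1) e\<close> evaluates to \<open>\<Prod> y_j^{e_j}\<close>; the
    powers of \<open>n j\<close> convert this to \<open>\<Prod> z_j^{e_j}\<close>.\<close>
  define g0 where "g0 = (\<Sum>e\<in>E - {top}. C (h e * (\<Prod>j<r. of_nat (n j) ^ e j)) * M (d - 1) e)"
  have g0: "g0 \<in> S_deg V (d - 1)"
    unfolding g0_def
  proof (intro S_deg_sum S_deg_smult M_in_S_deg)
    fix e assume e: "e \<in> E - {top}"
    have le: "e j \<le> dd j" if "j < r" for j using e that by (auto simp: E_def ext_fun_def less_Suc_eq_le)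
    obtain j where j: "j < r" "e j \<noteq> top j"
      using e topE ext_fun_neqE[of e r "\<lambda>j. {..<n j}" top "\<lambda>j. {..<n j}"] unfolding E_def by blast
    have "(\<Sum>j<r. e j) < (\<Sum>j<r. dd j)"
      using le j by (intro sum_strict_mono_ex1) (auto simp: top_def intro!: bexI[of _ j] le_neq_implies_less)
    then show "(\<Sum>j<r. e j) \<le> d - 1" by (simp add: off_def)
  qed
  have phi_g0: "phi z g0 = G z" if z: "z \<in> Z" for z
  proof -
    have "phi z g0 = (\<Sum>e\<in>E - {top}. h e * (\<Prod>j<r. of_nat (n j) ^ e j) * (\<Prod>j<r. y z j ^ e j))"
      by (simp only: g0_def mon_eval_sum mon_eval_const_mult phi_M[OF z])
    also have "\<dots> = (\<Sum>e\<in>E - {top}. h e * (\<Prod>j<r. z j ^ e j))"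
      by (intro sum.cong refl) (simp add: y_def power_divide prod_dividef del: of_nat_Suc)
    also have "\<dots> = (\<Sum>e\<in>E. h e * (\<Prod>j<r. z j ^ e j))"
      using topE finite_E htop by (simp add: sum.remove[of E top])
    also have "\<dots> = G z" unfolding h_def by (rule fourier_inversion[OF z])
    finally show ?thesis .
  qed
  have F0g0: "Fgen f 0 * g0 \<in> S_deg V d"
    using S_deg_mult[OF Fgen_in_S_deg g0, of 0] d_pos by simp
  have "q - Fgen f 0 * g0 \<in> J"
  proof (rule vanishing_imp_in_J)
    show "q - Fgen f 0 * g0 \<in> S_deg V d" by (rule S_deg_diff[OF q(1) F0g0])
    fix z assume z: "z \<in> Z"
    show "phi z (q - Fgen f 0 * g0) = 0"
      using z sum_neq_1[OF z] by (simp add: phi_mult phi_F0 phi_g0 G_def)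
  qed
  moreover have "q - Fgen f 0 * g0 \<in> S_deg V d" by (rule S_deg_diff[OF q(1) F0g0])
  ultimately obtain g where g: "\<And>l. l \<in> {1..d} \<Longrightarrow> g l \<in> S_deg V (d - 1)" "q - Fgen f 0 * g0 = (\<Sum>l\<in>{1..d}. Fgen f l * g l)"
    by (rule J_graded) blast
  show ?thesis
  proof (rule that[of "g(0 := g0)"])
    show "\<forall>i\<le>d. (g(0 := g0)) i \<in> S_deg V (d - 1)" using g(1) g0 by auto
    have "{..d} - {0} = {1..d}" by auto
    then have "(\<Sum>i\<le>d. Fgen f i * (g(0 := g0)) i) = Fgen f 0 * g0 + (\<Sum>i\<in>{1..d}. Fgen f i * (g(0 := g0)) i)"
      by (subst sum.remove[of "{..d}" 0]) auto
    also have "(\<Sum>i\<in>{1..d}. Fgen f i * (g(0 := g0)) i) = q - Fgen f 0 * g0"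
      unfolding g(2) by (intro sum.cong) auto
    finally show "q = (\<Sum>i\<le>d. Fgen f i * (g(0 := g0)) i)" by simp
  qed
qed

text \<open>Subtracting a multiple of the Hessian moves \<open>p\<close> into the kernel of
  \<open>res\<close>, where \<open>R\<close> vanishes too by \<open>res_kernel\<close>. Both agree
  on the Hessian, whose prescribed value is nonzero.\<close>

lemma toric_res_unique:
  assumes R: "is_toric_res V d f R" shows "R = res"
proof
  fix p
  show "R p = res p"
  proof (cases "p \<in> S_deg V d")
    case False
    then show ?thesis using R by (simp add: is_toric_res_def res_def)
  next
    case True
    let ?H = "hessH d f" and ?v = "complex_of_real (normVol d V)"
    note rd = R[unfolded is_toric_res_def] res_is_toric_res[unfolded is_toric_res_def]
    have v: "?v \<noteq> 0" unfolding normVol_V by (simp del: of_nat_Suc)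
    define c where "c = res p / ?v"
    define q where "q = p + C (- c) * ?H"
    have cH: "C (- c) * ?H \<in> S_deg V d" by (intro S_deg_smult hessH_f_in_S_deg)
    have lin: "T q = T p + (- c) * T ?H" if "is_toric_res V d f T" for T
      using that[unfolded is_toric_res_def] True cH hessH_f_in_S_deg by (simp add: q_def)
    have qS: "q \<in> S_deg V d" unfolding q_def by (intro S_deg_add True cH)
    have "res q = 0" using lin[OF res_is_toric_res] v by (simp add: res_hessH c_def)
    with qS obtain g where "\<forall>i\<le>d. g i \<in> S_deg V (d - 1)" "q = (\<Sum>i\<le>d. Fgen f i * g i)" by (rule res_kernel)
    then have "R q = 0" using rd(1) by simp
    then show ?thesis using lin[OF R] rd(1) v by (simp add: c_def)
  qed
qed

lemma toric_res_eq: "toric_res V d f = res"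
  unfolding toric_res_def using res_is_toric_res toric_res_unique by (intro the_equality)

end

end

theorem mainTheorem10:
  fixes r :: nat and dd :: "nat \<Rightarrow> nat" and a :: "nat \<Rightarrow> nat \<Rightarrow> complex"
    and k :: "nat \<Rightarrow> nat \<Rightarrow> nat"
  assumes "r \<ge> 1"
    and "\<forall>j<r. dd j \<ge> 1"
    and "(\<Sum>j<r. \<Sum>i<Suc (dd j). k j i) = (\<Sum>j<r. dd j)"
    and "delta_regular (Vset r dd) (\<Sum>j<r. dd j) (fpoly r dd a)"
  shows "(-1) ^ (\<Sum>j<r. dd j) *
           toric_res (Vset r dd) (\<Sum>j<r. dd j) (fpoly r dd a)
             (t0pow (\<Sum>j<r. dd j) *
                (\<Prod>j<r. \<Prod>i<Suc (dd j). (Poly_Mapping.single (vtx dd j i) (a j i)) ^ k j i))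
       = (let n = (\<lambda>j. Suc (dd j));
              kk = (\<lambda>j. \<Sum>i<n j. k j i);
              u = (\<lambda>j. of_nat (n j) ^ n j * (\<Prod>i<n j. a j i))
          in (\<Prod>j<r. (of_nat (n j) :: complex) powi (int (dd j) - int (kk j) - 1)) *
             (\<Sum>z\<in>{z :: nat \<Rightarrow> complex. (\<forall>j<r. z j ^ n j = u j) \<and> (\<forall>j\<ge>r. z j = 0)}.
                1 / ((\<Prod>j<r. z j powi (int (dd j) - int (kk j))) * (1 - (\<Sum>j<r. z j)))))"
proof -
  have d: "(\<Sum>j<r. dd j) = off dd r" by (simp add: off_def)
  have reg: "delta_regular (Vset r dd) (off dd r) (fpoly r dd a)" using assms(4) by (simp only: d)
  have blocks: "toric_blocks r dd" using assms(1,2) by unfold_locales auto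
  interpret Q: toric_poly_nz r dd a
    using blocks toric_poly.regular_imp_nonzero[OF _ reg]
    by (auto simp: toric_poly_nz_def toric_poly_nz_axioms_def toric_poly_def)
  have res: "toric_res (Vset r dd) (off dd r) (fpoly r dd a) = Q.res"
    by (rule Q.toric_res_eq) (rule Q.regular_imp_sum_neq_1[OF reg])
  define kk where "kk j = (\<Sum>i<Suc (dd j). k j i)" for j
  let ?m = "t0pow (off dd r) * (\<Prod>j<r. \<Prod>i<Suc (dd j). (Poly_Mapping.single (vtx dd j i) (a j i)) ^ k j i)"
  \<comment> \<open>The monomial \<open>x^k\<close> has degree \<open>d\<close>, so
    \<open>t_0^d\<close> supplies exactly one \<open>t_0\<close> to each of its factors.\<close>
  have m: "?m = (\<Prod>j<r. \<Prod>i<Suc (dd j). Q.Y j i ^ k j i)"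
  proof -
    have "t0pow (off dd r) = t0pow 1 ^ (\<Sum>j<r. \<Sum>i<Suc (dd j). k j i)"
      unfolding t0pow_power assms(3) d ..
    then have "t0pow (off dd r) = (\<Prod>j<r. \<Prod>i<Suc (dd j). t0pow 1 ^ k j i)"
      by (simp only: power_sum)
    then show ?thesis by (simp only: Q.Y_def power_mult_distrib prod.distrib)
  qed
  have mS: "?m \<in> S_deg (Vset r dd) (off dd r)"
  proof -
    have "(\<Prod>j<r. \<Prod>i<Suc (dd j). Q.Y j i ^ k j i) \<in> S_deg (Vset r dd) (\<Sum>j<r. \<Sum>i<Suc (dd j). 1 * k j i)"
      by (intro S_deg_prod S_deg_power Q.Y_in_S_deg) auto
    then show ?thesis unfolding m using assms(3) by (simp only: mult_1 d)
  qed
  have phi_m: "Q.phi z ?m = (\<Prod>j<r. Q.y z j ^ kk j)" if "z \<in> Q.Z" for z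
  proof -
    have "Q.phi z ?m = (\<Prod>j<r. \<Prod>i<Suc (dd j). Q.y z j ^ k j i)"
      unfolding m using that by (simp add: Q.phi_prod Q.phi_power Q.phi_Y del: prod.lessThan_Suc)
    then show ?thesis by (simp only: kk_def power_sum)
  qed
  \<comment> \<open>The values \<open>y_j = z_j / n_j\<close> contribute \<open>n_j^{-k_j}\<close>;
    together with \<open>n_j^{d_j - 1}\<close> from \<open>kappa\<close> this produces the exponent
    \<open>d_j - k_j - 1\<close>.\<close>
  have "Q.phi z ?m / Q.w z = (\<Prod>j<r. of_nat (Suc (dd j)) powi (- int (kk j))) *
      (1 / ((\<Prod>j<r. z j powi (int (dd j) - int (kk j))) * (1 - (\<Sum>j<r. z j))))" if z: "z \<in> Q.Z" for z
  proof -
    have "(\<Prod>j<r. Q.y z j ^ kk j) / (\<Prod>j<r. z j ^ dd j)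
        = (\<Prod>j<r. of_nat (Suc (dd j)) powi (- int (kk j))) / (\<Prod>j<r. z j powi (int (dd j) - int (kk j)))"
      unfolding prod_dividef[symmetric]
      using Q.Z_nz[OF z] by (intro prod.cong) (auto simp: Q.y_def power_int_diff power_int_minus power_divide field_simps simp del: of_nat_Suc)
    then show ?thesis
      by (simp only: phi_m[OF z] Q.w_def divide_divide_eq_left[symmetric] times_divide_eq_right mult_1_right)
  qed
  then have sum: "(\<Sum>z\<in>Q.Z. Q.phi z ?m / Q.w z) = (\<Prod>j<r. of_nat (Suc (dd j)) powi (- int (kk j))) *
      (\<Sum>z\<in>Q.Z. 1 / ((\<Prod>j<r. z j powi (int (dd j) - int (kk j))) * (1 - (\<Sum>j<r. z j))))"
    by (simp add: sum_distrib_left)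
  have "(-1) ^ off dd r * toric_res (Vset r dd) (off dd r) (fpoly r dd a) ?m
     = ((-1) ^ off dd r * (-1) ^ off dd r) * ((\<Prod>j<r. of_nat (Suc (dd j)) powi (int (dd j) - 1)) * (\<Prod>j<r. of_nat (Suc (dd j)) powi (- int (kk j)))) *
      (\<Sum>z\<in>Q.Z. 1 / ((\<Prod>j<r. z j powi (int (dd j) - int (kk j))) * (1 - (\<Sum>j<r. z j))))"
    unfolding res Q.res_def Q.kappa_def if_P[OF mS] sum by (simp only: mult.assoc)
  \<comment> \<open>The sign in the definition of \<open>R_{x^k}\<close> cancels the sign of the
    Hessian carried by \<open>kappa\<close>.\<close>
  also have "(-1) ^ off dd r * (-1) ^ off dd r = (1::complex)" by (simp add: power_add[symmetric])
  also have "(\<Prod>j<r. of_nat (Suc (dd j)) powi (int (dd j) - 1)) * (\<Prod>j<r. of_nat (Suc (dd j)) powi (- int (kk j)))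
     = (\<Prod>j<r. (of_nat (Suc (dd j)) :: complex) powi (int (dd j) - int (kk j) - 1))"
    unfolding prod.distrib[symmetric] by (intro prod.cong) (simp_all add: power_int_add[symmetric] algebra_simps del: of_nat_Suc)
  also have "Q.Z = {z. (\<forall>j<r. z j ^ Suc (dd j) = of_nat (Suc (dd j)) ^ Suc (dd j) * (\<Prod>i<Suc (dd j). a j i)) \<and> (\<forall>j\<ge>r. z j = 0)}"
    by (simp only: Q.Z_def ext_fun_def Q.u_def mem_Collect_eq)
  finally show ?thesis unfolding Let_def d kk_def by (simp only: mult_1)
qed

end
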